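(* Let $A$ and $B$ be small categories. There exist equivalences of categories $$\mathbf{DFib}(A,B)\simeq[B^{\mathrm{op}}\times A,\mathbf{Set}]\simeq\mathbf{DFib}(B\times A^{\mathrm{op}}),$$ pseudo-natural in $A$ and $B$.
   Context: A two-sided discrete fibration (from $A$ to $B$) is a span of functors $A\xleftarrow{q}E\xrightarrow{p}B$ between small categories such that: (i) for each $e\in E$, each arrow $qe\to a'$ in $A$ has a unique lift along $q$ to an arrow of $E$ that has domain $e$ and lies in the fiber over $pe$ (i.e. is sent by $p$ to the identity of $pe$); (ii) for each $e\in E$, each arrow $b'\to pe$ in $B$ has a unique lift along $p$ to an arrow of $E$ that has codomain $e$ and lies in the fiber over $qe$ (i.e. is sent by $q$ to the identity of $qe$); (iii) for each $f\colon e\to e'$ in $E$, the codomain of the lift of $qf$ (as in (i), with domain $e$) equals the domain of the lift of $pf$ (as in (ii), with codomain $e'$), and their composite is $f$. $\mathbf{Span}(A,B)$ is the category of spans of small categories from $A$ to $B$ and functors commuting with both legs; $\mathbf{DFib}(A,B)$ is its full subcategory on the two-sided discrete fibrations. For a small category $C$, a functor $p\colon E\to C$ is a discrete fibration if for each $e\in E$ and arrow $f\colon c'\to pe$ in $C$ there is a unique arrow $g$ of $E$ with codomain $e$ and $pg=f$; $\mathbf{DFib}(C)$ is the full subcategory of $\mathbf{Cat}_{/C}$ on the discrete fibrations. Functors $u\colon A'\to A$ and $v\colon B'\to B$ act on these categories in the usual way: by pullback on $\mathbf{DFib}(A,B)$ and $\mathbf{DFib}(B\times A^{\mathrm{op}})$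 and by precomposition on $[B^{\mathrm{op}}\times A,\mathbf{Set}]$. *)

theory Defs
  imports "HOL-Library.FuncSet" "HOL-Library.Nat_Bijection"
begin

section \<open>Universes\<close>

text \<open>
  A type of class \<open>universe\<close> is the ambient collection from which all small sets are drawn: a small
  set is a set of elements of the type that satisfies \<open>small\<close>. Only the closure properties below
  are required. They hold for the elements of a Grothendieck universe with Kuratowski pairs, when
  \<open>small X\<close> says that \<open>X\<close> is the set of members of some element, but power sets are not needed.
\<close>

class universe =
  fixes small :: "'a set \<Rightarrow> bool"
    and pair :: "'a \<Rightarrow> 'a \<Rightarrow> 'a"
  assumes pair_inject: "pair x y = pair x' y' \<longleftrightarrow> x = x' \<and> y = y'"
    and small_subset: "small X \<Longrightarrow> Y \<subseteq> X \<Longrightarrow> small Y"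
    and small_doubleton: "small {x, y}"
    and small_UN: "small X \<Longrightarrow> (\<And>x. x \<in> X \<Longrightarrow> small (F x)) \<Longrightarrow> small (\<Union>x\<in>X. F x)"

instantiation nat :: universe
begin

definition small_nat :: "nat set \<Rightarrow> bool" where "small_nat X = True"

definition pair_nat :: "nat \<Rightarrow> nat \<Rightarrow> nat" where "pair_nat x y = prod_encode (x, y)"

instance
  by standard (simp_all add: small_nat_def pair_nat_def)

end

definition p1 :: "'u::universe \<Rightarrow> 'u" where
  "p1 z = (THE x. \<exists>y. z = pair x y)"

definition p2 :: "'u::universe \<Rightarrow> 'u" where
  "p2 z = (THE y. \<exists>x. z = pair x y)"

lemma p1_pair [simp]: "p1 (pair x y) = x"
  by (auto simp: p1_def pair_inject)

lemma p2_pair [simp]: "p2 (pair x y) = y"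
  by (auto simp: p2_def pair_inject)


section \<open>Categories, functors, natural transformations\<close>

text \<open>
  \<open>Comp C g f\<close> is the composite \<open>g \<circ> f\<close>. The values of the operations outside \<open>Obj C\<close> and \<open>Arr C\<close>
  are irrelevant and left unconstrained; records that differ only there are isomorphic categories.
\<close>

record ('o, 'a) cat =
  Obj :: "'o set"
  Arr :: "'a set"
  Dom :: "'a \<Rightarrow> 'o"
  Cod :: "'a \<Rightarrow> 'o"
  Ident :: "'o \<Rightarrow> 'a"
  Comp :: "'a \<Rightarrow> 'a \<Rightarrow> 'a"

definition hom :: "('o, 'a) cat \<Rightarrow> 'o \<Rightarrow> 'o \<Rightarrow> 'a set" where
  "hom C x y = {f \<in> Arr C. Dom C f = x \<and> Cod C f = y}"

definition category :: "('o, 'a) cat \<Rightarrow> bool" where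
  "category C \<longleftrightarrow>
    (\<forall>f\<in>Arr C. Dom C f \<in> Obj C \<and> Cod C f \<in> Obj C) \<and>
    (\<forall>x\<in>Obj C. Ident C x \<in> hom C x x) \<and>
    (\<forall>f\<in>Arr C. \<forall>g\<in>Arr C. Cod C f = Dom C g \<longrightarrow> Comp C g f \<in> hom C (Dom C f) (Cod C g)) \<and>
    (\<forall>f\<in>Arr C. Comp C f (Ident C (Dom C f)) = f \<and> Comp C (Ident C (Cod C f)) f = f) \<and>
    (\<forall>f\<in>Arr C. \<forall>g\<in>Arr C. \<forall>h\<in>Arr C. Cod C f = Dom C g \<and> Cod C g = Dom C h \<longrightarrow>
      Comp C h (Comp C g f) = Comp C (Comp C h g) f)"

definition iso :: "('o, 'a) cat \<Rightarrow> 'a \<Rightarrow> bool" where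
  "iso C f \<longleftrightarrow> f \<in> Arr C \<and> (\<exists>g \<in> hom C (Cod C f) (Dom C f).
      Comp C g f = Ident C (Dom C f) \<and> Comp C f g = Ident C (Cod C f))"

definition op_cat :: "('o, 'a) cat \<Rightarrow> ('o, 'a) cat" where
  "op_cat C = \<lparr>Obj = Obj C, Arr = Arr C, Dom = Cod C, Cod = Dom C, Ident = Ident C,
     Comp = (\<lambda>g f. Comp C f g)\<rparr>"

definition full_subcat :: "('o, 'a) cat \<Rightarrow> 'o set \<Rightarrow> ('o, 'a) cat" where
  "full_subcat C X = \<lparr>Obj = Obj C \<inter> X, Arr = {f \<in> Arr C. Dom C f \<in> X \<and> Cod C f \<in> X},
     Dom = Dom C, Cod = Cod C, Ident = Ident C, Comp = Comp C\<rparr>"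

definition times_cat :: "('o, 'a) cat \<Rightarrow> ('p, 'b) cat \<Rightarrow> ('o \<times> 'p, 'a \<times> 'b) cat" where
  "times_cat C D = \<lparr>Obj = Obj C \<times> Obj D, Arr = Arr C \<times> Arr D,
     Dom = map_prod (Dom C) (Dom D), Cod = map_prod (Cod C) (Cod D),
     Ident = map_prod (Ident C) (Ident D),
     Comp = (\<lambda>(g, g') (f, f'). (Comp C g f, Comp D g' f'))\<rparr>"

text \<open>
  Functors carry their source and target, and their maps are extensional (\<open>undefined\<close> off the
  source), so that equality of records is equality of functors; likewise for natural
  transformations.
\<close>

record ('o, 'a, 'p, 'b) func =
  Src :: "('o, 'a) cat"
  Tgt :: "('p, 'b) cat"
  FO :: "'o \<Rightarrow> 'p"
  FA :: "'a \<Rightarrow> 'b"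

definition is_functor :: "('o, 'a, 'p, 'b) func \<Rightarrow> bool" where
  "is_functor F \<longleftrightarrow>
    category (Src F) \<and> category (Tgt F) \<and>
    FO F \<in> Obj (Src F) \<rightarrow>\<^sub>E Obj (Tgt F) \<and> FA F \<in> Arr (Src F) \<rightarrow>\<^sub>E Arr (Tgt F) \<and>
    (\<forall>f\<in>Arr (Src F). FA F f \<in> hom (Tgt F) (FO F (Dom (Src F) f)) (FO F (Cod (Src F) f))) \<and>
    (\<forall>x\<in>Obj (Src F). FA F (Ident (Src F) x) = Ident (Tgt F) (FO F x)) \<and>
    (\<forall>f\<in>Arr (Src F). \<forall>g\<in>Arr (Src F). Cod (Src F) f = Dom (Src F) g \<longrightarrow>
      FA F (Comp (Src F) g f) = Comp (Tgt F) (FA F g) (FA F f))"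

definition functor_between ::
  "('o, 'a, 'p, 'b) func \<Rightarrow> ('o, 'a) cat \<Rightarrow> ('p, 'b) cat \<Rightarrow> bool" where
  "functor_between F C D \<longleftrightarrow> is_functor F \<and> Src F = C \<and> Tgt F = D"

definition id_func :: "('o, 'a) cat \<Rightarrow> ('o, 'a, 'o, 'a) func" where
  "id_func C = \<lparr>Src = C, Tgt = C, FO = restrict (\<lambda>x. x) (Obj C), FA = restrict (\<lambda>f. f) (Arr C)\<rparr>"

definition comp_func ::
  "('p, 'b, 'q, 'c) func \<Rightarrow> ('o, 'a, 'p, 'b) func \<Rightarrow> ('o, 'a, 'q, 'c) func" where
  "comp_func G F = \<lparr>Src = Src F, Tgt = Tgt G,
     FO = compose (Obj (Src F)) (FO G) (FO F), FA = compose (Arr (Src F)) (FA G) (FA F)\<rparr>"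

definition op_func :: "('o, 'a, 'p, 'b) func \<Rightarrow> ('o, 'a, 'p, 'b) func" where
  "op_func F = \<lparr>Src = op_cat (Src F), Tgt = op_cat (Tgt F), FO = FO F, FA = FA F\<rparr>"

record ('o, 'a, 'p, 'b) nt =
  NSrc :: "('o, 'a, 'p, 'b) func"
  NTgt :: "('o, 'a, 'p, 'b) func"
  NC :: "'o \<Rightarrow> 'b"

definition is_nt :: "('o, 'a, 'p, 'b) nt \<Rightarrow> bool" where
  "is_nt \<alpha> \<longleftrightarrow> (let F = NSrc \<alpha>; G = NTgt \<alpha>; C = Src F; D = Tgt F in
    is_functor F \<and> is_functor G \<and> Src G = C \<and> Tgt G = D \<and>
    NC \<alpha> \<in> extensional (Obj C) \<and>
    (\<forall>x\<in>Obj C. NC \<alpha> x \<in> hom D (FO F x) (FO G x)) \<and>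
    (\<forall>f\<in>Arr C. Comp D (NC \<alpha> (Cod C f)) (FA F f) = Comp D (FA G f) (NC \<alpha> (Dom C f))))"

definition nat_iso ::
  "('o, 'a, 'p, 'b) nt \<Rightarrow> ('o, 'a, 'p, 'b) func \<Rightarrow> ('o, 'a, 'p, 'b) func \<Rightarrow> bool" where
  "nat_iso \<alpha> F G \<longleftrightarrow> is_nt \<alpha> \<and> NSrc \<alpha> = F \<and> NTgt \<alpha> = G \<and>
    (\<forall>x\<in>Obj (Src F). iso (Tgt F) (NC \<alpha> x))"

definition func_cat :: "('o, 'a) cat \<Rightarrow> ('p, 'b) cat \<Rightarrow>
    (('o, 'a, 'p, 'b) func, ('o, 'a, 'p, 'b) nt) cat" where
  "func_cat C D = \<lparr>Obj = {F. functor_between F C D},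
     Arr = {\<alpha>. is_nt \<alpha> \<and> functor_between (NSrc \<alpha>) C D},
     Dom = NSrc, Cod = NTgt,
     Ident = (\<lambda>F. \<lparr>NSrc = F, NTgt = F, NC = restrict (\<lambda>x. Ident D (FO F x)) (Obj C)\<rparr>),
     Comp = (\<lambda>\<beta> \<alpha>. \<lparr>NSrc = NSrc \<alpha>, NTgt = NTgt \<beta>,
       NC = restrict (\<lambda>x. Comp D (NC \<beta> x) (NC \<alpha> x)) (Obj C)\<rparr>)\<rparr>"

definition equivalence :: "('o, 'a, 'p, 'b) func \<Rightarrow> bool" where
  "equivalence F \<longleftrightarrow> is_functor F \<and> (\<exists>G \<eta> \<epsilon>. functor_between G (Tgt F) (Src F) \<and>
    nat_iso \<eta> (id_func (Src F)) (comp_func G F) \<and>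
    nat_iso \<epsilon> (comp_func F G) (id_func (Tgt F)))"

definition slice_cat :: "('o, 'a) cat \<Rightarrow> 'o \<Rightarrow> ('a, 'a \<times> 'a \<times> 'a) cat" where
  "slice_cat K c = \<lparr>Obj = {p \<in> Arr K. Cod K p = c},
     Arr = {(p, h, p'). p \<in> Arr K \<and> Cod K p = c \<and> p' \<in> Arr K \<and> Cod K p' = c \<and>
       h \<in> hom K (Dom K p) (Dom K p') \<and> Comp K p' h = p},
     Dom = (\<lambda>(p, h, p'). p), Cod = (\<lambda>(p, h, p'). p'),
     Ident = (\<lambda>p. (p, Ident K (Dom K p), p)),
     Comp = (\<lambda>(p', h', p'') (p, h, q). (p, Comp K h' h, p''))\<rparr>"

text \<open>A span \<open>A \<leftarrow> E \<rightarrow> B\<close> is the pair \<open>(q, p)\<close> of its legs \<open>q : E \<rightarrow> A\<close> and \<open>p : E \<rightarrow> B\<close>.\<close>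

definition span_cat ::
  "('o, 'a) cat \<Rightarrow> 'o \<Rightarrow> 'o \<Rightarrow> ('a \<times> 'a, ('a \<times> 'a) \<times> 'a \<times> ('a \<times> 'a)) cat" where
  "span_cat K a b = (let S = {(q, p). q \<in> Arr K \<and> p \<in> Arr K \<and> Dom K q = Dom K p \<and>
                                 Cod K q = a \<and> Cod K p = b} in
     \<lparr>Obj = S,
      Arr = {((q, p), h, (q', p')). (q, p) \<in> S \<and> (q', p') \<in> S \<and> h \<in> hom K (Dom K q) (Dom K q') \<and>
        Comp K q' h = q \<and> Comp K p' h = p},
      Dom = (\<lambda>(s, h, t). s), Cod = (\<lambda>(s, h, t). t),
      Ident = (\<lambda>s. (s, Ident K (Dom K (fst s)), s)),
      Comp = (\<lambda>(s', h', t') (s, h, t). (s, Comp K h' h, t'))\<rparr>)"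


section \<open>Small categories and small sets\<close>

type_synonym 'u scat = "('u, 'u) cat"
type_synonym 'u sfunc = "('u, 'u, 'u, 'u) func"

definition small_cat :: "('u::universe) scat \<Rightarrow> bool" where
  "small_cat C \<longleftrightarrow> category C \<and> small (Obj C) \<and> small (Arr C)"

definition Cat :: "(('u::universe) scat, 'u sfunc) cat" where
  "Cat = \<lparr>Obj = {C. small_cat C},
     Arr = {F. is_functor F \<and> small_cat (Src F) \<and> small_cat (Tgt F)},
     Dom = Src, Cod = Tgt, Ident = id_func, Comp = comp_func\<rparr>"

type_synonym 'u setfun = "'u set \<times> ('u \<Rightarrow> 'u) \<times> 'u set"

definition Set :: "(('u::universe) set, 'u setfun) cat" where
  "Set = \<lparr>Obj = {X. small X},
     Arr = {(X, f, Y). small X \<and> small Y \<and> f \<in> X \<rightarrow>\<^sub>E Y},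
     Dom = (\<lambda>(X, f, Y). X), Cod = (\<lambda>(X, f, Y). Y),
     Ident = (\<lambda>X. (X, restrict (\<lambda>x. x) X, X)),
     Comp = (\<lambda>(Y', g, Z) (X, f, Y). (X, compose X g f, Z))\<rparr>"

text \<open>
  Unlike \<open>times_cat\<close>, this product encodes pairs inside the universe, so that the product of small
  categories is again a small category over the same type.
\<close>

definition prod_cat :: "('u::universe) scat \<Rightarrow> 'u scat \<Rightarrow> 'u scat" where
  "prod_cat C D = \<lparr>Obj = {pair x y | x y. x \<in> Obj C \<and> y \<in> Obj D},
     Arr = {pair f g | f g. f \<in> Arr C \<and> g \<in> Arr D},
     Dom = (\<lambda>h. pair (Dom C (p1 h)) (Dom D (p2 h))),
     Cod = (\<lambda>h. pair (Cod C (p1 h)) (Cod D (p2 h))),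
     Ident = (\<lambda>z. pair (Ident C (p1 z)) (Ident D (p2 z))),
     Comp = (\<lambda>k h. pair (Comp C (p1 k) (p1 h)) (Comp D (p2 k) (p2 h)))\<rparr>"

definition proj1 :: "('u::universe) scat \<Rightarrow> 'u scat \<Rightarrow> 'u sfunc" where
  "proj1 C D = \<lparr>Src = prod_cat C D, Tgt = C,
     FO = restrict p1 (Obj (prod_cat C D)), FA = restrict p1 (Arr (prod_cat C D))\<rparr>"

definition proj2 :: "('u::universe) scat \<Rightarrow> 'u scat \<Rightarrow> 'u sfunc" where
  "proj2 C D = \<lparr>Src = prod_cat C D, Tgt = D,
     FO = restrict p2 (Obj (prod_cat C D)), FA = restrict p2 (Arr (prod_cat C D))\<rparr>"

definition tuple_func :: "('u::universe) sfunc \<Rightarrow> 'u sfunc \<Rightarrow> 'u sfunc" where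
  "tuple_func F G = \<lparr>Src = Src F, Tgt = prod_cat (Tgt F) (Tgt G),
     FO = restrict (\<lambda>x. pair (FO F x) (FO G x)) (Obj (Src F)),
     FA = restrict (\<lambda>f. pair (FA F f) (FA G f)) (Arr (Src F))\<rparr>"

definition prod_func :: "('u::universe) sfunc \<Rightarrow> 'u sfunc \<Rightarrow> 'u sfunc" where
  "prod_func F G = tuple_func (comp_func F (proj1 (Src F) (Src G)))
                              (comp_func G (proj2 (Src F) (Src G)))"


section \<open>Pullbacks of small categories\<close>

text \<open>
  The pullback of \<open>p : E \<rightarrow> C\<close> along \<open>w : C' \<rightarrow> C\<close>, with objects \<open>pair c' e\<close> such that \<open>w c' = p e\<close>.
\<close>

definition pb_cat :: "('u::universe) sfunc \<Rightarrow> 'u sfunc \<Rightarrow> 'u scat" where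
  "pb_cat w p = (prod_cat (Src w) (Src p))
     \<lparr>Obj := {pair c e | c e. c \<in> Obj (Src w) \<and> e \<in> Obj (Src p) \<and> FO w c = FO p e},
      Arr := {pair f g | f g. f \<in> Arr (Src w) \<and> g \<in> Arr (Src p) \<and> FA w f = FA p g}\<rparr>"

definition pb_proj :: "('u::universe) sfunc \<Rightarrow> 'u sfunc \<Rightarrow> 'u sfunc" where
  "pb_proj w p = \<lparr>Src = pb_cat w p, Tgt = Src w,
     FO = restrict p1 (Obj (pb_cat w p)), FA = restrict p1 (Arr (pb_cat w p))\<rparr>"

text \<open>The functor between the pullbacks of \<open>p\<close> and \<open>p'\<close> induced by \<open>h\<close> with \<open>p' \<circ> h = p\<close>.\<close>

definition pb_map :: "('u::universe) sfunc \<Rightarrow> 'u sfunc \<Rightarrow> 'u sfunc \<Rightarrow> 'u sfunc \<Rightarrow> 'u sfunc" where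
  "pb_map w p h p' = \<lparr>Src = pb_cat w p, Tgt = pb_cat w p',
     FO = restrict (\<lambda>z. pair (p1 z) (FO h (p2 z))) (Obj (pb_cat w p)),
     FA = restrict (\<lambda>z. pair (p1 z) (FA h (p2 z))) (Arr (pb_cat w p))\<rparr>"

text \<open>
  The canonical comparisons: of \<open>p\<close> with its pullback along the identity, and of the pullback along
  \<open>w'\<close> of the pullback along \<open>w\<close> with the pullback along \<open>w \<circ> w'\<close>.
\<close>

definition pb_unit :: "('u::universe) sfunc \<Rightarrow> 'u sfunc" where
  "pb_unit p = \<lparr>Src = Src p, Tgt = pb_cat (id_func (Tgt p)) p,
     FO = restrict (\<lambda>e. pair (FO p e) e) (Obj (Src p)),
     FA = restrict (\<lambda>g. pair (FA p g) g) (Arr (Src p))\<rparr>"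

definition pb_cmp :: "('u::universe) sfunc \<Rightarrow> 'u sfunc \<Rightarrow> 'u sfunc \<Rightarrow> 'u sfunc" where
  "pb_cmp w w' p = (let E = pb_cat w' (pb_proj w p) in
     \<lparr>Src = E, Tgt = pb_cat (comp_func w w') p,
      FO = restrict (\<lambda>z. pair (p1 z) (p2 (p2 z))) (Obj E),
      FA = restrict (\<lambda>z. pair (p1 z) (p2 (p2 z))) (Arr E)\<rparr>)"


section \<open>Discrete fibrations\<close>

definition discrete_fibration :: "('u::universe) sfunc \<Rightarrow> bool" where
  "discrete_fibration p \<longleftrightarrow> is_functor p \<and>
    (\<forall>e\<in>Obj (Src p). \<forall>f\<in>Arr (Tgt p). Cod (Tgt p) f = FO p e \<longrightarrow>
      (\<exists>!g. g \<in> Arr (Src p) \<and> Cod (Src p) g = e \<and> FA p g = f))"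

definition DFib :: "('u::universe) scat \<Rightarrow> ('u sfunc, 'u sfunc \<times> 'u sfunc \<times> 'u sfunc) cat" where
  "DFib C = full_subcat (slice_cat Cat C) {p. discrete_fibration p}"

definition is_left_lift ::
  "('u::universe) sfunc \<Rightarrow> 'u sfunc \<Rightarrow> 'u \<Rightarrow> 'u \<Rightarrow> 'u \<Rightarrow> bool" where
  "is_left_lift q p e f g \<longleftrightarrow> g \<in> Arr (Src q) \<and> Dom (Src q) g = e \<and> FA q g = f \<and>
     FA p g = Ident (Tgt p) (FO p e)"

definition is_right_lift ::
  "('u::universe) sfunc \<Rightarrow> 'u sfunc \<Rightarrow> 'u \<Rightarrow> 'u \<Rightarrow> 'u \<Rightarrow> bool" where
  "is_right_lift q p e f g \<longleftrightarrow> g \<in> Arr (Src q) \<and> Cod (Src q) g = e \<and> FA p g = f \<and>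
     FA q g = Ident (Tgt q) (FO q e)"

definition two_sided_discrete_fibration :: "('u::universe) sfunc \<Rightarrow> 'u sfunc \<Rightarrow> bool" where
  "two_sided_discrete_fibration q p \<longleftrightarrow>
    is_functor q \<and> is_functor p \<and> Src q = Src p \<and>
    (\<forall>e\<in>Obj (Src q). \<forall>f\<in>Arr (Tgt q). Dom (Tgt q) f = FO q e \<longrightarrow> (\<exists>!g. is_left_lift q p e f g)) \<and>
    (\<forall>e\<in>Obj (Src q). \<forall>f\<in>Arr (Tgt p). Cod (Tgt p) f = FO p e \<longrightarrow> (\<exists>!g. is_right_lift q p e f g)) \<and>
    (\<forall>h\<in>Arr (Src q).
      let l = (THE g. is_left_lift q p (Dom (Src q) h) (FA q h) g);
          r = (THE g. is_right_lift q p (Cod (Src q) h) (FA p h) g)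
      in Cod (Src q) l = Dom (Src q) r \<and> Comp (Src q) r l = h)"

type_synonym 'u span = "'u sfunc \<times> 'u sfunc"

definition DFib2 :: "('u::universe) scat \<Rightarrow> 'u scat \<Rightarrow>
    ('u span, 'u span \<times> 'u sfunc \<times> 'u span) cat" where
  "DFib2 A B = full_subcat (span_cat Cat A B) {(q, p). two_sided_discrete_fibration q p}"


section \<open>Pseudofunctors and pseudonatural equivalences\<close>

text \<open>
  A contravariant pseudofunctor \<open>P\<close> from a category \<open>K\<close> to categories: for \<open>w : k' \<rightarrow> k\<close> in \<open>K\<close> the
  functor \<open>act P w\<close> goes from \<open>fib P k\<close> to \<open>fib P k'\<close>, with invertible comparison cells
  \<open>unitor P k : 1 \<Rightarrow> act P 1\<close> and \<open>compositor P w w' : act P w' \<circ> act P w \<Rightarrow> act P (w \<circ> w')\<close>.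
\<close>

record ('k, 'l, 'o, 'a) psf =
  fib :: "'k \<Rightarrow> ('o, 'a) cat"
  act :: "'l \<Rightarrow> ('o, 'a, 'o, 'a) func"
  unitor :: "'k \<Rightarrow> ('o, 'a, 'o, 'a) nt"
  compositor :: "'l \<Rightarrow> 'l \<Rightarrow> ('o, 'a, 'o, 'a) nt"

definition pseudofunctor :: "('k, 'l) cat \<Rightarrow> ('k, 'l, 'o, 'a) psf \<Rightarrow> bool" where
  "pseudofunctor K P \<longleftrightarrow> category K \<and>
    (\<forall>k\<in>Obj K. category (fib P k)) \<and>
    (\<forall>w\<in>Arr K. functor_between (act P w) (fib P (Cod K w)) (fib P (Dom K w))) \<and>
    (\<forall>k\<in>Obj K. nat_iso (unitor P k) (id_func (fib P k)) (act P (Ident K k))) \<and>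
    (\<forall>w\<in>Arr K. \<forall>w'\<in>Arr K. Cod K w' = Dom K w \<longrightarrow>
      nat_iso (compositor P w w') (comp_func (act P w') (act P w)) (act P (Comp K w w'))) \<and>
    (\<forall>w\<in>Arr K. \<forall>X\<in>Obj (fib P (Cod K w)).
      Comp (fib P (Dom K w)) (NC (compositor P w (Ident K (Dom K w))) X)
          (NC (unitor P (Dom K w)) (FO (act P w) X))
        = Ident (fib P (Dom K w)) (FO (act P w) X) \<and>
      Comp (fib P (Dom K w)) (NC (compositor P (Ident K (Cod K w)) w) X)
          (FA (act P w) (NC (unitor P (Cod K w)) X))
        = Ident (fib P (Dom K w)) (FO (act P w) X)) \<and>
    (\<forall>w\<in>Arr K. \<forall>w'\<in>Arr K. \<forall>w''\<in>Arr K. \<forall>X\<in>Obj (fib P (Cod K w)).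
      Cod K w' = Dom K w \<and> Cod K w'' = Dom K w' \<longrightarrow>
      Comp (fib P (Dom K w'')) (NC (compositor P (Comp K w w') w'') X)
          (FA (act P w'') (NC (compositor P w w') X))
        = Comp (fib P (Dom K w'')) (NC (compositor P w (Comp K w' w'')) X)
          (NC (compositor P w' w'') (FO (act P w) X)))"

text \<open>
  The invertible cell of a pseudonatural transformation \<open>\<Phi>\<close> at \<open>w : k' \<rightarrow> k\<close> is
  \<open>\<theta> w : \<Phi> k' \<circ> act P w \<Rightarrow> act Q w \<circ> \<Phi> k\<close>.
\<close>

definition pseudonatural ::
  "('k, 'l) cat \<Rightarrow> ('k, 'l, 'o, 'a) psf \<Rightarrow> ('k, 'l, 'p, 'b) psf \<Rightarrow>
   ('k \<Rightarrow> ('o, 'a, 'p, 'b) func) \<Rightarrow> ('l \<Rightarrow> ('o, 'a, 'p, 'b) nt) \<Rightarrow> bool" where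
  "pseudonatural K P Q \<Phi> \<theta> \<longleftrightarrow> pseudofunctor K P \<and> pseudofunctor K Q \<and>
    (\<forall>k\<in>Obj K. functor_between (\<Phi> k) (fib P k) (fib Q k)) \<and>
    (\<forall>w\<in>Arr K. nat_iso (\<theta> w) (comp_func (\<Phi> (Dom K w)) (act P w))
                              (comp_func (act Q w) (\<Phi> (Cod K w)))) \<and>
    (\<forall>k\<in>Obj K. \<forall>X\<in>Obj (fib P k).
      Comp (fib Q k) (NC (\<theta> (Ident K k)) X) (FA (\<Phi> k) (NC (unitor P k) X))
        = NC (unitor Q k) (FO (\<Phi> k) X)) \<and>
    (\<forall>w\<in>Arr K. \<forall>w'\<in>Arr K. \<forall>X\<in>Obj (fib P (Cod K w)). Cod K w' = Dom K w \<longrightarrow>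
      Comp (fib Q (Dom K w')) (NC (\<theta> (Comp K w w')) X)
          (FA (\<Phi> (Dom K w')) (NC (compositor P w w') X))
        = Comp (fib Q (Dom K w')) (NC (compositor Q w w') (FO (\<Phi> (Cod K w)) X))
          (Comp (fib Q (Dom K w')) (FA (act Q w') (NC (\<theta> w) X))
            (NC (\<theta> w') (FO (act P w) X))))"

definition pseudonatural_equivalence ::
  "('k, 'l) cat \<Rightarrow> ('k, 'l, 'o, 'a) psf \<Rightarrow> ('k, 'l, 'p, 'b) psf \<Rightarrow>
   ('k \<Rightarrow> ('o, 'a, 'p, 'b) func) \<Rightarrow> ('l \<Rightarrow> ('o, 'a, 'p, 'b) nt) \<Rightarrow> bool" where
  "pseudonatural_equivalence K P Q \<Phi> \<theta> \<longleftrightarrow>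
    pseudonatural K P Q \<Phi> \<theta> \<and> (\<forall>k\<in>Obj K. equivalence (\<Phi> k))"


section \<open>The actions of functors\<close>

text \<open>Pullback of discrete fibrations along \<open>w : C' \<rightarrow> C\<close>.\<close>

type_synonym 'u dfib_func =
  "('u sfunc, 'u sfunc \<times> 'u sfunc \<times> 'u sfunc, 'u sfunc, 'u sfunc \<times> 'u sfunc \<times> 'u sfunc) func"
type_synonym 'u dfib_nt =
  "('u sfunc, 'u sfunc \<times> 'u sfunc \<times> 'u sfunc, 'u sfunc, 'u sfunc \<times> 'u sfunc \<times> 'u sfunc) nt"

definition DFib_act :: "('u::universe) sfunc \<Rightarrow> 'u dfib_func" where
  "DFib_act w = \<lparr>Src = DFib (Tgt w), Tgt = DFib (Src w),
     FO = restrict (pb_proj w) (Obj (DFib (Tgt w))),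
     FA = restrict (\<lambda>(p, h, p'). (pb_proj w p, pb_map w p h p', pb_proj w p')) (Arr (DFib (Tgt w)))\<rparr>"

definition DFib_unitor :: "('u::universe) scat \<Rightarrow> 'u dfib_nt" where
  "DFib_unitor C = \<lparr>NSrc = id_func (DFib C), NTgt = DFib_act (id_func C),
     NC = restrict (\<lambda>p. (p, pb_unit p, pb_proj (id_func C) p)) (Obj (DFib C))\<rparr>"

definition DFib_compositor :: "('u::universe) sfunc \<Rightarrow> 'u sfunc \<Rightarrow> 'u dfib_nt" where
  "DFib_compositor w w' = \<lparr>NSrc = comp_func (DFib_act w') (DFib_act w),
     NTgt = DFib_act (comp_func w w'),
     NC = restrict (\<lambda>p. (pb_proj w' (pb_proj w p), pb_cmp w w' p, pb_proj (comp_func w w') p))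
            (Obj (DFib (Tgt w)))\<rparr>"

text \<open>
  Pullback of spans along \<open>u : A' \<rightarrow> A\<close> and \<open>v : B' \<rightarrow> B\<close>: the apex \<open>A' \<times>\<^sub>A E \<times>\<^sub>B B'\<close> is formed as the
  pullback of \<open>\<langle>q, p\<rangle> : E \<rightarrow> A \<times> B\<close> along \<open>u \<times> v\<close>.
\<close>

definition span_pb :: "('u::universe) sfunc \<Rightarrow> 'u sfunc \<Rightarrow> 'u span \<Rightarrow> 'u span" where
  "span_pb u v = (\<lambda>(q, p). let r = pb_proj (prod_func u v) (tuple_func q p) in
     (comp_func (proj1 (Src u) (Src v)) r, comp_func (proj2 (Src u) (Src v)) r))"

type_synonym 'u dfib2_func =
  "('u span, 'u span \<times> 'u sfunc \<times> 'u span, 'u span, 'u span \<times> 'u sfunc \<times> 'u span) func"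
type_synonym 'u dfib2_nt =
  "('u span, 'u span \<times> 'u sfunc \<times> 'u span, 'u span, 'u span \<times> 'u sfunc \<times> 'u span) nt"

definition DFib2_act :: "('u::universe) sfunc \<Rightarrow> 'u sfunc \<Rightarrow> 'u dfib2_func" where
  "DFib2_act u v = \<lparr>Src = DFib2 (Tgt u) (Tgt v), Tgt = DFib2 (Src u) (Src v),
     FO = restrict (span_pb u v) (Obj (DFib2 (Tgt u) (Tgt v))),
     FA = restrict
       (\<lambda>((q, p), h, (q', p')). (span_pb u v (q, p),
          pb_map (prod_func u v) (tuple_func q p) h (tuple_func q' p'), span_pb u v (q', p')))
       (Arr (DFib2 (Tgt u) (Tgt v)))\<rparr>"

definition DFib2_unitor :: "('u::universe) scat \<Rightarrow> 'u scat \<Rightarrow> 'u dfib2_nt" where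
  "DFib2_unitor A B = \<lparr>NSrc = id_func (DFib2 A B), NTgt = DFib2_act (id_func A) (id_func B),
     NC = restrict
       (\<lambda>(q, p). ((q, p), pb_unit (tuple_func q p), span_pb (id_func A) (id_func B) (q, p)))
       (Obj (DFib2 A B))\<rparr>"

definition DFib2_compositor ::
  "('u::universe) sfunc \<Rightarrow> 'u sfunc \<Rightarrow> 'u sfunc \<Rightarrow> 'u sfunc \<Rightarrow> 'u dfib2_nt" where
  "DFib2_compositor u v u' v' = \<lparr>NSrc = comp_func (DFib2_act u' v') (DFib2_act u v),
     NTgt = DFib2_act (comp_func u u') (comp_func v v'),
     NC = restrict
       (\<lambda>(q, p). (span_pb u' v' (span_pb u v (q, p)),
          pb_cmp (prod_func u v) (prod_func u' v') (tuple_func q p),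
          span_pb (comp_func u u') (comp_func v v') (q, p)))
       (Obj (DFib2 (Tgt u) (Tgt v)))\<rparr>"

text \<open>Precomposition of \<open>Set\<close>-valued functors with \<open>w : C' \<rightarrow> C\<close>.\<close>

type_synonym 'u copsh = "('u, 'u, 'u set, 'u setfun) func"
type_synonym 'u copsh_nt = "('u, 'u, 'u set, 'u setfun) nt"

definition precomp :: "('u::universe) sfunc \<Rightarrow> ('u copsh, 'u copsh_nt, 'u copsh, 'u copsh_nt) func" where
  "precomp w = \<lparr>Src = func_cat (Tgt w) Set, Tgt = func_cat (Src w) Set,
     FO = restrict (\<lambda>X. comp_func X w) (Obj (func_cat (Tgt w) Set)),
     FA = restrict (\<lambda>\<alpha>. \<lparr>NSrc = comp_func (NSrc \<alpha>) w, NTgt = comp_func (NTgt \<alpha>) w,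
            NC = compose (Obj (Src w)) (NC \<alpha>) (FO w)\<rparr>) (Arr (func_cat (Tgt w) Set))\<rparr>"

text \<open>The family of identity arrows, as a transformation between functors that agree.\<close>

definition id_nt ::
  "('o, 'a, 'p, 'b) func \<Rightarrow> ('o, 'a, 'p, 'b) func \<Rightarrow> ('o, 'a, 'p, 'b) nt" where
  "id_nt F G = \<lparr>NSrc = F, NTgt = G, NC = restrict (\<lambda>x. Ident (Tgt F) (FO F x)) (Obj (Src F))\<rparr>"


section \<open>The three pseudofunctors in \<open>A\<close> and \<open>B\<close>\<close>

text \<open>All are indexed by pairs \<open>(A, B)\<close> of small categories and pairs \<open>(u, v)\<close> of functors.\<close>

definition DFib_span :: "(('u::universe) scat \<times> 'u scat, 'u sfunc \<times> 'u sfunc,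
    'u span, 'u span \<times> 'u sfunc \<times> 'u span) psf" where
  "DFib_span = \<lparr>fib = (\<lambda>(A, B). DFib2 A B),
     act = (\<lambda>(u, v). DFib2_act u v),
     unitor = (\<lambda>(A, B). DFib2_unitor A B),
     compositor = (\<lambda>(u, v) (u', v'). DFib2_compositor u v u' v')\<rparr>"

definition Prof :: "(('u::universe) scat \<times> 'u scat, 'u sfunc \<times> 'u sfunc,
    'u copsh, 'u copsh_nt) psf" where
  "Prof = \<lparr>fib = (\<lambda>(A, B). func_cat (prod_cat (op_cat B) A) Set),
     act = (\<lambda>(u, v). precomp (prod_func (op_func v) u)),
     unitor = (\<lambda>(A, B). id_nt (id_func (func_cat (prod_cat (op_cat B) A) Set))
                          (precomp (prod_func (op_func (id_func B)) (id_func A)))),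
     compositor = (\<lambda>(u, v) (u', v').
       id_nt (comp_func (precomp (prod_func (op_func v') u')) (precomp (prod_func (op_func v) u)))
         (precomp (prod_func (op_func (comp_func v v')) (comp_func u u'))))\<rparr>"

definition DFib_prod :: "(('u::universe) scat \<times> 'u scat, 'u sfunc \<times> 'u sfunc,
    'u sfunc, 'u sfunc \<times> 'u sfunc \<times> 'u sfunc) psf" where
  "DFib_prod = \<lparr>fib = (\<lambda>(A, B). DFib (prod_cat B (op_cat A))),
     act = (\<lambda>(u, v). DFib_act (prod_func v (op_func u))),
     unitor = (\<lambda>(A, B). DFib_unitor (prod_cat B (op_cat A))),
     compositor = (\<lambda>(u, v) (u', v').
       DFib_compositor (prod_func v (op_func u)) (prod_func v' (op_func u')))\<rparr>"

end

theory Submission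
  imports Defs
begin

text \<open>
  A two-sided discrete fibration \<open>(q, p)\<close> is sent to the profunctor of its fibres, on which arrows of
  \<open>A\<close> act by pushing forward along left lifts and arrows of \<open>B\<close> by pulling back along right lifts; the
  two actions commute because the composite of a right and a left lift factors again as a left lift
  followed by a right lift. By the same factorization an arrow of the apex is determined by its ends and
  its images in \<open>A\<close> and \<open>B\<close>, so a natural family of maps of fibres extends uniquely to a map of spans.
  Every profunctor arises from its two-sided category of elements.

  A profunctor is also a presheaf on \<open>C = B \<times> A\<^sup>o\<^sup>p\<close>. The second equivalence is therefore the classical one
  between presheaves on \<open>C\<close> and discrete fibrations over \<open>C\<close>, pseudonatural in \<open>C\<close>, reindexed along
  \<open>(A, B) \<mapsto> B \<times> A\<^sup>o\<^sup>p\<close>.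
\<close>

text \<open>\<open>Fib\<close> sends spans to profunctors and \<open>El\<close> sends presheaves to
  discrete fibrations, so both point along the chain of the theorem. No inverse is written down:
  \<open>equivalenceI\<close> asks only for a full, faithful and essentially surjective functor.
  What shapes the rest is coherence. Precomposition is strictly functorial, so all structural cells
  on the presheaf side are identities, whereas pullback along a composite agrees with iterated
  pullback only after encoded pairs are rearranged. These rearrangements are studied once, for the
  pullback of a functor over any base. A span is then read as a single functor into the product of
  its two feet, on which \<open>(u, v)\<close> acts by pullback along \<open>prod_func u v\<close>;
  in this way the same identities serve \<open>DFib\<close> and \<open>DFib2\<close>. The cells that
  compare fibrations with presheaves merely insert or drop a coordinate that is determined by the
  others, so that each coherence law is checked by following one typical element through both
  composites.\<close>

lemma in_hom: "f \<in> hom C x y \<longleftrightarrow> f \<in> Arr C \<and> Dom C f = x \<and> Cod C f = y"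
  by (simp add: hom_def)

lemma categoryI:
  assumes "\<And>f. f \<in> Arr C \<Longrightarrow> Dom C f \<in> Obj C"
    and "\<And>f. f \<in> Arr C \<Longrightarrow> Cod C f \<in> Obj C"
    and "\<And>x. x \<in> Obj C \<Longrightarrow> Ident C x \<in> Arr C"
    and "\<And>x. x \<in> Obj C \<Longrightarrow> Dom C (Ident C x) = x"
    and "\<And>x. x \<in> Obj C \<Longrightarrow> Cod C (Ident C x) = x"
    and "\<And>f g. f \<in> Arr C \<Longrightarrow> g \<in> Arr C \<Longrightarrow> Cod C f = Dom C g \<Longrightarrow> Comp C g f \<in> Arr C"
    and "\<And>f g. f \<in> Arr C \<Longrightarrow> g \<in> Arr C \<Longrightarrow> Cod C f = Dom C g \<Longrightarrow> Dom C (Comp C g f) = Dom C f"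
    and "\<And>f g. f \<in> Arr C \<Longrightarrow> g \<in> Arr C \<Longrightarrow> Cod C f = Dom C g \<Longrightarrow> Cod C (Comp C g f) = Cod C g"
    and "\<And>f. f \<in> Arr C \<Longrightarrow> Comp C f (Ident C (Dom C f)) = f"
    and "\<And>f. f \<in> Arr C \<Longrightarrow> Comp C (Ident C (Cod C f)) f = f"
    and "\<And>f g h. f \<in> Arr C \<Longrightarrow> g \<in> Arr C \<Longrightarrow> h \<in> Arr C \<Longrightarrow> Cod C f = Dom C g \<Longrightarrow>
      Cod C g = Dom C h \<Longrightarrow> Comp C h (Comp C g f) = Comp C (Comp C h g) f"
  shows "category C"
  using assms unfolding category_def in_hom by meson

lemma Dom_in_Obj [simp]: "category C \<Longrightarrow> f \<in> Arr C \<Longrightarrow> Dom C f \<in> Obj C"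
  and Cod_in_Obj [simp]: "category C \<Longrightarrow> f \<in> Arr C \<Longrightarrow> Cod C f \<in> Obj C"
  and Ident_in_Arr [simp]: "category C \<Longrightarrow> x \<in> Obj C \<Longrightarrow> Ident C x \<in> Arr C"
  and Dom_Ident [simp]: "category C \<Longrightarrow> x \<in> Obj C \<Longrightarrow> Dom C (Ident C x) = x"
  and Cod_Ident [simp]: "category C \<Longrightarrow> x \<in> Obj C \<Longrightarrow> Cod C (Ident C x) = x"
  and Comp_in_Arr [simp]:
    "category C \<Longrightarrow> f \<in> Arr C \<Longrightarrow> g \<in> Arr C \<Longrightarrow> Cod C f = Dom C g \<Longrightarrow> Comp C g f \<in> Arr C"
  and Dom_Comp [simp]:
    "category C \<Longrightarrow> f \<in> Arr C \<Longrightarrow> g \<in> Arr C \<Longrightarrow> Cod C f = Dom C g \<Longrightarrow> Dom C (Comp C g f) = Dom C f"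
  and Cod_Comp [simp]:
    "category C \<Longrightarrow> f \<in> Arr C \<Longrightarrow> g \<in> Arr C \<Longrightarrow> Cod C f = Dom C g \<Longrightarrow> Cod C (Comp C g f) = Cod C g"
  and Comp_Ident_right [simp]: "category C \<Longrightarrow> f \<in> Arr C \<Longrightarrow> Dom C f = x \<Longrightarrow> Comp C f (Ident C x) = f"
  and Comp_Ident_left [simp]: "category C \<Longrightarrow> f \<in> Arr C \<Longrightarrow> Cod C f = x \<Longrightarrow> Comp C (Ident C x) f = f"
  and Comp_assoc:
    "category C \<Longrightarrow> f \<in> Arr C \<Longrightarrow> g \<in> Arr C \<Longrightarrow> h \<in> Arr C \<Longrightarrow> Cod C f = Dom C g \<Longrightarrow> Cod C g = Dom C h \<Longrightarrow>
      Comp C h (Comp C g f) = Comp C (Comp C h g) f"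
  by (auto simp: category_def in_hom)

section \<open>Functors, natural transformations and their equality\<close>

lemma functorI:
  assumes "category (Src F)" and "category (Tgt F)"
    and "FO F \<in> extensional (Obj (Src F))" and "FA F \<in> extensional (Arr (Src F))"
    and "\<And>x. x \<in> Obj (Src F) \<Longrightarrow> FO F x \<in> Obj (Tgt F)"
    and "\<And>f. f \<in> Arr (Src F) \<Longrightarrow> FA F f \<in> Arr (Tgt F)"
    and "\<And>f. f \<in> Arr (Src F) \<Longrightarrow> Dom (Tgt F) (FA F f) = FO F (Dom (Src F) f)"
    and "\<And>f. f \<in> Arr (Src F) \<Longrightarrow> Cod (Tgt F) (FA F f) = FO F (Cod (Src F) f)"
    and "\<And>x. x \<in> Obj (Src F) \<Longrightarrow> FA F (Ident (Src F) x) = Ident (Tgt F) (FO F x)"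
    and "\<And>f g. f \<in> Arr (Src F) \<Longrightarrow> g \<in> Arr (Src F) \<Longrightarrow> Cod (Src F) f = Dom (Src F) g \<Longrightarrow>
      FA F (Comp (Src F) g f) = Comp (Tgt F) (FA F g) (FA F f)"
  shows "is_functor F"
  using assms unfolding is_functor_def in_hom by (auto simp: PiE_def)

lemma is_functor_between: "is_functor F \<Longrightarrow> functor_between F (Src F) (Tgt F)"
  by (simp add: functor_between_def)

lemma
  assumes "functor_between F C D"
  shows functor_betweenD: "is_functor F" "Src F = C" "Tgt F = D" "category C" "category D"
    and FO_in_Obj: "x \<in> Obj C \<Longrightarrow> FO F x \<in> Obj D"
    and FA_in_Arr: "f \<in> Arr C \<Longrightarrow> FA F f \<in> Arr D"
    and Dom_FA: "f \<in> Arr C \<Longrightarrow> Dom D (FA F f) = FO F (Dom C f)"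
    and Cod_FA: "f \<in> Arr C \<Longrightarrow> Cod D (FA F f) = FO F (Cod C f)"
    and FA_Ident: "x \<in> Obj C \<Longrightarrow> FA F (Ident C x) = Ident D (FO F x)"
    and FA_Comp: "f \<in> Arr C \<Longrightarrow> g \<in> Arr C \<Longrightarrow> Cod C f = Dom C g \<Longrightarrow>
      FA F (Comp C g f) = Comp D (FA F g) (FA F f)"
    and FO_extensional: "FO F \<in> extensional (Obj C)"
    and FA_extensional: "FA F \<in> extensional (Arr C)"
  using assms by (auto simp: functor_between_def is_functor_def in_hom PiE_def Pi_iff)

lemmas functor_simps = FO_in_Obj FA_in_Arr Dom_FA Cod_FA FA_Ident FA_Comp

lemma func_eqI:
  assumes "functor_between F C D" and "functor_between G C D"
    and "\<And>x. x \<in> Obj C \<Longrightarrow> FO F x = FO G x" and "\<And>f. f \<in> Arr C \<Longrightarrow> FA F f = FA G f"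
  shows "F = G"
proof -
  have "FO F = FO G" "FA F = FA G"
    using assms by (meson extensionalityI FO_extensional FA_extensional)+
  then show ?thesis
    using functor_betweenD(2,3)[OF assms(1)] functor_betweenD(2,3)[OF assms(2)]
    by (intro func.equality) auto
qed

text \<open>A normal form for functors: identities, composites, projections, pairings and the
  pullback maps are all rewritten to it by the \<open>_eq_mk\<close> lemmas, so that
  \<open>mk_func_functor\<close> proves functoriality for each, and equality of two functors reduces
  to equality of restricted maps.\<close>

definition mk_func :: "('o, 'a) cat \<Rightarrow> ('p, 'b) cat \<Rightarrow> ('o \<Rightarrow> 'p) \<Rightarrow> ('a \<Rightarrow> 'b) \<Rightarrow> ('o, 'a, 'p, 'b) func" where
  "mk_func C D fo fa = \<lparr>Src = C, Tgt = D, FO = restrict fo (Obj C), FA = restrict fa (Arr C)\<rparr>"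

lemma mk_func_simps [simp]:
  "Src (mk_func C D fo fa) = C" "Tgt (mk_func C D fo fa) = D"
  "x \<in> Obj C \<Longrightarrow> FO (mk_func C D fo fa) x = fo x"
  "f \<in> Arr C \<Longrightarrow> FA (mk_func C D fo fa) f = fa f"
  by (simp_all add: mk_func_def)

lemma mk_func_functor:
  assumes "category C" and "category D"
    and "\<And>x. x \<in> Obj C \<Longrightarrow> fo x \<in> Obj D"
    and "\<And>f. f \<in> Arr C \<Longrightarrow> fa f \<in> Arr D"
    and "\<And>f. f \<in> Arr C \<Longrightarrow> Dom D (fa f) = fo (Dom C f)"
    and "\<And>f. f \<in> Arr C \<Longrightarrow> Cod D (fa f) = fo (Cod C f)"
    and "\<And>x. x \<in> Obj C \<Longrightarrow> fa (Ident C x) = Ident D (fo x)"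
    and "\<And>f g. f \<in> Arr C \<Longrightarrow> g \<in> Arr C \<Longrightarrow> Cod C f = Dom C g \<Longrightarrow>
      fa (Comp C g f) = Comp D (fa g) (fa f)"
  shows "functor_between (mk_func C D fo fa) C D"
  unfolding functor_between_def
  by (intro conjI functorI) (use assms in \<open>simp_all add: mk_func_def\<close>)

lemma id_func_eq_mk: "id_func C = mk_func C C (\<lambda>x. x) (\<lambda>f. f)"
  by (simp add: id_func_def mk_func_def)

lemma comp_func_eq_mk:
  "comp_func G F = mk_func (Src F) (Tgt G) (\<lambda>x. FO G (FO F x)) (\<lambda>f. FA G (FA F f))"
  by (simp add: comp_func_def mk_func_def compose_def)

lemma id_func_simps [simp]:
  "Src (id_func C) = C" "Tgt (id_func C) = C"
  "x \<in> Obj C \<Longrightarrow> FO (id_func C) x = x" "f \<in> Arr C \<Longrightarrow> FA (id_func C) f = f"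
  by (simp_all add: id_func_def)

lemma comp_func_simps [simp]:
  "Src (comp_func G F) = Src F" "Tgt (comp_func G F) = Tgt G"
  "x \<in> Obj (Src F) \<Longrightarrow> FO (comp_func G F) x = FO G (FO F x)"
  "f \<in> Arr (Src F) \<Longrightarrow> FA (comp_func G F) f = FA G (FA F f)"
  by (simp_all add: comp_func_def compose_def)

lemma id_func_functor [intro]: "category C \<Longrightarrow> functor_between (id_func C) C C"
  unfolding id_func_eq_mk by (rule mk_func_functor) auto

lemma comp_func_functor [intro]:
  assumes F: "functor_between F C D" and G: "functor_between G D E"
  shows "functor_between (comp_func G F) C E"
  unfolding comp_func_eq_mk functor_betweenD(2)[OF F] functor_betweenD(3)[OF G]
  by (rule mk_func_functor)
    (use functor_betweenD[OF F] functor_betweenD[OF G] in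
      \<open>auto simp: functor_simps[OF F] functor_simps[OF G]\<close>)

lemma comp_func_id_right [simp]: "functor_between F C D \<Longrightarrow> comp_func F (id_func C) = F"
  using functor_betweenD[of F C D] by (intro func_eqI[of _ C D]) auto

lemma comp_func_id_left [simp]: "functor_between F C D \<Longrightarrow> comp_func (id_func D) F = F"
  using functor_betweenD[of F C D] by (intro func_eqI[of _ C D]) (auto simp: functor_simps)

lemma comp_func_assoc:
  assumes F: "functor_between F C D" and G: "functor_between G D E" and H: "functor_between H E E'"
  shows "comp_func H (comp_func G F) = comp_func (comp_func H G) F"
  by (rule func_eqI[of _ C E']) (use assms in \<open>auto simp: functor_betweenD(2) functor_simps[OF F]\<close>)

lemma ntI:
  assumes F: "functor_between (NSrc \<alpha>) C D" and G: "functor_between (NTgt \<alpha>) C D"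
    and "NC \<alpha> \<in> extensional (Obj C)"
    and "\<And>x. x \<in> Obj C \<Longrightarrow> NC \<alpha> x \<in> Arr D"
    and "\<And>x. x \<in> Obj C \<Longrightarrow> Dom D (NC \<alpha> x) = FO (NSrc \<alpha>) x"
    and "\<And>x. x \<in> Obj C \<Longrightarrow> Cod D (NC \<alpha> x) = FO (NTgt \<alpha>) x"
    and "\<And>f. f \<in> Arr C \<Longrightarrow> Comp D (NC \<alpha> (Cod C f)) (FA (NSrc \<alpha>) f)
      = Comp D (FA (NTgt \<alpha>) f) (NC \<alpha> (Dom C f))"
  shows "is_nt \<alpha>"
  using assms functor_betweenD[OF F] functor_betweenD[OF G] by (auto simp: is_nt_def Let_def in_hom)

lemma
  assumes "is_nt \<alpha>" and "functor_between (NSrc \<alpha>) C D"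
  shows nt_NTgt: "functor_between (NTgt \<alpha>) C D"
    and NC_extensional: "NC \<alpha> \<in> extensional (Obj C)"
    and NC_in_Arr: "x \<in> Obj C \<Longrightarrow> NC \<alpha> x \<in> Arr D"
    and Dom_NC: "x \<in> Obj C \<Longrightarrow> Dom D (NC \<alpha> x) = FO (NSrc \<alpha>) x"
    and Cod_NC: "x \<in> Obj C \<Longrightarrow> Cod D (NC \<alpha> x) = FO (NTgt \<alpha>) x"
    and NC_natural: "f \<in> Arr C \<Longrightarrow> Comp D (NC \<alpha> (Cod C f)) (FA (NSrc \<alpha>) f)
      = Comp D (FA (NTgt \<alpha>) f) (NC \<alpha> (Dom C f))"
  using assms by (auto simp: is_nt_def Let_def in_hom functor_between_def)

lemma nt_eqI:
  assumes "is_nt \<alpha>" and "is_nt \<beta>" and "functor_between (NSrc \<alpha>) C D"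
    and "NSrc \<alpha> = NSrc \<beta>" and "NTgt \<alpha> = NTgt \<beta>" and "\<And>x. x \<in> Obj C \<Longrightarrow> NC \<alpha> x = NC \<beta> x"
  shows "\<alpha> = \<beta>"
proof -
  have "NC \<alpha> = NC \<beta>"
    using assms by (metis extensionalityI NC_extensional)
  then show ?thesis
    using assms(4,5) by (intro nt.equality) auto
qed

lemma iso_Ident: "category C \<Longrightarrow> x \<in> Obj C \<Longrightarrow> iso C (Ident C x)"
  unfolding iso_def by (intro conjI bexI[of _ "Ident C x"]) (auto simp: in_hom)

subsection \<open>Basic constructions of categories\<close>

lemma op_cat_simps [simp]:
  "Obj (op_cat C) = Obj C" "Arr (op_cat C) = Arr C" "Dom (op_cat C) = Cod C" "Cod (op_cat C) = Dom C"
  "Ident (op_cat C) = Ident C" "Comp (op_cat C) g f = Comp C f g"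
  by (simp_all add: op_cat_def)

lemma op_cat_op_cat [simp]: "op_cat (op_cat C) = C"
  by (simp add: op_cat_def)

lemma category_op_cat [simp]: "category C \<Longrightarrow> category (op_cat C)"
  by (rule categoryI) (auto simp: Comp_assoc)

lemma op_func_simps [simp]:
  "Src (op_func F) = op_cat (Src F)" "Tgt (op_func F) = op_cat (Tgt F)"
  "FO (op_func F) = FO F" "FA (op_func F) = FA F"
  by (simp_all add: op_func_def)

lemma op_func_op_func [simp]: "op_func (op_func F) = F"
  by (simp add: op_func_def)

lemma op_func_functor [intro]:
  assumes F: "functor_between F C D" shows "functor_between (op_func F) (op_cat C) (op_cat D)"
  unfolding functor_between_def
  by (intro conjI functorI)
    (use functor_betweenD[OF F] FO_extensional[OF F] FA_extensional[OF F] in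
      \<open>auto simp: functor_simps[OF F]\<close>)

lemma op_func_id [simp]: "op_func (id_func C) = id_func (op_cat C)"
  by (simp add: op_func_def id_func_def)

lemma op_func_comp: "op_func (comp_func G F) = comp_func (op_func G) (op_func F)"
  by (simp add: op_func_def comp_func_def)

lemma full_subcat_simps [simp]:
  "Obj (full_subcat C X) = Obj C \<inter> X" "Arr (full_subcat C X) = {f \<in> Arr C. Dom C f \<in> X \<and> Cod C f \<in> X}"
  "Dom (full_subcat C X) = Dom C" "Cod (full_subcat C X) = Cod C"
  "Ident (full_subcat C X) = Ident C" "Comp (full_subcat C X) = Comp C"
  by (simp_all add: full_subcat_def)

lemma category_full_subcat: "category C \<Longrightarrow> category (full_subcat C X)"
  by (rule categoryI) (auto simp: Comp_assoc)

lemma times_cat_simps [simp]: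
  "Obj (times_cat C D) = Obj C \<times> Obj D" "Arr (times_cat C D) = Arr C \<times> Arr D"
  "Dom (times_cat C D) (f, g) = (Dom C f, Dom D g)" "Cod (times_cat C D) (f, g) = (Cod C f, Cod D g)"
  "Ident (times_cat C D) (x, y) = (Ident C x, Ident D y)"
  "Comp (times_cat C D) (f, g) (f', g') = (Comp C f f', Comp D g g')"
  by (simp_all add: times_cat_def)

lemma category_times_cat: "category C \<Longrightarrow> category D \<Longrightarrow> category (times_cat C D)"
  by (rule categoryI) (auto simp: Comp_assoc)

lemma slice_cat_simps [simp]:
  "Obj (slice_cat K c) = {p \<in> Arr K. Cod K p = c}"
  "Arr (slice_cat K c) = {(p, h, p'). p \<in> Arr K \<and> Cod K p = c \<and> p' \<in> Arr K \<and> Cod K p' = c \<and>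
       h \<in> Arr K \<and> Dom K p = Dom K h \<and> Dom K p' = Cod K h \<and> Comp K p' h = p}"
  "Dom (slice_cat K c) (p, h, p') = p" "Cod (slice_cat K c) (p, h, p') = p'"
  "Ident (slice_cat K c) p = (p, Ident K (Dom K p), p)"
  "Comp (slice_cat K c) (q, h', p'') (p, h, p') = (p, Comp K h' h, p'')"
  by (auto simp: slice_cat_def in_hom)

lemma category_slice_cat:
  assumes K: "category K" shows "category (slice_cat K c)"
proof (rule categoryI)
  fix f g assume "f \<in> Arr (slice_cat K c)" "g \<in> Arr (slice_cat K c)"
    and "Cod (slice_cat K c) f = Dom (slice_cat K c) g"
  then show "Comp (slice_cat K c) g f \<in> Arr (slice_cat K c)"
    and "Dom (slice_cat K c) (Comp (slice_cat K c) g f) = Dom (slice_cat K c) f"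
    and "Cod (slice_cat K c) (Comp (slice_cat K c) g f) = Cod (slice_cat K c) g"
    using K by (cases f; cases g; simp add: Comp_assoc)+
next
  fix f g h assume "f \<in> Arr (slice_cat K c)" "g \<in> Arr (slice_cat K c)" "h \<in> Arr (slice_cat K c)"
    and "Cod (slice_cat K c) f = Dom (slice_cat K c) g" "Cod (slice_cat K c) g = Dom (slice_cat K c) h"
  then show "Comp (slice_cat K c) h (Comp (slice_cat K c) g f) =
      Comp (slice_cat K c) (Comp (slice_cat K c) h g) f"
    using K by (cases f; cases g; cases h; simp add: Comp_assoc)
next
  fix f assume "f \<in> Arr (slice_cat K c)"
  then show "Dom (slice_cat K c) f \<in> Obj (slice_cat K c)" "Cod (slice_cat K c) f \<in> Obj (slice_cat K c)"
    and "Comp (slice_cat K c) f (Ident (slice_cat K c) (Dom (slice_cat K c) f)) = f"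
    and "Comp (slice_cat K c) (Ident (slice_cat K c) (Cod (slice_cat K c) f)) f = f"
    using K by (cases f; simp)+
qed (use K in simp_all)

text \<open>The set bound by \<open>let\<close> inside \<open>span_cat\<close>, named so that the
  simplification rules can refer to it.\<close>

definition spans :: "('o, 'a) cat \<Rightarrow> 'o \<Rightarrow> 'o \<Rightarrow> ('a \<times> 'a) set" where
  "spans K a b = {(q, p). q \<in> Arr K \<and> p \<in> Arr K \<and> Dom K p = Dom K q \<and> Cod K q = a \<and> Cod K p = b}"

lemma span_cat_simps [simp]:
  "Obj (span_cat K a b) = spans K a b"
  "Arr (span_cat K a b) = {((q, p), h, (q', p')). (q, p) \<in> spans K a b \<and> (q', p') \<in> spans K a b \<and>
     h \<in> Arr K \<and> Dom K q = Dom K h \<and> Dom K q' = Cod K h \<and> Comp K q' h = q \<and> Comp K p' h = p}"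
  "Dom (span_cat K a b) (s, h, t) = s" "Cod (span_cat K a b) (s, h, t) = t"
  "Ident (span_cat K a b) s = (s, Ident K (Dom K (fst s)), s)"
  "Comp (span_cat K a b) (s', h', t') (s, h, t) = (s, Comp K h' h, t')"
  by (auto simp: span_cat_def Let_def spans_def in_hom)

lemma category_span_cat:
  assumes K: "category K" shows "category (span_cat K a b)"
proof (rule categoryI)
  fix f g assume "f \<in> Arr (span_cat K a b)" "g \<in> Arr (span_cat K a b)"
    and "Cod (span_cat K a b) f = Dom (span_cat K a b) g"
  then show "Comp (span_cat K a b) g f \<in> Arr (span_cat K a b)"
    and "Dom (span_cat K a b) (Comp (span_cat K a b) g f) = Dom (span_cat K a b) f"
    and "Cod (span_cat K a b) (Comp (span_cat K a b) g f) = Cod (span_cat K a b) g"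
    using K by (cases f; cases g; simp add: Comp_assoc spans_def case_prod_beta)+
next
  fix f g h assume "f \<in> Arr (span_cat K a b)" "g \<in> Arr (span_cat K a b)" "h \<in> Arr (span_cat K a b)"
    and "Cod (span_cat K a b) f = Dom (span_cat K a b) g" "Cod (span_cat K a b) g = Dom (span_cat K a b) h"
  then show "Comp (span_cat K a b) h (Comp (span_cat K a b) g f) =
      Comp (span_cat K a b) (Comp (span_cat K a b) h g) f"
    using K by (cases f; cases g; cases h; simp add: Comp_assoc case_prod_beta)
next
  fix f assume "f \<in> Arr (span_cat K a b)"
  then show "Dom (span_cat K a b) f \<in> Obj (span_cat K a b)" "Cod (span_cat K a b) f \<in> Obj (span_cat K a b)"
    and "Comp (span_cat K a b) f (Ident (span_cat K a b) (Dom (span_cat K a b) f)) = f"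
    and "Comp (span_cat K a b) (Ident (span_cat K a b) (Cod (span_cat K a b) f)) f = f"
    using K by (cases f; simp add: case_prod_beta spans_def)+
qed (use K in \<open>simp_all add: spans_def case_prod_beta\<close>)

lemma func_cat_simps [simp]:
  "Obj (func_cat C D) = {F. functor_between F C D}"
  "Arr (func_cat C D) = {\<alpha>. is_nt \<alpha> \<and> functor_between (NSrc \<alpha>) C D}"
  "Dom (func_cat C D) = NSrc" "Cod (func_cat C D) = NTgt"
  "Ident (func_cat C D) F = \<lparr>NSrc = F, NTgt = F, NC = restrict (\<lambda>x. Ident D (FO F x)) (Obj C)\<rparr>"
  "Comp (func_cat C D) \<beta> \<alpha> = \<lparr>NSrc = NSrc \<alpha>, NTgt = NTgt \<beta>,
       NC = restrict (\<lambda>x. Comp D (NC \<beta> x) (NC \<alpha> x)) (Obj C)\<rparr>"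
  by (simp_all add: func_cat_def)

lemma nt_Ident:
  assumes F: "functor_between F C D"
  shows "is_nt \<lparr>NSrc = F, NTgt = F, NC = restrict (\<lambda>x. Ident D (FO F x)) (Obj C)\<rparr>"
  by (rule ntI[of _ C D]) (use F functor_betweenD[OF F] in \<open>auto simp: functor_simps[OF F]\<close>)

lemma nt_Comp:
  assumes \<alpha>: "is_nt \<alpha>" "functor_between (NSrc \<alpha>) C D" and \<beta>: "is_nt \<beta>" "NSrc \<beta> = NTgt \<alpha>"
  shows "is_nt \<lparr>NSrc = NSrc \<alpha>, NTgt = NTgt \<beta>, NC = restrict (\<lambda>x. Comp D (NC \<beta> x) (NC \<alpha> x)) (Obj C)\<rparr>"
    (is "is_nt ?\<gamma>")
proof -
  note F = \<alpha>(2)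
  have G: "functor_between (NTgt \<alpha>) C D" using nt_NTgt[OF \<alpha>] .
  then have G': "functor_between (NSrc \<beta>) C D" using \<beta>(2) by simp
  have H: "functor_between (NTgt \<beta>) C D" using nt_NTgt[OF \<beta>(1) G'] .
  note a = NC_in_Arr[OF \<alpha>] Dom_NC[OF \<alpha>] Cod_NC[OF \<alpha>]
  note b = NC_in_Arr[OF \<beta>(1) G'] Dom_NC[OF \<beta>(1) G', unfolded \<beta>(2)] Cod_NC[OF \<beta>(1) G']
  note c = functor_betweenD[OF F]
  show ?thesis
  proof (rule ntI[of _ C D])
    fix f assume f: "f \<in> Arr C"
    let ?x = "Dom C f" and ?y = "Cod C f"
    have xy: "?x \<in> Obj C" "?y \<in> Obj C" using f c by auto
    have "Comp D (Comp D (NC \<beta> ?y) (NC \<alpha> ?y)) (FA (NSrc \<alpha>) f) =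
        Comp D (NC \<beta> ?y) (Comp D (NC \<alpha> ?y) (FA (NSrc \<alpha>) f))"
      using f xy c a b by (intro Comp_assoc[symmetric]) (auto simp: functor_simps[OF F])
    also have "\<dots> = Comp D (NC \<beta> ?y) (Comp D (FA (NTgt \<alpha>) f) (NC \<alpha> ?x))"
      using NC_natural[OF \<alpha> f] by simp
    also have "\<dots> = Comp D (Comp D (NC \<beta> ?y) (FA (NTgt \<alpha>) f)) (NC \<alpha> ?x)"
      using f xy c a b by (intro Comp_assoc) (auto simp: functor_simps[OF G])
    also have "\<dots> = Comp D (Comp D (FA (NTgt \<beta>) f) (NC \<beta> ?x)) (NC \<alpha> ?x)"
      using NC_natural[OF \<beta>(1) G' f] \<beta>(2) by simp
    also have "\<dots> = Comp D (FA (NTgt \<beta>) f) (Comp D (NC \<beta> ?x) (NC \<alpha> ?x))"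
      using f xy c a b by (intro Comp_assoc[symmetric]) (auto simp: functor_simps[OF H])
    finally show "Comp D (NC ?\<gamma> ?y) (FA (NSrc ?\<gamma>) f) = Comp D (FA (NTgt ?\<gamma>) f) (NC ?\<gamma> ?x)"
      using xy by simp
  qed (use F H c a b in auto)
qed

lemma category_func_cat:
  assumes "category C" and "category D" shows "category (func_cat C D)"
proof (rule categoryI)
  fix \<alpha> assume \<alpha>: "\<alpha> \<in> Arr (func_cat C D)"
  show "Cod (func_cat C D) \<alpha> \<in> Obj (func_cat C D)"
    using \<alpha> nt_NTgt[of \<alpha>] by simp
  have "is_nt \<lparr>NSrc = NSrc \<alpha>, NTgt = NSrc \<alpha>, NC = restrict (\<lambda>x. Ident D (FO (NSrc \<alpha>) x)) (Obj C)\<rparr>"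
    using \<alpha> by (intro nt_Ident) simp
  from nt_Comp[OF this _, of C D \<alpha>]
  show "Comp (func_cat C D) \<alpha> (Ident (func_cat C D) (Dom (func_cat C D) \<alpha>)) = \<alpha>"
    using \<alpha> assms NC_in_Arr[of \<alpha> C D] Dom_NC[of \<alpha> C D]
    by (intro nt_eqI[of _ _ C D]) auto
  have "is_nt \<lparr>NSrc = NTgt \<alpha>, NTgt = NTgt \<alpha>, NC = restrict (\<lambda>x. Ident D (FO (NTgt \<alpha>) x)) (Obj C)\<rparr>"
    using \<alpha> by (intro nt_Ident nt_NTgt) simp_all
  from nt_Comp[of \<alpha> C D, OF _ _ this]
  show "Comp (func_cat C D) (Ident (func_cat C D) (Cod (func_cat C D) \<alpha>)) \<alpha> = \<alpha>"
    using \<alpha> assms NC_in_Arr[of \<alpha> C D] Cod_NC[of \<alpha> C D]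
    by (intro nt_eqI[of _ _ C D]) auto
next
  fix \<alpha> \<beta> \<gamma> assume \<alpha>: "\<alpha> \<in> Arr (func_cat C D)" and \<beta>: "\<beta> \<in> Arr (func_cat C D)"
    and \<gamma>: "\<gamma> \<in> Arr (func_cat C D)"
    and eq: "Cod (func_cat C D) \<alpha> = Dom (func_cat C D) \<beta>" "Cod (func_cat C D) \<beta> = Dom (func_cat C D) \<gamma>"
  show "Comp (func_cat C D) \<gamma> (Comp (func_cat C D) \<beta> \<alpha>) = Comp (func_cat C D) (Comp (func_cat C D) \<gamma> \<beta>) \<alpha>"
    using \<alpha> \<beta> \<gamma> eq assms NC_in_Arr[of \<alpha> C D] Cod_NC[of \<alpha> C D] NC_in_Arr[of \<beta> C D] Cod_NC[of \<beta> C D]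
      Dom_NC[of \<beta> C D] Dom_NC[of \<gamma> C D] NC_in_Arr[of \<gamma> C D]
    by (auto intro!: restrict_ext Comp_assoc)
qed (auto intro: nt_Ident nt_Comp)

text \<open>Componentwise inverses are automatically natural: insert a component of
  \<open>\<alpha>\<close> followed by its inverse next to an arrow of the target functor, slide the
  arrow past that component by naturality of \<open>\<alpha>\<close>, and cancel on the other
  side.\<close>

lemma iso_func_cat:
  assumes \<alpha>: "is_nt \<alpha>" "functor_between (NSrc \<alpha>) C D"
    and iso: "\<And>x. x \<in> Obj C \<Longrightarrow> iso D (NC \<alpha> x)"
  shows "iso (func_cat C D) \<alpha>"
proof -
  note F = \<alpha>(2)
  have G: "functor_between (NTgt \<alpha>) C D" using nt_NTgt[OF \<alpha>] .
  note c = functor_betweenD[OF F]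
  note a = NC_in_Arr[OF \<alpha>] Dom_NC[OF \<alpha>] Cod_NC[OF \<alpha>]
  have "\<forall>x\<in>Obj C. \<exists>g. g \<in> Arr D \<and> Dom D g = FO (NTgt \<alpha>) x \<and> Cod D g = FO (NSrc \<alpha>) x \<and>
      Comp D g (NC \<alpha> x) = Ident D (FO (NSrc \<alpha>) x) \<and> Comp D (NC \<alpha> x) g = Ident D (FO (NTgt \<alpha>) x)"
    using iso a unfolding iso_def by (auto simp: in_hom Bex_def)
  then obtain i where i: "\<And>x. x \<in> Obj C \<Longrightarrow> i x \<in> Arr D" "\<And>x. x \<in> Obj C \<Longrightarrow> Dom D (i x) = FO (NTgt \<alpha>) x"
      "\<And>x. x \<in> Obj C \<Longrightarrow> Cod D (i x) = FO (NSrc \<alpha>) x"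
      "\<And>x. x \<in> Obj C \<Longrightarrow> Comp D (i x) (NC \<alpha> x) = Ident D (FO (NSrc \<alpha>) x)"
      "\<And>x. x \<in> Obj C \<Longrightarrow> Comp D (NC \<alpha> x) (i x) = Ident D (FO (NTgt \<alpha>) x)"
    by metis
  define \<beta> where "\<beta> = \<lparr>NSrc = NTgt \<alpha>, NTgt = NSrc \<alpha>, NC = restrict i (Obj C)\<rparr>"
  have "is_nt \<beta>"
  proof (rule ntI[of _ C D])
    fix f assume f: "f \<in> Arr C"
    let ?x = "Dom C f" and ?y = "Cod C f"
    have xy: "?x \<in> Obj C" "?y \<in> Obj C" using f c by auto
    note s = f xy c a i functor_simps[OF F] functor_simps[OF G]
    have "Comp D (i ?y) (FA (NTgt \<alpha>) f) = Comp D (Comp D (i ?y) (FA (NTgt \<alpha>) f)) (Comp D (NC \<alpha> ?x) (i ?x))"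
      using s by simp
    also have "\<dots> = Comp D (i ?y) (Comp D (FA (NTgt \<alpha>) f) (Comp D (NC \<alpha> ?x) (i ?x)))"
      by (rule Comp_assoc[symmetric]) (simp_all add: s)
    also have "\<dots> = Comp D (i ?y) (Comp D (Comp D (FA (NTgt \<alpha>) f) (NC \<alpha> ?x)) (i ?x))"
      by (rule arg_cong[of _ _ "Comp D (i ?y)"], rule Comp_assoc) (simp_all add: s)
    also have "\<dots> = Comp D (i ?y) (Comp D (Comp D (NC \<alpha> ?y) (FA (NSrc \<alpha>) f)) (i ?x))"
      using NC_natural[OF \<alpha> f] by simp
    also have "\<dots> = Comp D (i ?y) (Comp D (NC \<alpha> ?y) (Comp D (FA (NSrc \<alpha>) f) (i ?x)))"
      by (rule arg_cong[of _ _ "Comp D (i ?y)"], rule Comp_assoc[symmetric]) (simp_all add: s)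
    also have "\<dots> = Comp D (Comp D (i ?y) (NC \<alpha> ?y)) (Comp D (FA (NSrc \<alpha>) f) (i ?x))"
      by (rule Comp_assoc) (simp_all add: s)
    also have "\<dots> = Comp D (FA (NSrc \<alpha>) f) (i ?x)"
      using s by simp
    finally show "Comp D (NC \<beta> ?y) (FA (NSrc \<beta>) f) = Comp D (FA (NTgt \<beta>) f) (NC \<beta> ?x)"
      using xy by (simp add: \<beta>_def)
  qed (use F G i in \<open>auto simp: \<beta>_def\<close>)
  then show ?thesis
    unfolding iso_def using \<alpha> G i
    by (intro conjI bexI[of _ \<beta>]) (auto simp: in_hom \<beta>_def intro!: restrict_ext)
qed

lemma nat_isoI:
  assumes F: "functor_between F C D" and G: "functor_between G C D"
    and "NSrc \<alpha> = F" and "NTgt \<alpha> = G" and "NC \<alpha> \<in> extensional (Obj C)"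
    and "\<And>x. x \<in> Obj C \<Longrightarrow> Dom D (NC \<alpha> x) = FO F x"
    and "\<And>x. x \<in> Obj C \<Longrightarrow> Cod D (NC \<alpha> x) = FO G x"
    and "\<And>f. f \<in> Arr C \<Longrightarrow> Comp D (NC \<alpha> (Cod C f)) (FA F f) = Comp D (FA G f) (NC \<alpha> (Dom C f))"
    and iso: "\<And>x. x \<in> Obj C \<Longrightarrow> iso D (NC \<alpha> x)"
  shows "nat_iso \<alpha> F G"
proof -
  have "is_nt \<alpha>"
    by (rule ntI[of _ C D]) (use assms in \<open>auto simp: iso_def\<close>)
  then show ?thesis
    using assms functor_betweenD[OF F] by (simp add: nat_iso_def)
qed

lemma id_nt_nat_iso:
  assumes F: "functor_between F C D" shows "nat_iso (id_nt F F) F F"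
  by (rule nat_isoI[OF F F]) (use functor_betweenD[OF F] in
    \<open>simp_all add: id_nt_def functor_simps[OF F] iso_Ident\<close>)

subsection \<open>Small categories and small sets\<close>

declare pair_inject [simp]

text \<open>The class has no replacement axiom for images; an image is a union of singletons, which
  reduces it to \<open>small_UN\<close> and \<open>small_doubleton\<close>.\<close>

lemma small_image:
  fixes f :: "'u::universe \<Rightarrow> 'u"
  assumes "small X" shows "small (f ` X)"
proof -
  have "small (\<Union>x\<in>X. {f x})"
    by (rule small_UN[OF assms]) (use small_doubleton[of "f x" "f x" for x] in simp)
  then show ?thesis by (simp add: UNION_singleton_eq_range)
qed

text \<open>A dependent sum is a union of images. Smallness of products, pullbacks and categories of
  elements all comes from here.\<close>

lemma small_pairs:
  assumes "small I" and "\<And>i. i \<in> I \<Longrightarrow> small (F i)"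
  shows "small {pair i x | i x. i \<in> I \<and> x \<in> F i}"
proof -
  have "{pair i x | i x. i \<in> I \<and> x \<in> F i} = (\<Union>i\<in>I. pair i ` F i)" by auto
  then show ?thesis using assms by (simp add: small_UN small_image)
qed

lemma small_catD: "small_cat C \<Longrightarrow> category C" "small_cat C \<Longrightarrow> small (Obj C)" "small_cat C \<Longrightarrow> small (Arr C)"
  by (simp_all add: small_cat_def)

lemma Cat_simps [simp]:
  "Obj Cat = {C. small_cat C}"
  "Arr Cat = {F. is_functor F \<and> small_cat (Src F) \<and> small_cat (Tgt F)}"
  "Dom Cat = Src" "Cod Cat = Tgt" "Ident Cat = id_func" "Comp Cat = comp_func"
  by (simp_all add: Cat_def)

lemma in_Arr_Cat:
  "functor_between F C D \<Longrightarrow> small_cat C \<Longrightarrow> small_cat D \<Longrightarrow> F \<in> Arr Cat"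
  by (auto simp: functor_between_def)

lemma Arr_CatD:
  "F \<in> Arr Cat \<Longrightarrow> functor_between F (Src F) (Tgt F)"
  by (auto simp: functor_between_def)

lemma category_Cat: "category (Cat :: (('u::universe) scat, 'u sfunc) cat)"
proof (rule categoryI)
  fix f g :: "'u sfunc"
  assume f: "f \<in> Arr Cat" and g: "g \<in> Arr Cat" and eq: "Cod Cat f = Dom Cat g"
  have fg: "functor_between f (Src f) (Src g)" "functor_between g (Src g) (Tgt g)"
    using f g eq by (auto simp: functor_between_def)
  then show "Comp Cat g f \<in> Arr Cat"
    using f g functor_betweenD(1)[OF comp_func_functor[OF fg]] by simp
  fix h :: "'u sfunc" assume h: "h \<in> Arr Cat" "Cod Cat g = Dom Cat h"
  then show "Comp Cat h (Comp Cat g f) = Comp Cat (Comp Cat h g) f"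
    using fg by (simp add: comp_func_assoc[OF fg(1)] functor_between_def)
qed (auto dest: small_catD is_functor_between intro!: in_Arr_Cat functor_betweenD(1)[OF id_func_functor])

text \<open>The set-theoretic inverses respect the structure because \<open>F\<close> does and is
  injective on objects and on arrows. With it every comparison functor below is inverted by giving
  two bijections.\<close>

lemma iso_CatI:
  assumes F: "functor_between F C D" and "small_cat C" and "small_cat D"
    and O: "bij_betw (FO F) (Obj C) (Obj D)" and A: "bij_betw (FA F) (Arr C) (Arr D)"
  shows "iso Cat F"
proof -
  note [simp] = functor_betweenD[OF F] functor_simps[OF F]
  define G where "G = mk_func D C (inv_into (Obj C) (FO F)) (inv_into (Arr C) (FA F))"
  have o: "inv_into (Obj C) (FO F) x \<in> Obj C" "FO F (inv_into (Obj C) (FO F) x) = x" if "x \<in> Obj D" for x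
    using that O by (auto simp: bij_betw_def inv_into_into f_inv_into_f)
  have o': "inv_into (Obj C) (FO F) (FO F x) = x" if "x \<in> Obj C" for x
    using that O by (auto simp: bij_betw_def)
  have a: "inv_into (Arr C) (FA F) x \<in> Arr C" "FA F (inv_into (Arr C) (FA F) x) = x" if "x \<in> Arr D" for x
    using that A by (auto simp: bij_betw_def inv_into_into f_inv_into_f)
  have a': "inv_into (Arr C) (FA F) (FA F x) = x" if "x \<in> Arr C" for x
    using that A by (auto simp: bij_betw_def)
  have d: "Dom C (inv_into (Arr C) (FA F) f) = inv_into (Obj C) (FO F) (Dom D f)"
    "Cod C (inv_into (Arr C) (FA F) f) = inv_into (Obj C) (FO F) (Cod D f)" if "f \<in> Arr D" for f
    using a[OF that] Dom_FA[OF F a(1)[OF that]] Cod_FA[OF F a(1)[OF that]]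
    by (simp_all add: o')
  have G: "functor_between G D C"
    unfolding G_def
  proof (rule mk_func_functor)
    fix x assume x: "x \<in> Obj D"
    show "inv_into (Arr C) (FA F) (Ident D x) = Ident C (inv_into (Obj C) (FO F) x)"
      using a'[of "Ident C (inv_into (Obj C) (FO F) x)"] o[OF x] by simp
  next
    fix f g assume "f \<in> Arr D" "g \<in> Arr D" "Cod D f = Dom D g"
    then show "inv_into (Arr C) (FA F) (Comp D g f) =
        Comp C (inv_into (Arr C) (FA F) g) (inv_into (Arr C) (FA F) f)"
      using a'[of "Comp C (inv_into (Arr C) (FA F) g) (inv_into (Arr C) (FA F) f)"] a d by simp
  qed (simp_all add: o a d)
  have "comp_func G F = id_func C"
    by (rule func_eqI[OF comp_func_functor[OF F G] id_func_functor]) (simp_all add: G_def o' a')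
  moreover have "comp_func F G = id_func D"
    using functor_betweenD(2)[OF G]
    by (intro func_eqI[OF comp_func_functor[OF G F] id_func_functor]) (simp_all add: G_def o a)
  ultimately show ?thesis
    unfolding iso_def using assms G functor_betweenD[OF G]
    by (intro conjI bexI[of _ G]) (auto simp: in_hom)
qed

lemma Set_simps [simp]:
  "Obj Set = {X. small X}" "Arr Set = {(X, f, Y). small X \<and> small Y \<and> f \<in> X \<rightarrow>\<^sub>E Y}"
  "Dom Set (X, f, Y) = X" "Cod Set (X, f, Y) = Y"
  "Ident Set X = (X, restrict (\<lambda>x. x) X, X)"
  "Comp Set (Y', g, Z) (X, f, Y) = (X, compose X g f, Z)"
  by (simp_all add: Set_def)

lemma category_Set: "category Set"
  by (rule categoryI) (auto simp: compose_def PiE_def extensional_def Pi_iff intro!: ext, metis)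

lemma iso_SetI:
  assumes "small X" "small Y" "f \<in> extensional X" "bij_betw f X Y" shows "iso Set (X, f, Y)"
proof -
  define g where "g = restrict (inv_into X f) Y"
  have "compose X g f = restrict (\<lambda>x. x) X" "compose Y f g = restrict (\<lambda>x. x) Y"
    using assms(4) by (auto simp: g_def compose_def bij_betw_def f_inv_into_f intro!: restrict_ext)
  moreover have "g \<in> Y \<rightarrow>\<^sub>E X" "f \<in> X \<rightarrow>\<^sub>E Y"
    using assms(3,4) by (auto simp: g_def bij_betw_def inv_into_into PiE_def)
  ultimately show ?thesis
    unfolding iso_def using assms(1,2) by (intro conjI bexI[of _ "(Y, g, X)"]) (auto simp: in_hom)
qed

lemma prod_cat_simps [simp]:
  "Obj (prod_cat C D) = {pair x y | x y. x \<in> Obj C \<and> y \<in> Obj D}"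
  "Arr (prod_cat C D) = {pair f g | f g. f \<in> Arr C \<and> g \<in> Arr D}"
  "Dom (prod_cat C D) h = pair (Dom C (p1 h)) (Dom D (p2 h))"
  "Cod (prod_cat C D) h = pair (Cod C (p1 h)) (Cod D (p2 h))"
  "Ident (prod_cat C D) z = pair (Ident C (p1 z)) (Ident D (p2 z))"
  "Comp (prod_cat C D) k h = pair (Comp C (p1 k) (p1 h)) (Comp D (p2 k) (p2 h))"
  by (simp_all add: prod_cat_def)

lemma category_prod_cat: "category C \<Longrightarrow> category D \<Longrightarrow> category (prod_cat C D)"
  by (rule categoryI) (auto simp: Comp_assoc)

lemma small_cat_prod_cat: "small_cat C \<Longrightarrow> small_cat D \<Longrightarrow> small_cat (prod_cat C D)"
  using small_pairs[of "Obj C" "\<lambda>_. Obj D"] small_pairs[of "Arr C" "\<lambda>_. Arr D"]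
  by (auto simp: small_cat_def category_prod_cat)

lemma small_cat_op_cat [simp]: "small_cat (op_cat C) \<longleftrightarrow> small_cat C"
  using category_op_cat[of "op_cat C"] by (auto simp: small_cat_def)

lemma op_cat_prod_cat: "op_cat (prod_cat C D) = prod_cat (op_cat C) (op_cat D)"
  by (simp add: op_cat_def prod_cat_def)

lemma proj1_eq_mk: "proj1 C D = mk_func (prod_cat C D) C p1 p1"
  and proj2_eq_mk: "proj2 C D = mk_func (prod_cat C D) D p2 p2"
  by (simp_all add: proj1_def proj2_def mk_func_def)

lemma tuple_func_eq_mk:
  "tuple_func F G = mk_func (Src F) (prod_cat (Tgt F) (Tgt G)) (\<lambda>x. pair (FO F x) (FO G x))
     (\<lambda>f. pair (FA F f) (FA G f))"
  by (simp add: tuple_func_def mk_func_def)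

lemma proj_simps [simp]:
  "Src (proj1 C D) = prod_cat C D" "Tgt (proj1 C D) = C"
  "Src (proj2 C D) = prod_cat C D" "Tgt (proj2 C D) = D"
  "x \<in> Obj C \<Longrightarrow> y \<in> Obj D \<Longrightarrow> FO (proj1 C D) (pair x y) = x"
  "f \<in> Arr C \<Longrightarrow> g \<in> Arr D \<Longrightarrow> FA (proj1 C D) (pair f g) = f"
  "x \<in> Obj C \<Longrightarrow> y \<in> Obj D \<Longrightarrow> FO (proj2 C D) (pair x y) = y"
  "f \<in> Arr C \<Longrightarrow> g \<in> Arr D \<Longrightarrow> FA (proj2 C D) (pair f g) = g"
  by (simp_all add: proj1_def proj2_def)

lemma tuple_func_simps [simp]:
  "Src (tuple_func F G) = Src F" "Tgt (tuple_func F G) = prod_cat (Tgt F) (Tgt G)"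
  "x \<in> Obj (Src F) \<Longrightarrow> FO (tuple_func F G) x = pair (FO F x) (FO G x)"
  "f \<in> Arr (Src F) \<Longrightarrow> FA (tuple_func F G) f = pair (FA F f) (FA G f)"
  by (simp_all add: tuple_func_def)

lemma proj_functor [intro]:
  assumes "category C" "category D"
  shows "functor_between (proj1 C D) (prod_cat C D) C" "functor_between (proj2 C D) (prod_cat C D) D"
  unfolding proj1_eq_mk proj2_eq_mk
  by (rule mk_func_functor; use assms in \<open>auto simp: category_prod_cat\<close>)+

lemma tuple_func_functor [intro]:
  assumes F: "functor_between F E C" and G: "functor_between G E D"
  shows "functor_between (tuple_func F G) E (prod_cat C D)"
  unfolding tuple_func_eq_mk functor_betweenD(2,3)[OF F] functor_betweenD(3)[OF G]
  by (rule mk_func_functor) (use functor_betweenD[OF F] functor_betweenD[OF G] in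
    \<open>auto simp: functor_simps[OF F] functor_simps[OF G] category_prod_cat\<close>)

lemma comp_proj_tuple [simp]:
  assumes F: "functor_between F E C" and G: "functor_between G E D"
  shows "comp_func (proj1 C D) (tuple_func F G) = F" "comp_func (proj2 C D) (tuple_func F G) = G"
  by (rule func_eqI[OF comp_func_functor[OF tuple_func_functor[OF F G] proj_functor(1)] F]
      func_eqI[OF comp_func_functor[OF tuple_func_functor[OF F G] proj_functor(2)] G];
      simp add: functor_betweenD[OF F] functor_betweenD[OF G] functor_simps[OF F] functor_simps[OF G])+

lemma tuple_comp_proj [simp]:
  assumes r: "functor_between r E (prod_cat C D)" and C: "category C" "category D"
  shows "tuple_func (comp_func (proj1 C D) r) (comp_func (proj2 C D) r) = r"
proof (rule func_eqI[OF tuple_func_functor r])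
  show "functor_between (comp_func (proj1 C D) r) E C" "functor_between (comp_func (proj2 C D) r) E D"
    using r C by auto
  show "FO (tuple_func (comp_func (proj1 C D) r) (comp_func (proj2 C D) r)) x = FO r x"
    if "x \<in> Obj E" for x
    using FO_in_Obj[OF r that] that functor_betweenD(2)[OF r] by auto
  show "FA (tuple_func (comp_func (proj1 C D) r) (comp_func (proj2 C D) r)) f = FA r f"
    if "f \<in> Arr E" for f
    using FA_in_Arr[OF r that] that functor_betweenD(2)[OF r] by auto
qed

lemma comp_tuple_func:
  assumes F: "functor_between F E C" and G: "functor_between G E D" and H: "functor_between H E' E"
  shows "comp_func (tuple_func F G) H = tuple_func (comp_func F H) (comp_func G H)"
  using functor_betweenD(2)[OF H] functor_betweenD(2)[OF F] functor_betweenD(2)[OF G]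
  by (intro func_eqI[OF comp_func_functor[OF H tuple_func_functor[OF F G]]
        tuple_func_functor[OF comp_func_functor[OF H F] comp_func_functor[OF H G]]])
    (auto simp: functor_simps[OF H])

lemma prod_func_simps [simp]:
  "Src (prod_func F G) = prod_cat (Src F) (Src G)" "Tgt (prod_func F G) = prod_cat (Tgt F) (Tgt G)"
  "x \<in> Obj (Src F) \<Longrightarrow> y \<in> Obj (Src G) \<Longrightarrow> FO (prod_func F G) (pair x y) = pair (FO F x) (FO G y)"
  "f \<in> Arr (Src F) \<Longrightarrow> g \<in> Arr (Src G) \<Longrightarrow> FA (prod_func F G) (pair f g) = pair (FA F f) (FA G g)"
  by (auto simp: prod_func_def)

lemma prod_func_functor [intro]:
  assumes F: "functor_between F C D" and G: "functor_between G C' D'"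
  shows "functor_between (prod_func F G) (prod_cat C C') (prod_cat D D')"
  unfolding prod_func_def functor_betweenD(2)[OF F] functor_betweenD(2)[OF G]
  by (rule tuple_func_functor[OF comp_func_functor[OF proj_functor(1) F] comp_func_functor[OF proj_functor(2) G]])
    (simp_all add: functor_betweenD[OF F] functor_betweenD[OF G])

lemma prod_func_id:
  assumes "category C" "category D"
  shows "prod_func (id_func C) (id_func D) = id_func (prod_cat C D)"
  by (rule func_eqI[OF prod_func_functor id_func_functor]) (use assms in \<open>auto simp: category_prod_cat\<close>)

lemma prod_func_comp:
  assumes F: "functor_between F C D" and G: "functor_between G C' D'"
    and F': "functor_between F' B C" and G': "functor_between G' B' C'"
  shows "comp_func (prod_func F G) (prod_func F' G') = prod_func (comp_func F F') (comp_func G G')"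
  by (rule func_eqI[OF comp_func_functor[OF prod_func_functor[OF F' G'] prod_func_functor[OF F G]]
        prod_func_functor[OF comp_func_functor[OF F' F] comp_func_functor[OF G' G]]])
    (auto simp: functor_betweenD[OF F] functor_betweenD[OF G] functor_betweenD[OF F'] functor_betweenD[OF G']
      functor_simps[OF F'] functor_simps[OF G'])

text \<open>An equality of records, since passing to the opposite leaves the maps of a functor
  untouched and commutes with \<open>prod_cat\<close> on the nose. It turns the action on
  profunctors into precomposition of presheaves.\<close>

lemma op_func_prod_func: "op_func (prod_func F G) = prod_func (op_func F) (op_func G)"
  by (simp add: op_func_def prod_func_def tuple_func_def comp_func_def proj1_def proj2_def
      compose_def op_cat_prod_cat restrict_def)

subsection \<open>Pullbacks\<close>

lemma pb_cat_simps [simp]: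
  "Obj (pb_cat w p) = {pair c e | c e. c \<in> Obj (Src w) \<and> e \<in> Obj (Src p) \<and> FO w c = FO p e}"
  "Arr (pb_cat w p) = {pair f g | f g. f \<in> Arr (Src w) \<and> g \<in> Arr (Src p) \<and> FA w f = FA p g}"
  "Dom (pb_cat w p) h = pair (Dom (Src w) (p1 h)) (Dom (Src p) (p2 h))"
  "Cod (pb_cat w p) h = pair (Cod (Src w) (p1 h)) (Cod (Src p) (p2 h))"
  "Ident (pb_cat w p) z = pair (Ident (Src w) (p1 z)) (Ident (Src p) (p2 z))"
  "Comp (pb_cat w p) k h = pair (Comp (Src w) (p1 k) (p1 h)) (Comp (Src p) (p2 k) (p2 h))"
  by (simp_all add: pb_cat_def prod_cat_def)

text \<open>The arrows of \<open>pb_cat\<close> are only required to agree as arrows of the base;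
  this yields agreement of their ends, so that their domains and codomains are objects of the
  pullback.\<close>

lemma FO_eq_if_FA_eq:
  assumes "functor_between w C' C" "functor_between p E C" "f \<in> Arr C'" "g \<in> Arr E" "FA w f = FA p g"
  shows "FO w (Dom C' f) = FO p (Dom E g)" "FO w (Cod C' f) = FO p (Cod E g)"
  using assms by (metis Dom_FA, metis Cod_FA)

lemma category_pb_cat:
  assumes w: "functor_between w C' C" and p: "functor_between p E C"
  shows "category (pb_cat w p)"
  by (rule categoryI)
    (auto simp: functor_betweenD[OF w] functor_betweenD[OF p] functor_simps[OF w] functor_simps[OF p]
      FO_eq_if_FA_eq[OF w p] Comp_assoc)

lemma small_cat_pb_cat:
  assumes w: "functor_between w C' C" and p: "functor_between p E C" and s: "small_cat C'" "small_cat E"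
  shows "small_cat (pb_cat w p)"
  unfolding small_cat_def
proof (intro conjI category_pb_cat[OF w p])
  show "small (Obj (pb_cat w p))"
    by (rule small_subset[OF small_pairs[OF small_catD(2)[OF s(1)] small_catD(2)[OF s(2)]]])
      (auto simp: functor_betweenD[OF w] functor_betweenD[OF p])
  show "small (Arr (pb_cat w p))"
    by (rule small_subset[OF small_pairs[OF small_catD(3)[OF s(1)] small_catD(3)[OF s(2)]]])
      (auto simp: functor_betweenD[OF w] functor_betweenD[OF p])
qed

lemma pb_proj_eq_mk: "pb_proj w p = mk_func (pb_cat w p) (Src w) p1 p1"
  by (simp add: pb_proj_def mk_func_def)

lemma pb_map_eq_mk: "pb_map w p h p' = mk_func (pb_cat w p) (pb_cat w p')
    (\<lambda>z. pair (p1 z) (FO h (p2 z))) (\<lambda>z. pair (p1 z) (FA h (p2 z)))"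
  by (simp add: pb_map_def mk_func_def)

lemma pb_unit_eq_mk: "pb_unit p = mk_func (Src p) (pb_cat (id_func (Tgt p)) p)
    (\<lambda>e. pair (FO p e) e) (\<lambda>g. pair (FA p g) g)"
  by (simp add: pb_unit_def mk_func_def)

lemma pb_cmp_eq_mk: "pb_cmp w w' p = mk_func (pb_cat w' (pb_proj w p)) (pb_cat (comp_func w w') p)
    (\<lambda>z. pair (p1 z) (p2 (p2 z))) (\<lambda>z. pair (p1 z) (p2 (p2 z)))"
  by (simp add: pb_cmp_def mk_func_def Let_def)

lemma pb_func_simps [simp]:
  "Src (pb_proj w p) = pb_cat w p" "Tgt (pb_proj w p) = Src w"
  "Src (pb_map w p h p') = pb_cat w p" "Tgt (pb_map w p h p') = pb_cat w p'"
  "Src (pb_unit p) = Src p" "Tgt (pb_unit p) = pb_cat (id_func (Tgt p)) p"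
  "Src (pb_cmp w w' p) = pb_cat w' (pb_proj w p)" "Tgt (pb_cmp w w' p) = pb_cat (comp_func w w') p"
  "z \<in> Obj (pb_cat w p) \<Longrightarrow> FO (pb_proj w p) z = p1 z"
  "k \<in> Arr (pb_cat w p) \<Longrightarrow> FA (pb_proj w p) k = p1 k"
  "z \<in> Obj (pb_cat w p) \<Longrightarrow> FO (pb_map w p h p') z = pair (p1 z) (FO h (p2 z))"
  "k \<in> Arr (pb_cat w p) \<Longrightarrow> FA (pb_map w p h p') k = pair (p1 k) (FA h (p2 k))"
  "e \<in> Obj (Src p) \<Longrightarrow> FO (pb_unit p) e = pair (FO p e) e"
  "g \<in> Arr (Src p) \<Longrightarrow> FA (pb_unit p) g = pair (FA p g) g"
  "z \<in> Obj (pb_cat w' (pb_proj w p)) \<Longrightarrow> FO (pb_cmp w w' p) z = pair (p1 z) (p2 (p2 z))"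
  "k \<in> Arr (pb_cat w' (pb_proj w p)) \<Longrightarrow> FA (pb_cmp w w' p) k = pair (p1 k) (p2 (p2 k))"
  by (simp_all add: pb_proj_eq_mk pb_map_eq_mk pb_unit_eq_mk pb_cmp_eq_mk)

lemma pb_proj_functor [intro]:
  assumes w: "functor_between w C' C" and p: "functor_between p E C"
  shows "functor_between (pb_proj w p) (pb_cat w p) C'"
proof -
  have "functor_between (pb_proj w p) (pb_cat w p) (Src w)"
    unfolding pb_proj_eq_mk by (rule mk_func_functor[OF category_pb_cat[OF w p]])
      (auto simp: functor_betweenD[OF w] functor_betweenD[OF p])
  then show ?thesis by (simp add: functor_betweenD[OF w])
qed

section \<open>Pullback on maps over a base, and naturality of its comparisons\<close>

context
  fixes p h p' :: "('u::universe) sfunc" and C E E'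
  assumes p': "functor_between p' E' C" and h: "functor_between h E E'" and p: "comp_func p' h = p"
begin

lemma over_functor: "functor_between p E C"
  using comp_func_functor[OF h p'] p by simp

lemma over_simps:
  "e \<in> Obj E \<Longrightarrow> FO p' (FO h e) = FO p e" "g \<in> Arr E \<Longrightarrow> FA p' (FA h g) = FA p g"
  using p functor_betweenD[OF h] by (auto simp flip: p)

lemma pb_unit_natural:
  "comp_func (pb_map (id_func C) p h p') (pb_unit p) = comp_func (pb_unit p') h"
  unfolding comp_func_eq_mk[of "pb_map _ p h p'"] comp_func_eq_mk[of "pb_unit p'"] mk_func_def
  by (auto simp: functor_betweenD[OF p'] functor_betweenD[OF h]
      functor_betweenD[OF over_functor] functor_simps[OF h] over_simps functor_simps[OF over_functor]
      intro!: restrict_ext)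

context
  fixes w :: "'u sfunc" and C'
  assumes w: "functor_between w C' C"
begin

lemma pb_map_functor: "functor_between (pb_map w p h p') (pb_cat w p) (pb_cat w p')"
  unfolding pb_map_eq_mk
  by (rule mk_func_functor[OF category_pb_cat[OF w over_functor] category_pb_cat[OF w p']])
    (auto simp: functor_betweenD[OF w] functor_betweenD[OF p'] functor_betweenD[OF h] functor_betweenD[OF over_functor] functor_simps[OF h] over_simps)

lemma pb_proj_map: "comp_func (pb_proj w p') (pb_map w p h p') = pb_proj w p"
  by (rule func_eqI[OF comp_func_functor[OF pb_map_functor pb_proj_functor[OF w p']] pb_proj_functor[OF w over_functor]])
    (auto simp: functor_betweenD[OF w] functor_betweenD[OF p'] functor_betweenD[OF h] functor_betweenD[OF over_functor] functor_simps[OF h] over_simps)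

lemma pb_map_comp:
  assumes h': "functor_between h' E0 E" and p0: "comp_func p h' = p0"
  shows "comp_func (pb_map w p h p') (pb_map w p0 h' p) = pb_map w p0 (comp_func h h') p'"
proof -
  have p0': "functor_between p0 E0 C" using comp_func_functor[OF h' over_functor] p0 by simp
  have *: "FO p (FO h' e) = FO p0 e" if "e \<in> Obj E0" for e
    using that functor_betweenD[OF h'] by (simp flip: p0)
  have **: "FA p (FA h' e) = FA p0 e" if "e \<in> Arr E0" for e
    using that functor_betweenD[OF h'] by (simp flip: p0)
  show ?thesis
    unfolding comp_func_eq_mk[of "pb_map w p h p'"] pb_map_eq_mk[of w p0 "comp_func h h'"] mk_func_def
    by (auto simp: functor_betweenD[OF w] functor_betweenD[OF h'] functor_betweenD[OF over_functor]
        functor_betweenD[OF p0'] * ** functor_simps[OF h'] intro!: restrict_ext)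
qed

lemma pb_cmp_natural:
  assumes w': "functor_between w' C'' C'"
  shows "comp_func (pb_cmp w w' p') (pb_map w' (pb_proj w p) (pb_map w p h p') (pb_proj w p'))
    = comp_func (pb_map (comp_func w w') p h p') (pb_cmp w w' p)"
  unfolding comp_func_eq_mk[of "pb_cmp w w' p'"] comp_func_eq_mk[of "pb_map _ p h p'"] mk_func_def
  by (auto simp: functor_betweenD[OF w] functor_betweenD[OF p'] functor_betweenD[OF h]
      functor_betweenD[OF over_functor] functor_betweenD[OF w'] functor_simps[OF h] over_simps
      functor_simps[OF over_functor] intro!: restrict_ext)

end

end

section \<open>Unit and associativity laws of pullback\<close>

context
  fixes p :: "('u::universe) sfunc" and C E
  assumes p: "functor_between p E C"
begin

lemma pb_unit_functor: "functor_between (pb_unit p) E (pb_cat (id_func C) p)"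
proof -
  have "functor_between (pb_unit p) (Src p) (pb_cat (id_func (Tgt p)) p)"
    unfolding pb_unit_eq_mk
    by (rule mk_func_functor)
      (auto simp: functor_betweenD[OF p] functor_simps[OF p] intro!: category_pb_cat[OF id_func_functor p])
  then show ?thesis by (simp add: functor_betweenD[OF p])
qed

lemma pb_proj_unit: "comp_func (pb_proj (id_func C) p) (pb_unit p) = p"
  by (rule func_eqI[OF comp_func_functor[OF pb_unit_functor pb_proj_functor[OF id_func_functor p]] p])
    (auto simp: functor_betweenD[OF p] functor_simps[OF p])

lemma iso_pb_unit:
  assumes "small_cat E" "small_cat C" shows "iso Cat (pb_unit p)"
  by (rule iso_CatI[OF pb_unit_functor])
    (auto simp: assms functor_betweenD[OF p] functor_simps[OF p] inj_on_def bij_betw_def image_iff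
      intro!: small_cat_pb_cat[OF id_func_functor p])

context
  fixes w :: "'u sfunc" and C'
  assumes w: "functor_between w C' C"
begin

lemma pb_map_id: "pb_map w p (id_func E) p = id_func (pb_cat w p)"
  unfolding id_func_eq_mk pb_map_eq_mk mk_func_def
  by (auto simp: functor_betweenD[OF w] functor_betweenD[OF p] intro!: restrict_ext)

text \<open>On \<open>pair c e\<close> the unit adds a second copy of \<open>c\<close>, which the
  comparison drops again. This is one of the two unit laws of the pullback pseudofunctors.\<close>

lemma pb_cmp_proj_unit: "comp_func (pb_cmp w (id_func C') p) (pb_unit (pb_proj w p)) = id_func (pb_cat w p)"
  unfolding comp_func_eq_mk[of "pb_cmp _ _ _"] id_func_eq_mk[of "pb_cat w p"] mk_func_def
  by (auto simp: functor_betweenD[OF w] functor_betweenD[OF p] comp_func_id_right[OF w] intro!: restrict_ext)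

text \<open>The other unit law: here the coordinate inserted and then dropped is the image of
  \<open>e\<close> under \<open>p\<close>.\<close>

lemma pb_cmp_map_unit:
  "comp_func (pb_cmp (id_func C) w p) (pb_map w p (pb_unit p) (pb_proj (id_func C) p)) = id_func (pb_cat w p)"
  unfolding comp_func_eq_mk[of "pb_cmp _ _ _"] id_func_eq_mk[of "pb_cat w p"] mk_func_def
  by (auto simp: functor_betweenD[OF w] functor_betweenD[OF p] functor_simps[OF p] comp_func_id_left[OF w]
      intro!: restrict_ext)

context
  fixes w' :: "'u sfunc" and C''
  assumes w': "functor_between w' C'' C'"
begin

lemma pb_cmp_functor: "functor_between (pb_cmp w w' p) (pb_cat w' (pb_proj w p)) (pb_cat (comp_func w w') p)"
  unfolding pb_cmp_eq_mk
  by (rule mk_func_functor[OF category_pb_cat[OF w' pb_proj_functor[OF w p]]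
        category_pb_cat[OF comp_func_functor[OF w' w] p]])
    (auto simp: functor_betweenD[OF w] functor_betweenD[OF p] functor_betweenD[OF w'])

lemma pb_proj_cmp: "comp_func (pb_proj (comp_func w w') p) (pb_cmp w w' p) = pb_proj w' (pb_proj w p)"
  by (rule func_eqI[OF comp_func_functor[OF pb_cmp_functor pb_proj_functor[OF comp_func_functor[OF w' w] p]]
        pb_proj_functor[OF w' pb_proj_functor[OF w p]]])
    (auto simp: functor_betweenD[OF w] functor_betweenD[OF p] functor_betweenD[OF w'])

lemma iso_pb_cmp:
  assumes "small_cat E" "small_cat C'" "small_cat C''" shows "iso Cat (pb_cmp w w' p)"
proof (rule iso_CatI[OF pb_cmp_functor])
  note [simp] = functor_betweenD[OF w] functor_betweenD[OF p] functor_betweenD[OF w'] functor_simps[OF w']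
  show "small_cat (pb_cat w' (pb_proj w p))" "small_cat (pb_cat (comp_func w w') p)"
    by (intro small_cat_pb_cat[OF w' pb_proj_functor[OF w p]] small_cat_pb_cat[OF w p] assms
        small_cat_pb_cat[OF comp_func_functor[OF w' w] p])+
  \<comment> \<open>The comparison forgets the middle coordinate, but membership in the iterated
    pullback forces that coordinate to be the image under \<open>w'\<close> of the first one; the
    witness restores it.\<close>
  show "bij_betw (FO (pb_cmp w w' p)) (Obj (pb_cat w' (pb_proj w p))) (Obj (pb_cat (comp_func w w') p))"
    by (rule bij_betw_byWitness[where f' = "\<lambda>z. pair (p1 z) (pair (FO w' (p1 z)) (p2 z))"]) auto
  show "bij_betw (FA (pb_cmp w w' p)) (Arr (pb_cat w' (pb_proj w p))) (Arr (pb_cat (comp_func w w') p))"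
    by (rule bij_betw_byWitness[where f' = "\<lambda>z. pair (p1 z) (pair (FA w' (p1 z)) (p2 z))"]) auto
qed

text \<open>Both composites keep the outermost and the innermost coordinate:
  \<open>pair c (pair c' (pair c1 e))\<close> goes to \<open>pair c e\<close>.\<close>

lemma pb_cmp_assoc:
  assumes w'': "functor_between w'' C''' C''"
  shows "comp_func (pb_cmp (comp_func w w') w'' p)
      (pb_map w'' (pb_proj w' (pb_proj w p)) (pb_cmp w w' p) (pb_proj (comp_func w w') p))
    = comp_func (pb_cmp w (comp_func w' w'') p) (pb_cmp w' w'' (pb_proj w p))"
  unfolding comp_func_eq_mk[of "pb_cmp _ _ _"] mk_func_def
  by (auto simp: functor_betweenD[OF w] functor_betweenD[OF p] functor_betweenD[OF w'] functor_betweenD[OF w'']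
      functor_simps[OF w''] comp_func_assoc[OF w'' w' w] intro!: restrict_ext)

end

end

end

subsection \<open>Equivalences\<close>

text \<open>The usual argument by choice. Every \<open>d\<close> receives a chosen isomorphism
  \<open>e d\<close> from an object in the image, with inverse \<open>e' d\<close>; a quasi-inverse
  is obtained by conjugating with these and taking preimages, which exist by fullness. Every
  equation required in \<open>C\<close> is then checked after applying \<open>F\<close>, by
  faithfulness.\<close>

lemma equivalenceI:
  assumes F: "functor_between F C D"
    and faithful: "\<And>f g. f \<in> Arr C \<Longrightarrow> g \<in> Arr C \<Longrightarrow> Dom C f = Dom C g \<Longrightarrow> Cod C f = Cod C g \<Longrightarrow>
      FA F f = FA F g \<Longrightarrow> f = g"
    and full: "\<And>x y k. x \<in> Obj C \<Longrightarrow> y \<in> Obj C \<Longrightarrow> k \<in> Arr D \<Longrightarrow> Dom D k = FO F x \<Longrightarrow> Cod D k = FO F y \<Longrightarrow>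
      \<exists>f. f \<in> Arr C \<and> Dom C f = x \<and> Cod C f = y \<and> FA F f = k"
    and surj: "\<And>d. d \<in> Obj D \<Longrightarrow> \<exists>c k. c \<in> Obj C \<and> iso D k \<and> Dom D k = FO F c \<and> Cod D k = d"
  shows "equivalence F"
proof -
  note F1 = functor_betweenD[OF F]
  define R where "R d c k k' \<longleftrightarrow> c \<in> Obj C \<and> iso D k \<and> Dom D k = FO F c \<and> Cod D k = d \<and>
    k' \<in> Arr D \<and> Dom D k' = d \<and> Cod D k' = FO F c \<and> Comp D k' k = Ident D (FO F c) \<and> Comp D k k' = Ident D d"
    for d c k k'
  have "\<exists>c k k'. R d c k k'" if "d \<in> Obj D" for d
  proof -
    obtain c k where ck: "c \<in> Obj C" "iso D k" "Dom D k = FO F c" "Cod D k = d"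
      using surj \<open>d \<in> Obj D\<close> by blast
    then obtain k' where "k' \<in> Arr D" "Dom D k' = d" "Cod D k' = FO F c" "Comp D k' k = Ident D (FO F c)"
        "Comp D k k' = Ident D d"
      unfolding iso_def by (auto simp: in_hom)
    with ck show ?thesis unfolding R_def by blast
  qed
  then obtain g0 e e' where R: "\<And>d. d \<in> Obj D \<Longrightarrow> R d (g0 d) (e d) (e' d)" by metis
  then have g: "\<And>d. d \<in> Obj D \<Longrightarrow> g0 d \<in> Obj C"
    and ei: "\<And>d. d \<in> Obj D \<Longrightarrow> iso D (e d)"
    and e: "\<And>d. d \<in> Obj D \<Longrightarrow> Dom D (e d) = FO F (g0 d)" "\<And>d. d \<in> Obj D \<Longrightarrow> Cod D (e d) = d"
    and e': "\<And>d. d \<in> Obj D \<Longrightarrow> e' d \<in> Arr D" "\<And>d. d \<in> Obj D \<Longrightarrow> Dom D (e' d) = d"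
      "\<And>d. d \<in> Obj D \<Longrightarrow> Cod D (e' d) = FO F (g0 d)"
    and ee: "\<And>d. d \<in> Obj D \<Longrightarrow> Comp D (e' d) (e d) = Ident D (FO F (g0 d))"
      "\<And>d. d \<in> Obj D \<Longrightarrow> Comp D (e d) (e' d) = Ident D d"
    unfolding R_def by blast+
  have ea: "e d \<in> Arr D" if "d \<in> Obj D" for d using ei[OF that] by (simp add: iso_def)
  \<comment> \<open>Removes an adjacent pair of a chosen isomorphism and its inverse from the middle
    of a left-nested composite.\<close>
  have cancel: "Comp D (Comp D a (e d)) (e' d) = a" if "d \<in> Obj D" "a \<in> Arr D" "Dom D a = d" for a d
    using that F1 e e' ea ee by (simp add: Comp_assoc[symmetric])
  define L where "L x y k = (SOME f. f \<in> Arr C \<and> Dom C f = x \<and> Cod C f = y \<and> FA F f = k)" for x y k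
  have L: "L x y k \<in> Arr C" "Dom C (L x y k) = x" "Cod C (L x y k) = y" "FA F (L x y k) = k"
    if "x \<in> Obj C" "y \<in> Obj C" "k \<in> Arr D" "Dom D k = FO F x" "Cod D k = FO F y" for x y k
    using someI_ex[OF full[OF that]] by (simp_all add: L_def)
  \<comment> \<open>The conjugate of \<open>k\<close> by the chosen isomorphisms; it runs between
    objects in the image of \<open>F\<close>, so it has a preimage, which becomes the value of the
    quasi-inverse at \<open>k\<close>.\<close>
  define t where "t k = Comp D (Comp D (e' (Cod D k)) k) (e (Dom D k))" for k
  have t: "t k \<in> Arr D" "Dom D (t k) = FO F (g0 (Dom D k))" "Cod D (t k) = FO F (g0 (Cod D k))"
    if "k \<in> Arr D" for k
    using that F1 e e' ea by (simp_all add: t_def)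
  define G where "G = mk_func D C g0 (\<lambda>k. L (g0 (Dom D k)) (g0 (Cod D k)) (t k))"
  note s = F1 functor_simps[OF F] g e e' ea ee L t
  have G: "functor_between G D C"
    unfolding G_def
  proof (rule mk_func_functor)
    fix x assume x: "x \<in> Obj D"
    show "L (g0 (Dom D (Ident D x))) (g0 (Cod D (Ident D x))) (t (Ident D x)) = Ident C (g0 x)"
      by (rule faithful) (use x in \<open>simp_all add: s\<close>, simp add: t_def s)
  next
    fix f k assume fk: "f \<in> Arr D" "k \<in> Arr D" "Cod D f = Dom D k"
    have "t (Comp D k f) = Comp D (t k) (t f)"
      using fk by (simp add: t_def s Comp_assoc cancel)
    then show "L (g0 (Dom D (Comp D k f))) (g0 (Cod D (Comp D k f))) (t (Comp D k f)) =
        Comp C (L (g0 (Dom D k)) (g0 (Cod D k)) (t k)) (L (g0 (Dom D f)) (g0 (Cod D f)) (t f))"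
      using fk by (intro faithful) (simp_all add: s)
  qed (simp_all add: s)
  have GF: "functor_between (comp_func G F) C C" and FG: "functor_between (comp_func F G) D D"
    using F G by auto
  \<comment> \<open>The unit is the preimage of \<open>e'\<close> at \<open>FO F x\<close>; its
    inverse is the preimage of \<open>e\<close> there. The counit is \<open>e\<close>
    itself.\<close>
  define \<eta> where "\<eta> = \<lparr>NSrc = id_func C, NTgt = comp_func G F, NC = restrict (\<lambda>x. L x (g0 (FO F x)) (e' (FO F x))) (Obj C)\<rparr>"
  define \<epsilon> where "\<epsilon> = \<lparr>NSrc = comp_func F G, NTgt = id_func D, NC = restrict e (Obj D)\<rparr>"
  have "nat_iso \<eta> (id_func C) (comp_func G F)"
  proof (rule nat_isoI[OF id_func_functor GF])
    fix f assume f: "f \<in> Arr C"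
    show "Comp C (NC \<eta> (Cod C f)) (FA (id_func C) f) = Comp C (FA (comp_func G F) f) (NC \<eta> (Dom C f))"
      by (rule faithful)
        (use f functor_betweenD(2)[OF G] in \<open>simp_all add: \<eta>_def s G_def\<close>, simp add: t_def s cancel)
  next
    fix x assume x: "x \<in> Obj C"
    have "Comp C (L (g0 (FO F x)) x (e (FO F x))) (L x (g0 (FO F x)) (e' (FO F x))) = Ident C x"
      by (rule faithful) (use x in \<open>simp_all add: s\<close>)
    moreover have "Comp C (L x (g0 (FO F x)) (e' (FO F x))) (L (g0 (FO F x)) x (e (FO F x))) = Ident C (g0 (FO F x))"
      by (rule faithful) (use x in \<open>simp_all add: s\<close>)
    ultimately show "iso C (NC \<eta> x)"
      unfolding iso_def using x
      by (intro conjI bexI[of _ "L (g0 (FO F x)) x (e (FO F x))"]) (simp_all add: \<eta>_def s in_hom)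
  qed (use functor_betweenD(2)[OF G] in \<open>simp_all add: \<eta>_def s G_def\<close>)
  moreover have "nat_iso \<epsilon> (comp_func F G) (id_func D)"
  proof (rule nat_isoI[OF FG id_func_functor])
    fix f assume f: "f \<in> Arr D"
    show "Comp D (NC \<epsilon> (Cod D f)) (FA (comp_func F G) f) = Comp D (FA (id_func D) f) (NC \<epsilon> (Dom D f))"
      using f functor_betweenD(2)[OF G] by (simp add: \<epsilon>_def s G_def) (simp add: t_def s Comp_assoc)
  qed (use functor_betweenD(2)[OF G] ei in \<open>simp_all add: \<epsilon>_def s G_def\<close>)
  ultimately show ?thesis
    unfolding equivalence_def using F1 G by auto
qed

subsection \<open>Set-valued functors\<close>

definition ap :: "'u setfun \<Rightarrow> 'u \<Rightarrow> 'u" where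
  "ap m = fst (snd m)"

lemma ap_simp [simp]: "ap (X, f, Y) = f"
  by (simp add: ap_def)

lemma Arr_Set_eq:
  assumes "m \<in> Arr Set"
  shows "m = (Dom Set m, ap m, Cod Set m)" "ap m \<in> Dom Set m \<rightarrow>\<^sub>E Cod Set m"
  using assms by auto

lemma ap_Comp_Set:
  assumes "m \<in> Arr Set" "n \<in> Arr Set" "x \<in> Dom Set m"
  shows "ap (Comp Set n m) x = ap n (ap m x)"
  using assms by (auto simp: compose_def)

text \<open>Arrows of \<open>Set\<close> are triples with both ends recorded; from here on they are
  handled through their values on elements, which is the form in which functoriality is
  used.\<close>

lemma
  assumes X: "functor_between X C Set"
  shows copsh_small: "c \<in> Obj C \<Longrightarrow> small (FO X c)"
    and copsh_FA: "f \<in> Arr C \<Longrightarrow> FA X f = (FO X (Dom C f), ap (FA X f), FO X (Cod C f))"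
    and copsh_in: "f \<in> Arr C \<Longrightarrow> x \<in> FO X (Dom C f) \<Longrightarrow> ap (FA X f) x \<in> FO X (Cod C f)"
    and copsh_Ident: "c \<in> Obj C \<Longrightarrow> x \<in> FO X c \<Longrightarrow> ap (FA X (Ident C c)) x = x"
    and copsh_Comp: "f \<in> Arr C \<Longrightarrow> g \<in> Arr C \<Longrightarrow> Cod C f = Dom C g \<Longrightarrow> x \<in> FO X (Dom C f) \<Longrightarrow>
      ap (FA X (Comp C g f)) x = ap (FA X g) (ap (FA X f) x)"
proof -
  show "c \<in> Obj C \<Longrightarrow> small (FO X c)"
    using FO_in_Obj[OF X] by simp
  show *: "f \<in> Arr C \<Longrightarrow> FA X f = (FO X (Dom C f), ap (FA X f), FO X (Cod C f))" for f
    using Arr_Set_eq(1)[OF FA_in_Arr[OF X]] functor_simps[OF X] by metis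
  show "f \<in> Arr C \<Longrightarrow> x \<in> FO X (Dom C f) \<Longrightarrow> ap (FA X f) x \<in> FO X (Cod C f)"
    using Arr_Set_eq(2)[OF FA_in_Arr[OF X]] functor_simps[OF X] by (auto simp: PiE_def Pi_iff)
  show "c \<in> Obj C \<Longrightarrow> x \<in> FO X c \<Longrightarrow> ap (FA X (Ident C c)) x = x"
    by (simp add: functor_simps[OF X])
  show "f \<in> Arr C \<Longrightarrow> g \<in> Arr C \<Longrightarrow> Cod C f = Dom C g \<Longrightarrow> x \<in> FO X (Dom C f) \<Longrightarrow>
      ap (FA X (Comp C g f)) x = ap (FA X g) (ap (FA X f) x)"
    using ap_Comp_Set[OF FA_in_Arr[OF X] FA_in_Arr[OF X], of f g x] by (simp add: functor_simps[OF X] del: Set_simps(2-))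
qed

text \<open>\<open>XA f\<close> may be arbitrary off \<open>XO (Dom C f)\<close>; the restriction
  supplies the extensionality that arrows of \<open>Set\<close> must have.\<close>

definition mk_copsh :: "('o, 'a) cat \<Rightarrow> ('o \<Rightarrow> 'u set) \<Rightarrow> ('a \<Rightarrow> 'u \<Rightarrow> 'u) \<Rightarrow>
    ('o, 'a, ('u::universe) set, 'u setfun) func" where
  "mk_copsh C XO XA =
    mk_func C Set XO (\<lambda>f. (XO (Dom C f), restrict (XA f) (XO (Dom C f)), XO (Cod C f)))"

lemma mk_copsh_simps [simp]:
  "Src (mk_copsh C XO XA) = C" "Tgt (mk_copsh C XO XA) = Set"
  "c \<in> Obj C \<Longrightarrow> FO (mk_copsh C XO XA) c = XO c"
  "f \<in> Arr C \<Longrightarrow> x \<in> XO (Dom C f) \<Longrightarrow> ap (FA (mk_copsh C XO XA) f) x = XA f x"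
  by (simp_all add: mk_copsh_def)

lemma mk_copsh_functor:
  assumes C: "category C" and "\<And>c. c \<in> Obj C \<Longrightarrow> small (XO c)"
    and X: "\<And>f x. f \<in> Arr C \<Longrightarrow> x \<in> XO (Dom C f) \<Longrightarrow> XA f x \<in> XO (Cod C f)"
    and "\<And>c x. c \<in> Obj C \<Longrightarrow> x \<in> XO c \<Longrightarrow> XA (Ident C c) x = x"
    and "\<And>f g x. f \<in> Arr C \<Longrightarrow> g \<in> Arr C \<Longrightarrow> Cod C f = Dom C g \<Longrightarrow> x \<in> XO (Dom C f) \<Longrightarrow>
      XA (Comp C g f) x = XA g (XA f x)"
  shows "functor_between (mk_copsh C XO XA) C Set"
  unfolding mk_copsh_def
proof (rule mk_func_functor[OF C category_Set])
  fix f g assume "f \<in> Arr C" "g \<in> Arr C" "Cod C f = Dom C g"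
  then show "(XO (Dom C (Comp C g f)), restrict (XA (Comp C g f)) (XO (Dom C (Comp C g f))), XO (Cod C (Comp C g f)))
    = Comp Set (XO (Dom C g), restrict (XA g) (XO (Dom C g)), XO (Cod C g))
       (XO (Dom C f), restrict (XA f) (XO (Dom C f)), XO (Cod C f))"
    using assms X[of f] by (auto simp: compose_def intro!: restrict_ext)
qed (use assms in \<open>auto intro!: restrict_ext\<close>)

lemma
  assumes \<alpha>: "is_nt \<alpha>" "functor_between (NSrc \<alpha>) C Set"
  shows NC_Set: "c \<in> Obj C \<Longrightarrow> NC \<alpha> c = (FO (NSrc \<alpha>) c, ap (NC \<alpha> c), FO (NTgt \<alpha>) c)"
    and NC_in: "c \<in> Obj C \<Longrightarrow> x \<in> FO (NSrc \<alpha>) c \<Longrightarrow> ap (NC \<alpha> c) x \<in> FO (NTgt \<alpha>) c"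
    and NC_ext: "c \<in> Obj C \<Longrightarrow> ap (NC \<alpha> c) \<in> extensional (FO (NSrc \<alpha>) c)"
    and NC_natural_Set: "f \<in> Arr C \<Longrightarrow> x \<in> FO (NSrc \<alpha>) (Dom C f) \<Longrightarrow>
      ap (NC \<alpha> (Cod C f)) (ap (FA (NSrc \<alpha>) f) x) = ap (FA (NTgt \<alpha>) f) (ap (NC \<alpha> (Dom C f)) x)"
proof -
  note X = \<alpha>(2) and Y = nt_NTgt[OF \<alpha>]
  show "c \<in> Obj C \<Longrightarrow> NC \<alpha> c = (FO (NSrc \<alpha>) c, ap (NC \<alpha> c), FO (NTgt \<alpha>) c)"
    using Arr_Set_eq(1)[OF NC_in_Arr[OF \<alpha>]] Dom_NC[OF \<alpha>] Cod_NC[OF \<alpha>] by metis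
  show "c \<in> Obj C \<Longrightarrow> x \<in> FO (NSrc \<alpha>) c \<Longrightarrow> ap (NC \<alpha> c) x \<in> FO (NTgt \<alpha>) c"
    and "c \<in> Obj C \<Longrightarrow> ap (NC \<alpha> c) \<in> extensional (FO (NSrc \<alpha>) c)"
    using Arr_Set_eq(2)[OF NC_in_Arr[OF \<alpha>]] Dom_NC[OF \<alpha>] Cod_NC[OF \<alpha>] by (auto simp: PiE_def Pi_iff)
  assume f: "f \<in> Arr C" and x: "x \<in> FO (NSrc \<alpha>) (Dom C f)"
  have fO: "Dom C f \<in> Obj C" "Cod C f \<in> Obj C" using f functor_betweenD[OF X] by auto
  note s = FA_in_Arr[OF X f] FA_in_Arr[OF Y f] NC_in_Arr[OF \<alpha> fO(1)] NC_in_Arr[OF \<alpha> fO(2)]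
  have "ap (NC \<alpha> (Cod C f)) (ap (FA (NSrc \<alpha>) f) x) = ap (Comp Set (NC \<alpha> (Cod C f)) (FA (NSrc \<alpha>) f)) x"
    by (rule ap_Comp_Set[symmetric]) (use s x Dom_FA[OF X f] in auto)
  also have "\<dots> = ap (Comp Set (FA (NTgt \<alpha>) f) (NC \<alpha> (Dom C f))) x"
    using NC_natural[OF \<alpha> f] by simp
  also have "\<dots> = ap (FA (NTgt \<alpha>) f) (ap (NC \<alpha> (Dom C f)) x)"
    by (rule ap_Comp_Set) (use s x Dom_NC[OF \<alpha> fO(1)] in auto)
  finally show "ap (NC \<alpha> (Cod C f)) (ap (FA (NSrc \<alpha>) f) x) = ap (FA (NTgt \<alpha>) f) (ap (NC \<alpha> (Dom C f)) x)" .
qed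

definition mk_copsh_nt :: "('o, 'a, 'u set, 'u setfun) func \<Rightarrow> ('o, 'a, 'u set, 'u setfun) func \<Rightarrow>
    ('o \<Rightarrow> 'u \<Rightarrow> 'u) \<Rightarrow> ('o, 'a, ('u::universe) set, 'u setfun) nt" where
  "mk_copsh_nt X Y t = \<lparr>NSrc = X, NTgt = Y,
     NC = restrict (\<lambda>c. (FO X c, restrict (t c) (FO X c), FO Y c)) (Obj (Src X))\<rparr>"

lemma mk_copsh_nt_simps [simp]:
  "NSrc (mk_copsh_nt X Y t) = X" "NTgt (mk_copsh_nt X Y t) = Y"
  "c \<in> Obj (Src X) \<Longrightarrow> x \<in> FO X c \<Longrightarrow> ap (NC (mk_copsh_nt X Y t) c) x = t c x"
  by (simp_all add: mk_copsh_nt_def)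

lemma is_nt_mk_copsh_nt:
  assumes X: "functor_between X C Set" and Y: "functor_between Y C Set"
    and t: "\<And>c x. c \<in> Obj C \<Longrightarrow> x \<in> FO X c \<Longrightarrow> t c x \<in> FO Y c"
    and nat: "\<And>f x. f \<in> Arr C \<Longrightarrow> x \<in> FO X (Dom C f) \<Longrightarrow>
      t (Cod C f) (ap (FA X f) x) = ap (FA Y f) (t (Dom C f) x)"
  shows "is_nt (mk_copsh_nt X Y t)"
proof (rule ntI[of _ C Set])
  note s = functor_betweenD[OF X] functor_betweenD[OF Y]
  fix f assume f: "f \<in> Arr C"
  have fO: "Dom C f \<in> Obj C" "Cod C f \<in> Obj C" using f s by auto
  show "Comp Set (NC (mk_copsh_nt X Y t) (Cod C f)) (FA (NSrc (mk_copsh_nt X Y t)) f) =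
      Comp Set (FA (NTgt (mk_copsh_nt X Y t)) f) (NC (mk_copsh_nt X Y t) (Dom C f))"
    using f fO s nat[OF f] copsh_in[OF X f] t[OF fO(1)] copsh_FA[OF X f] copsh_FA[OF Y f]
    by (cases "FA X f"; cases "FA Y f") (auto simp: mk_copsh_nt_def compose_def intro!: restrict_ext)
qed (use assms functor_betweenD[OF X] copsh_small in \<open>auto simp: mk_copsh_nt_def\<close>)

lemma copsh_nt_eqI:
  assumes \<alpha>: "is_nt \<alpha>" "functor_between (NSrc \<alpha>) C Set" and \<beta>: "is_nt \<beta>"
    and eq: "NSrc \<alpha> = NSrc \<beta>" "NTgt \<alpha> = NTgt \<beta>"
    and ap: "\<And>c x. c \<in> Obj C \<Longrightarrow> x \<in> FO (NSrc \<alpha>) c \<Longrightarrow> ap (NC \<alpha> c) x = ap (NC \<beta> c) x"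
  shows "\<alpha> = \<beta>"
proof (rule nt_eqI[OF \<alpha>(1) \<beta> \<alpha>(2) eq])
  fix c assume c: "c \<in> Obj C"
  have \<beta>': "functor_between (NSrc \<beta>) C Set" using \<alpha> eq by simp
  have "ap (NC \<alpha> c) = ap (NC \<beta> c)"
    using NC_ext[OF \<alpha> c] NC_ext[OF \<beta> \<beta>' c] ap[OF c] eq by (metis extensionalityI)
  then show "NC \<alpha> c = NC \<beta> c"
    using NC_Set[OF \<alpha> c] NC_Set[OF \<beta> \<beta>' c] eq by metis
qed

lemma iso_copsh_ntI:
  assumes \<alpha>: "is_nt \<alpha>" "functor_between (NSrc \<alpha>) C Set"
    and bij: "\<And>c. c \<in> Obj C \<Longrightarrow> bij_betw (ap (NC \<alpha> c)) (FO (NSrc \<alpha>) c) (FO (NTgt \<alpha>) c)"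
  shows "iso (func_cat C Set) \<alpha>"
proof (rule iso_func_cat[OF \<alpha>])
  fix c assume c: "c \<in> Obj C"
  show "iso Set (NC \<alpha> c)"
    by (subst NC_Set[OF \<alpha> c], rule iso_SetI)
      (use c copsh_small[OF \<alpha>(2)] copsh_small[OF nt_NTgt[OF \<alpha>]] NC_ext[OF \<alpha>] bij in auto)
qed

lemma copsh_Comp_ap:
  assumes "is_nt \<alpha>" "functor_between (NSrc \<alpha>) C Set" "is_nt \<beta>" "NSrc \<beta> = NTgt \<alpha>" "c \<in> Obj C" "x \<in> FO (NSrc \<alpha>) c"
  shows "ap (NC (Comp (func_cat C Set) \<beta> \<alpha>) c) x = ap (NC \<beta> c) (ap (NC \<alpha> c) x)"
proof -
  have "functor_between (NSrc \<beta>) C Set" using nt_NTgt assms by metis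
  then show ?thesis
    using assms ap_Comp_Set[OF NC_in_Arr[of \<alpha> C Set c] NC_in_Arr[of \<beta> C Set c]] Dom_NC[of \<alpha> C Set c] by simp
qed

lemma copsh_Ident_ap:
  assumes "functor_between X C Set" "c \<in> Obj C" "x \<in> FO X c"
  shows "ap (NC (Ident (func_cat C Set) X) c) x = x"
  using assms by simp

subsection \<open>Pseudofunctors\<close>

lemma nat_iso_id_nt: "functor_between F C D \<Longrightarrow> F = G \<Longrightarrow> nat_iso (id_nt F G) F G"
  using id_nt_nat_iso by blast

text \<open>When the action preserves identities and composites exactly and the cells are families
  of identities, every coherence law is an equation between identities of the same object.\<close>

lemma strict_pseudofunctor:
  assumes K: "category K" and fib: "\<And>k. k \<in> Obj K \<Longrightarrow> category (fib P k)"
    and act: "\<And>w. w \<in> Arr K \<Longrightarrow> functor_between (act P w) (fib P (Cod K w)) (fib P (Dom K w))"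
    and id: "\<And>k. k \<in> Obj K \<Longrightarrow> act P (Ident K k) = id_func (fib P k)"
    and comp: "\<And>w w'. w \<in> Arr K \<Longrightarrow> w' \<in> Arr K \<Longrightarrow> Cod K w' = Dom K w \<Longrightarrow>
      act P (Comp K w w') = comp_func (act P w') (act P w)"
    and unitor: "\<And>k. k \<in> Obj K \<Longrightarrow> unitor P k = id_nt (id_func (fib P k)) (act P (Ident K k))"
    and compositor: "\<And>w w'. w \<in> Arr K \<Longrightarrow> w' \<in> Arr K \<Longrightarrow> Cod K w' = Dom K w \<Longrightarrow>
      compositor P w w' = id_nt (comp_func (act P w') (act P w)) (act P (Comp K w w'))"
  shows "pseudofunctor K P"
proof -
  have un: "NC (unitor P k) X = Ident (fib P k) X" if "k \<in> Obj K" "X \<in> Obj (fib P k)" for k X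
    using that by (simp add: unitor id_nt_def)
  have co: "NC (compositor P w w') X = Ident (fib P (Dom K w')) (FO (act P w') (FO (act P w) X))"
    if "w \<in> Arr K" "w' \<in> Arr K" "Cod K w' = Dom K w" "X \<in> Obj (fib P (Cod K w))" for w w' X
    using that functor_betweenD[OF act[OF that(1)]] functor_betweenD[OF act[OF that(2)]]
    by (simp add: compositor id_nt_def)
  have act_id: "FO (act P (Ident K k)) X = X" if "k \<in> Obj K" "X \<in> Obj (fib P k)" for k X
    using that by (simp add: id)
  have act_comp: "FO (act P (Comp K w w')) X = FO (act P w') (FO (act P w) X)"
    if "w \<in> Arr K" "w' \<in> Arr K" "Cod K w' = Dom K w" "X \<in> Obj (fib P (Cod K w))" for w w' X
    using that functor_betweenD[OF act[OF that(1)]] by (simp add: comp)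
  have actD: "FO (act P w) X \<in> Obj (fib P (Dom K w))" if "w \<in> Arr K" "X \<in> Obj (fib P (Cod K w))" for w X
    using FO_in_Obj[OF act] that by blast
  have act_Ident: "FA (act P w) (Ident (fib P (Cod K w)) X) = Ident (fib P (Dom K w)) (FO (act P w) X)"
    if "w \<in> Arr K" "X \<in> Obj (fib P (Cod K w))" for w X
    using FA_Ident[OF act] that by blast
  have act_Ident': "FA (act P w') (Ident (fib P (Dom K w)) X) = Ident (fib P (Dom K w')) (FO (act P w') X)"
    if "w' \<in> Arr K" "Cod K w' = Dom K w" "X \<in> Obj (fib P (Dom K w))" for w w' X
    using act_Ident that by metis
  have isou: "nat_iso (unitor P k) (id_func (fib P k)) (act P (Ident K k))" if "k \<in> Obj K" for k
    unfolding unitor[OF that] by (rule nat_iso_id_nt[OF id_func_functor]) (use that fib id in auto)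
  have isoc: "nat_iso (compositor P w w') (comp_func (act P w') (act P w)) (act P (Comp K w w'))"
    if w: "w \<in> Arr K" "w' \<in> Arr K" "Cod K w' = Dom K w" for w w'
    unfolding compositor[OF w]
    by (rule nat_iso_id_nt[OF comp_func_functor[OF act[OF w(1)] act[OF w(2), unfolded w(3)]] comp[OF w, symmetric]])
  show ?thesis
    unfolding pseudofunctor_def
    using K fib act isou isoc by (auto simp: un co act_id act_comp actD act_Ident act_Ident')
qed

text \<open>\<open>P'\<close> is the reindexing of \<open>P\<close> along \<open>T\<close>, but only on composable data: elsewhere the operations of
  \<open>Prof\<close> and of the reindexed presheaf pseudofunctor differ.\<close>

definition reindexes ::
  "('l, 'm, 'k, 'n) func \<Rightarrow> ('k, 'n, 'o, 'a) psf \<Rightarrow> ('l, 'm, 'o, 'a) psf \<Rightarrow> bool" where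
  "reindexes T P P' \<longleftrightarrow>
    (\<forall>k\<in>Obj (Src T). fib P' k = fib P (FO T k) \<and> unitor P' k = unitor P (FO T k)) \<and>
    (\<forall>w\<in>Arr (Src T). act P' w = act P (FA T w)) \<and>
    (\<forall>w\<in>Arr (Src T). \<forall>w'\<in>Arr (Src T). Cod (Src T) w' = Dom (Src T) w \<longrightarrow>
      compositor P' w w' = compositor P (FA T w) (FA T w'))"

lemma pseudofunctorD:
  assumes "pseudofunctor K P"
  shows "category K"
    and "\<And>k. k \<in> Obj K \<Longrightarrow> category (fib P k)"
    and "\<And>w. w \<in> Arr K \<Longrightarrow> functor_between (act P w) (fib P (Cod K w)) (fib P (Dom K w))"
    and "\<And>k. k \<in> Obj K \<Longrightarrow> nat_iso (unitor P k) (id_func (fib P k)) (act P (Ident K k))"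
    and "\<And>w w'. w \<in> Arr K \<Longrightarrow> w' \<in> Arr K \<Longrightarrow> Cod K w' = Dom K w \<Longrightarrow>
      nat_iso (compositor P w w') (comp_func (act P w') (act P w)) (act P (Comp K w w'))"
    and "\<And>w X. w \<in> Arr K \<Longrightarrow> X \<in> Obj (fib P (Cod K w)) \<Longrightarrow>
      Comp (fib P (Dom K w)) (NC (compositor P w (Ident K (Dom K w))) X)
          (NC (unitor P (Dom K w)) (FO (act P w) X))
        = Ident (fib P (Dom K w)) (FO (act P w) X)"
    and "\<And>w X. w \<in> Arr K \<Longrightarrow> X \<in> Obj (fib P (Cod K w)) \<Longrightarrow>
      Comp (fib P (Dom K w)) (NC (compositor P (Ident K (Cod K w)) w) X)
          (FA (act P w) (NC (unitor P (Cod K w)) X))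
        = Ident (fib P (Dom K w)) (FO (act P w) X)"
    and "\<And>w w' w'' X. w \<in> Arr K \<Longrightarrow> w' \<in> Arr K \<Longrightarrow> w'' \<in> Arr K \<Longrightarrow> X \<in> Obj (fib P (Cod K w)) \<Longrightarrow>
      Cod K w' = Dom K w \<Longrightarrow> Cod K w'' = Dom K w' \<Longrightarrow>
      Comp (fib P (Dom K w'')) (NC (compositor P (Comp K w w') w'') X)
          (FA (act P w'') (NC (compositor P w w') X))
        = Comp (fib P (Dom K w'')) (NC (compositor P w (Comp K w' w'')) X)
          (NC (compositor P w' w'') (FO (act P w) X))"
  using assms unfolding pseudofunctor_def by blast+

lemma pseudofunctorI:
  assumes "category K"
    and "\<And>k. k \<in> Obj K \<Longrightarrow> category (fib P k)"
    and "\<And>w. w \<in> Arr K \<Longrightarrow> functor_between (act P w) (fib P (Cod K w)) (fib P (Dom K w))"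
    and "\<And>k. k \<in> Obj K \<Longrightarrow> nat_iso (unitor P k) (id_func (fib P k)) (act P (Ident K k))"
    and "\<And>w w'. w \<in> Arr K \<Longrightarrow> w' \<in> Arr K \<Longrightarrow> Cod K w' = Dom K w \<Longrightarrow>
      nat_iso (compositor P w w') (comp_func (act P w') (act P w)) (act P (Comp K w w'))"
    and "\<And>w X. w \<in> Arr K \<Longrightarrow> X \<in> Obj (fib P (Cod K w)) \<Longrightarrow>
      Comp (fib P (Dom K w)) (NC (compositor P w (Ident K (Dom K w))) X)
          (NC (unitor P (Dom K w)) (FO (act P w) X))
        = Ident (fib P (Dom K w)) (FO (act P w) X)"
    and "\<And>w X. w \<in> Arr K \<Longrightarrow> X \<in> Obj (fib P (Cod K w)) \<Longrightarrow>
      Comp (fib P (Dom K w)) (NC (compositor P (Ident K (Cod K w)) w) X)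
          (FA (act P w) (NC (unitor P (Cod K w)) X))
        = Ident (fib P (Dom K w)) (FO (act P w) X)"
    and "\<And>w w' w'' X. w \<in> Arr K \<Longrightarrow> w' \<in> Arr K \<Longrightarrow> w'' \<in> Arr K \<Longrightarrow> X \<in> Obj (fib P (Cod K w)) \<Longrightarrow>
      Cod K w' = Dom K w \<Longrightarrow> Cod K w'' = Dom K w' \<Longrightarrow>
      Comp (fib P (Dom K w'')) (NC (compositor P (Comp K w w') w'') X)
          (FA (act P w'') (NC (compositor P w w') X))
        = Comp (fib P (Dom K w'')) (NC (compositor P w (Comp K w' w'')) X)
          (NC (compositor P w' w'') (FO (act P w) X))"
  shows "pseudofunctor K P"
  using assms unfolding pseudofunctor_def by blast

lemma pseudonaturalD:
  assumes "pseudonatural K P Q \<Phi> \<theta>"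
  shows "pseudofunctor K P" "pseudofunctor K Q"
    and "\<And>k. k \<in> Obj K \<Longrightarrow> functor_between (\<Phi> k) (fib P k) (fib Q k)"
    and "\<And>w. w \<in> Arr K \<Longrightarrow> nat_iso (\<theta> w) (comp_func (\<Phi> (Dom K w)) (act P w)) (comp_func (act Q w) (\<Phi> (Cod K w)))"
    and "\<And>k X. k \<in> Obj K \<Longrightarrow> X \<in> Obj (fib P k) \<Longrightarrow>
      Comp (fib Q k) (NC (\<theta> (Ident K k)) X) (FA (\<Phi> k) (NC (unitor P k) X)) = NC (unitor Q k) (FO (\<Phi> k) X)"
    and "\<And>w w' X. w \<in> Arr K \<Longrightarrow> w' \<in> Arr K \<Longrightarrow> X \<in> Obj (fib P (Cod K w)) \<Longrightarrow> Cod K w' = Dom K w \<Longrightarrow>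
      Comp (fib Q (Dom K w')) (NC (\<theta> (Comp K w w')) X) (FA (\<Phi> (Dom K w')) (NC (compositor P w w') X))
        = Comp (fib Q (Dom K w')) (NC (compositor Q w w') (FO (\<Phi> (Cod K w)) X))
          (Comp (fib Q (Dom K w')) (FA (act Q w') (NC (\<theta> w) X)) (NC (\<theta> w') (FO (act P w) X)))"
  using assms unfolding pseudonatural_def by blast+

lemma pseudonaturalI:
  assumes "pseudofunctor K P" "pseudofunctor K Q"
    and "\<And>k. k \<in> Obj K \<Longrightarrow> functor_between (\<Phi> k) (fib P k) (fib Q k)"
    and "\<And>w. w \<in> Arr K \<Longrightarrow> nat_iso (\<theta> w) (comp_func (\<Phi> (Dom K w)) (act P w)) (comp_func (act Q w) (\<Phi> (Cod K w)))"
    and "\<And>k X. k \<in> Obj K \<Longrightarrow> X \<in> Obj (fib P k) \<Longrightarrow>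
      Comp (fib Q k) (NC (\<theta> (Ident K k)) X) (FA (\<Phi> k) (NC (unitor P k) X)) = NC (unitor Q k) (FO (\<Phi> k) X)"
    and "\<And>w w' X. w \<in> Arr K \<Longrightarrow> w' \<in> Arr K \<Longrightarrow> X \<in> Obj (fib P (Cod K w)) \<Longrightarrow> Cod K w' = Dom K w \<Longrightarrow>
      Comp (fib Q (Dom K w')) (NC (\<theta> (Comp K w w')) X) (FA (\<Phi> (Dom K w')) (NC (compositor P w w') X))
        = Comp (fib Q (Dom K w')) (NC (compositor Q w w') (FO (\<Phi> (Cod K w)) X))
          (Comp (fib Q (Dom K w')) (FA (act Q w') (NC (\<theta> w) X)) (NC (\<theta> w') (FO (act P w) X)))"
  shows "pseudonatural K P Q \<Phi> \<theta>"
  using assms unfolding pseudonatural_def by blast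

lemma reindexesD:
  assumes "reindexes T P P'" and "functor_between T L K"
  shows "k \<in> Obj L \<Longrightarrow> fib P' k = fib P (FO T k)" "k \<in> Obj L \<Longrightarrow> unitor P' k = unitor P (FO T k)"
    "w \<in> Arr L \<Longrightarrow> act P' w = act P (FA T w)"
    "w \<in> Arr L \<Longrightarrow> w' \<in> Arr L \<Longrightarrow> Cod L w' = Dom L w \<Longrightarrow> compositor P' w w' = compositor P (FA T w) (FA T w')"
  using assms by (auto simp: reindexes_def functor_betweenD)

text \<open>Each axiom at arrows of \<open>L\<close> is the same axiom at their images in
  \<open>K\<close>. The images are again composable and \<open>T\<close> preserves composites
  strictly, so no new coherence arises.\<close>

lemma pseudofunctor_reindex:
  assumes P: "pseudofunctor K P" and T: "functor_between T L K" and P': "reindexes T P P'"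
  shows "pseudofunctor L P'"
proof -
  note s = reindexesD[OF P' T] functor_betweenD[OF T] functor_simps[OF T]
  show ?thesis
  proof (rule pseudofunctorI)
    fix w w' w'' X assume "w \<in> Arr L" "w' \<in> Arr L" "w'' \<in> Arr L" "X \<in> Obj (fib P' (Cod L w))"
      "Cod L w' = Dom L w" "Cod L w'' = Dom L w'"
    then show "Comp (fib P' (Dom L w'')) (NC (compositor P' (Comp L w w') w'') X)
          (FA (act P' w'') (NC (compositor P' w w') X))
        = Comp (fib P' (Dom L w'')) (NC (compositor P' w (Comp L w' w'')) X)
          (NC (compositor P' w' w'') (FO (act P' w) X))"
      using pseudofunctorD(8)[OF P, of "FA T w" "FA T w'" "FA T w''" X] by (simp add: s)
  next
    fix w X assume "w \<in> Arr L" "X \<in> Obj (fib P' (Cod L w))"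
    then show "Comp (fib P' (Dom L w)) (NC (compositor P' w (Ident L (Dom L w))) X)
          (NC (unitor P' (Dom L w)) (FO (act P' w) X)) = Ident (fib P' (Dom L w)) (FO (act P' w) X)"
      and "Comp (fib P' (Dom L w)) (NC (compositor P' (Ident L (Cod L w)) w) X)
          (FA (act P' w) (NC (unitor P' (Cod L w)) X)) = Ident (fib P' (Dom L w)) (FO (act P' w) X)"
      using pseudofunctorD(6,7)[OF P, of "FA T w" X] by (simp_all add: s)
  next
    fix w w' assume "w \<in> Arr L" "w' \<in> Arr L" "Cod L w' = Dom L w"
    then show "nat_iso (compositor P' w w') (comp_func (act P' w') (act P' w)) (act P' (Comp L w w'))"
      using pseudofunctorD(5)[OF P, of "FA T w" "FA T w'"] by (simp add: s)
  next
    fix w assume "w \<in> Arr L"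
    then show "functor_between (act P' w) (fib P' (Cod L w)) (fib P' (Dom L w))"
      using pseudofunctorD(3)[OF P, of "FA T w"] by (simp add: s)
  next
    fix k assume "k \<in> Obj L"
    then show "nat_iso (unitor P' k) (id_func (fib P' k)) (act P' (Ident L k))" "category (fib P' k)"
      using pseudofunctorD(2,4)[OF P, of "FO T k"] by (simp_all add: s)
  qed (simp add: s)
qed

text \<open>The way in which an equivalence in one variable \<open>C\<close> becomes one in the two
  variables \<open>A\<close> and \<open>B\<close>.\<close>

lemma pseudonatural_equivalence_reindex:
  assumes "pseudonatural_equivalence K P Q \<Phi> \<theta>" and T: "functor_between T L K"
    and P': "reindexes T P P'" and Q': "reindexes T Q Q'"
  shows "pseudonatural_equivalence L P' Q' (\<lambda>k. \<Phi> (FO T k)) (\<lambda>w. \<theta> (FA T w))"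
proof -
  have PQ: "pseudonatural K P Q \<Phi> \<theta>" and eq: "\<And>k. k \<in> Obj K \<Longrightarrow> equivalence (\<Phi> k)"
    using assms(1) by (auto simp: pseudonatural_equivalence_def)
  note s = reindexesD[OF P' T] reindexesD[OF Q' T] functor_betweenD[OF T] functor_simps[OF T]
  have "pseudonatural L P' Q' (\<lambda>k. \<Phi> (FO T k)) (\<lambda>w. \<theta> (FA T w))"
  proof (rule pseudonaturalI)
    fix w w' X assume "w \<in> Arr L" "w' \<in> Arr L" "X \<in> Obj (fib P' (Cod L w))" "Cod L w' = Dom L w"
    then show "Comp (fib Q' (Dom L w')) (NC (\<theta> (FA T (Comp L w w'))) X)
          (FA (\<Phi> (FO T (Dom L w'))) (NC (compositor P' w w') X))
        = Comp (fib Q' (Dom L w')) (NC (compositor Q' w w') (FO (\<Phi> (FO T (Cod L w))) X))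
          (Comp (fib Q' (Dom L w')) (FA (act Q' w') (NC (\<theta> (FA T w)) X)) (NC (\<theta> (FA T w')) (FO (act P' w) X)))"
      using pseudonaturalD(6)[OF PQ, of "FA T w" "FA T w'" X] by (simp add: s)
  next
    fix k X assume "k \<in> Obj L" "X \<in> Obj (fib P' k)"
    then show "Comp (fib Q' k) (NC (\<theta> (FA T (Ident L k))) X) (FA (\<Phi> (FO T k)) (NC (unitor P' k) X))
        = NC (unitor Q' k) (FO (\<Phi> (FO T k)) X)"
      using pseudonaturalD(5)[OF PQ, of "FO T k" X] by (simp add: s)
  next
    fix w assume "w \<in> Arr L"
    then show "nat_iso (\<theta> (FA T w)) (comp_func (\<Phi> (FO T (Dom L w))) (act P' w))
        (comp_func (act Q' w) (\<Phi> (FO T (Cod L w))))"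
      using pseudonaturalD(4)[OF PQ, of "FA T w"] by (simp add: s)
  next
    fix k assume "k \<in> Obj L"
    then show "functor_between (\<Phi> (FO T k)) (fib P' k) (fib Q' k)"
      using pseudonaturalD(3)[OF PQ, of "FO T k"] by (simp add: s)
  qed (rule pseudofunctor_reindex[OF pseudonaturalD(1)[OF PQ] T P']
      pseudofunctor_reindex[OF pseudonaturalD(2)[OF PQ] T Q'])+
  then show ?thesis
    using eq by (simp add: pseudonatural_equivalence_def s)
qed

subsection \<open>Precomposition\<close>

lemma precomp_simps [simp]:
  "Src (precomp w) = func_cat (Tgt w) Set" "Tgt (precomp w) = func_cat (Src w) Set"
  by (simp_all add: precomp_def)

lemma precomp_FO:
  fixes X :: "('u::universe) copsh"
  shows "functor_between w C' C \<Longrightarrow> functor_between X C Set \<Longrightarrow> FO (precomp w) X = comp_func X w"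
  by (simp add: precomp_def functor_betweenD)

lemma precomp_FA:
  fixes \<alpha> :: "('u::universe) copsh_nt"
  assumes w: "functor_between w C' C" and "is_nt \<alpha>" "functor_between (NSrc \<alpha>) C Set"
  shows "FA (precomp w) \<alpha> = \<lparr>NSrc = comp_func (NSrc \<alpha>) w, NTgt = comp_func (NTgt \<alpha>) w,
    NC = restrict (\<lambda>c. NC \<alpha> (FO w c)) (Obj C')\<rparr>"
  using assms functor_betweenD[OF w] by (simp add: precomp_def compose_def)

lemma precomp_nt:
  fixes \<alpha> :: "('u::universe) copsh_nt"
  assumes w: "functor_between w C' C" and \<alpha>: "is_nt \<alpha>" "functor_between (NSrc \<alpha>) C Set"
  shows "is_nt (FA (precomp w) \<alpha>)"
  unfolding precomp_FA[OF w \<alpha>]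
  by (rule ntI[of _ C' Set])
    (auto simp: comp_func_functor[OF w \<alpha>(2)] comp_func_functor[OF w nt_NTgt[OF \<alpha>]] functor_betweenD[OF w]
      functor_simps[OF w] Dom_NC[OF \<alpha>] Cod_NC[OF \<alpha>] NC_natural[OF \<alpha>] NC_in_Arr[OF \<alpha>] simp del: Set_simps
      simp flip: Cod_FA[OF w] Dom_FA[OF w])

lemma precomp_functor:
  fixes w :: "('u::universe) sfunc"
  assumes w: "functor_between w C' C"
  shows "functor_between (precomp w) (func_cat C Set) (func_cat C' Set)"
proof -
  note s = functor_betweenD[OF w] functor_simps[OF w] precomp_FO[OF w] precomp_FA[OF w]
  have "precomp w = mk_func (func_cat C Set) (func_cat C' Set) (\<lambda>X. comp_func X w) (\<lambda>\<alpha>.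
    \<lparr>NSrc = comp_func (NSrc \<alpha>) w, NTgt = comp_func (NTgt \<alpha>) w, NC = compose (Obj (Src w)) (NC \<alpha>) (FO w)\<rparr>)"
    by (simp add: precomp_def mk_func_def s)
  moreover have "functor_between \<dots> (func_cat C Set) (func_cat C' Set)"
  proof (rule mk_func_functor)
    show "category (func_cat C Set)" "category (func_cat C' Set)"
      by (auto intro!: category_func_cat category_Set simp: s)
    fix \<alpha> :: "'u copsh_nt" assume "\<alpha> \<in> Arr (func_cat C Set)"
    then show "\<lparr>NSrc = comp_func (NSrc \<alpha>) w, NTgt = comp_func (NTgt \<alpha>) w, NC = compose (Obj (Src w)) (NC \<alpha>) (FO w)\<rparr>
        \<in> Arr (func_cat C' Set)"
      using precomp_nt[OF w, of \<alpha>] precomp_FA[OF w, of \<alpha>] comp_func_functor[OF w, of "NSrc \<alpha>" Set]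
      by (simp add: compose_def s)
  qed (use comp_func_functor[OF w] in \<open>auto simp: s compose_def functor_betweenD(2) intro!: restrict_ext\<close>)
  ultimately show ?thesis by simp
qed

lemma precomp_id:
  fixes C :: "('u::universe) scat"
  assumes C: "category C" shows "precomp (id_func C) = id_func (func_cat C Set)"
proof (rule func_eqI[OF precomp_functor[OF id_func_functor[OF C]] id_func_functor])
  fix \<alpha> :: "'u copsh_nt" assume \<alpha>: "\<alpha> \<in> Arr (func_cat C Set)"
  have "restrict (\<lambda>c. NC \<alpha> (FO (id_func C) c)) (Obj C) = restrict (NC \<alpha>) (Obj C)"
    by (rule restrict_ext) simp
  also have "\<dots> = NC \<alpha>" using \<alpha> by (auto intro!: extensional_restrict NC_extensional)
  finally show "FA (precomp (id_func C)) \<alpha> = FA (id_func (func_cat C Set)) \<alpha>"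
    using \<alpha> precomp_FA[OF id_func_functor[OF C], of \<alpha>] nt_NTgt[of \<alpha> C Set]
      comp_func_id_right[of "NSrc \<alpha>" C Set] comp_func_id_right[of "NTgt \<alpha>" C Set] by simp
qed (auto simp: precomp_FO[OF id_func_functor[OF C]] category_func_cat C category_Set)

lemma precomp_comp:
  fixes w :: "('u::universe) sfunc"
  assumes w: "functor_between w C' C" and w': "functor_between w' C'' C'"
  shows "precomp (comp_func w w') = comp_func (precomp w') (precomp w)"
proof (rule func_eqI[OF precomp_functor[OF comp_func_functor[OF w' w]]
      comp_func_functor[OF precomp_functor[OF w] precomp_functor[OF w']]])
  note ww' = comp_func_functor[OF w' w]
  fix X :: "'u copsh" assume X: "X \<in> Obj (func_cat C Set)"
  then show "FO (precomp (comp_func w w')) X = FO (comp_func (precomp w') (precomp w)) X"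
    using precomp_FO[OF ww', of X] precomp_FO[OF w, of X] precomp_FO[OF w', of "comp_func X w"]
    by (simp add: functor_betweenD[OF w] comp_func_functor[OF w] comp_func_assoc[OF w' w])
next
  note ww' = comp_func_functor[OF w' w]
  fix \<alpha> :: "'u copsh_nt" assume \<alpha>: "\<alpha> \<in> Arr (func_cat C Set)"
  then show "FA (precomp (comp_func w w')) \<alpha> = FA (comp_func (precomp w') (precomp w)) \<alpha>"
    using precomp_FA[OF ww', of \<alpha>] precomp_FA[OF w, of \<alpha>] precomp_nt[OF w, of \<alpha>]
      precomp_FA[OF w', of "FA (precomp w) \<alpha>"] nt_NTgt[of \<alpha> C Set]
    by (auto simp: functor_betweenD[OF w] functor_betweenD[OF w'] functor_simps[OF w'] comp_func_functor[OF w]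
        comp_func_assoc[OF w' w] intro!: restrict_ext)
qed

definition Psh :: "(('u::universe) scat, 'u sfunc, 'u copsh, 'u copsh_nt) psf" where
  "Psh = \<lparr>fib = (\<lambda>C. func_cat (op_cat C) Set),
     act = (\<lambda>w. precomp (op_func w)),
     unitor = (\<lambda>C. id_nt (id_func (func_cat (op_cat C) Set)) (precomp (op_func (id_func C)))),
     compositor = (\<lambda>w w'. id_nt (comp_func (precomp (op_func w')) (precomp (op_func w)))
       (precomp (op_func (comp_func w w'))))\<rparr>"

lemma Psh_simps [simp]:
  "fib Psh C = func_cat (op_cat C) Set" "act Psh w = precomp (op_func w)"
  by (simp_all add: Psh_def)

lemma pseudofunctor_Psh: "pseudofunctor (Cat :: (('u::universe) scat, 'u sfunc) cat) Psh"
proof (rule strict_pseudofunctor)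
  fix w :: "'u sfunc" assume "w \<in> Arr Cat"
  then show "functor_between (act Psh w) (fib Psh (Cod Cat w)) (fib Psh (Dom Cat w))"
    using precomp_functor[OF op_func_functor[OF Arr_CatD]] by auto
next
  fix w w' :: "'u sfunc" assume *: "w \<in> Arr Cat" "w' \<in> Arr Cat" "Cod Cat w' = Dom Cat w"
  then have "functor_between w (Src w) (Tgt w)" "functor_between w' (Src w') (Src w)"
    using Arr_CatD[of w] Arr_CatD[of w'] by auto
  then show "act Psh (Comp Cat w w') = comp_func (act Psh w') (act Psh w)"
    using precomp_comp[OF op_func_functor op_func_functor, of w _ _ w'] by (simp add: op_func_comp)
qed (auto simp: Psh_def precomp_id small_catD category_func_cat category_Set category_Cat)

subsection \<open>Pullback of discrete fibrations\<close>

lemma iso_full_subcat: "iso C f \<Longrightarrow> Dom C f \<in> X \<Longrightarrow> Cod C f \<in> X \<Longrightarrow> iso (full_subcat C X) f"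
  unfolding iso_def by (auto simp: in_hom)

text \<open>The inverse \<open>k\<close> of \<open>h\<close> is automatically a map over
  \<open>c\<close>, because \<open>p k = p' h k = p'\<close>.\<close>

lemma iso_slice_cat:
  assumes K: "category K" and h: "iso K h" and p: "(p, h, p') \<in> Arr (slice_cat K c)"
  shows "iso (slice_cat K c) (p, h, p')"
proof -
  obtain k where k: "k \<in> Arr K" "Dom K k = Cod K h" "Cod K k = Dom K h"
    "Comp K k h = Ident K (Dom K h)" "Comp K h k = Ident K (Cod K h)"
    using h by (auto simp: iso_def in_hom)
  have "Comp K p k = p'"
    using Comp_assoc[OF K, of k h p'] k p K by simp
  then show ?thesis
    unfolding iso_def using p k by (intro conjI bexI[of _ "(p', k, p)"]) (simp_all add: in_hom)
qed

lemma DFib_simps [simp]: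
  "Dom (DFib C) (p, h, p') = p" "Cod (DFib C) (p, h, p') = p'"
  "Ident (DFib C) p = (p, id_func (Src p), p)"
  "Comp (DFib C) (q, h', p'') (p, h, p') = (p, comp_func h' h, p'')"
  by (simp_all add: DFib_def)

lemma Obj_DFib:
  "p \<in> Obj (DFib C) \<longleftrightarrow>
    functor_between p (Src p) C \<and> small_cat (Src p) \<and> small_cat C \<and> discrete_fibration p"
  by (auto simp: DFib_def functor_between_def)

lemma Arr_DFib:
  "(p, h, p') \<in> Arr (DFib C) \<longleftrightarrow>
    p \<in> Obj (DFib C) \<and> p' \<in> Obj (DFib C) \<and> functor_between h (Src p) (Src p') \<and> comp_func p' h = p"
  by (simp add: DFib_def functor_between_def, rule iffI; elim conjE; simp)

lemma Obj_DFibD: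
  assumes "p \<in> Obj (DFib C)"
  shows "functor_between p (Src p) C" "small_cat (Src p)" "small_cat C" "discrete_fibration p"
  using assms by (simp_all add: Obj_DFib)

lemma Arr_DFibD:
  assumes "(p, h, p') \<in> Arr (DFib C)"
  shows "p \<in> Obj (DFib C)" "p' \<in> Obj (DFib C)" "functor_between h (Src p) (Src p')" "comp_func p' h = p"
  using assms by (simp_all add: Arr_DFib)

lemma category_DFib: "category (DFib C)"
  unfolding DFib_def by (intro category_full_subcat category_slice_cat category_Cat)

lemma iso_DFib:
  assumes h: "iso Cat h" and "(p, h, p') \<in> Arr (DFib C)" shows "iso (DFib C) (p, h, p')"
  using assms iso_slice_cat[OF category_Cat h, of p p' C] unfolding DFib_def
  by (intro iso_full_subcat) (auto simp del: slice_cat_simps(2) Cat_simps)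

lemma discrete_fibration_lift:
  assumes "discrete_fibration p" and "functor_between p E C" and "e \<in> Obj E" "f \<in> Arr C" "Cod C f = FO p e"
  shows "\<exists>!g. g \<in> Arr E \<and> Cod E g = e \<and> FA p g = f"
  using assms by (simp add: discrete_fibration_def functor_between_def)

text \<open>The lift of \<open>f\<close> at \<open>pair c e\<close> is \<open>pair f g\<close>,
  where \<open>g\<close> is the lift at \<open>e\<close> of the image of \<open>f\<close> under
  \<open>w\<close>; the second coordinate of any other lift is a lift of the same arrow, hence equal
  to \<open>g\<close>.\<close>

lemma discrete_fibration_pb_proj:
  assumes w: "functor_between w C' C" and p: "functor_between p E C" and d: "discrete_fibration p"
  shows "discrete_fibration (pb_proj w p)"
  unfolding discrete_fibration_def
proof (intro conjI ballI impI)
  show "is_functor (pb_proj w p)" using pb_proj_functor[OF w p] by (simp add: functor_between_def)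
  note s = functor_betweenD[OF w] functor_betweenD[OF p] functor_simps[OF w] functor_simps[OF p]
  fix z f assume "z \<in> Obj (Src (pb_proj w p))" and f: "f \<in> Arr (Tgt (pb_proj w p))"
    and cod: "Cod (Tgt (pb_proj w p)) f = FO (pb_proj w p) z"
  then obtain c e where z: "z = pair c e" and ce: "c \<in> Obj C'" "e \<in> Obj E" "FO w c = FO p e"
    by (auto simp: s)
  then have f: "f \<in> Arr C'" "Cod C' f = c" using f cod by (simp_all add: s)
  have "\<exists>!g. g \<in> Arr E \<and> Cod E g = e \<and> FA p g = FA w f"
    by (rule discrete_fibration_lift[OF d p ce(2)]) (simp_all add: s f ce)
  then obtain g where g: "g \<in> Arr E" "Cod E g = e" "FA p g = FA w f"
    and uniq: "\<And>g'. g' \<in> Arr E \<Longrightarrow> Cod E g' = e \<Longrightarrow> FA p g' = FA w f \<Longrightarrow> g' = g"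
    by blast
  show "\<exists>!k. k \<in> Arr (Src (pb_proj w p)) \<and> Cod (Src (pb_proj w p)) k = z \<and> FA (pb_proj w p) k = f"
  proof (rule ex1I[of _ "pair f g"])
    show "pair f g \<in> Arr (Src (pb_proj w p)) \<and> Cod (Src (pb_proj w p)) (pair f g) = z \<and> FA (pb_proj w p) (pair f g) = f"
      using f g z by (simp add: s)
  next
    fix k assume k: "k \<in> Arr (Src (pb_proj w p)) \<and> Cod (Src (pb_proj w p)) k = z \<and> FA (pb_proj w p) k = f"
    then obtain f' g' where k': "k = pair f' g'" "f' \<in> Arr C'" "g' \<in> Arr E" "FA w f' = FA p g'"
      by (auto simp: s)
    then have "f' = f" "Cod E g' = e" using k z by (simp_all add: s)
    then show "k = pair f g" using k' uniq[of g'] by simp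
  qed
qed

lemma Obj_DFib_pb_proj:
  assumes w: "functor_between w C' C" "small_cat C'" and p: "p \<in> Obj (DFib C)"
  shows "pb_proj w p \<in> Obj (DFib C')"
proof -
  note p = Obj_DFibD[OF p]
  show ?thesis
    unfolding Obj_DFib pb_func_simps
    by (intro conjI pb_proj_functor[OF w(1) p(1)] small_cat_pb_cat[OF w(1) p(1) w(2) p(2)]
        discrete_fibration_pb_proj[OF w(1) p(1,4)] w(2))
qed

lemma Arr_DFib_pb_map:
  assumes w: "functor_between w C' C" "small_cat C'" and h: "(p, h, p') \<in> Arr (DFib C)"
  shows "(pb_proj w p, pb_map w p h p', pb_proj w p') \<in> Arr (DFib C')"
proof -
  note h = Arr_DFibD[OF h]
  note p' = Obj_DFibD[OF h(2)]
  show ?thesis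
    using Obj_DFib_pb_proj[OF w] pb_map_functor[OF p'(1) h(3,4) w(1)] pb_proj_map[OF p'(1) h(3,4) w(1)] h
    by (simp add: Arr_DFib)
qed

lemma DFib_act_simps [simp]:
  "Src (DFib_act w) = DFib (Tgt w)" "Tgt (DFib_act w) = DFib (Src w)"
  "p \<in> Obj (DFib (Tgt w)) \<Longrightarrow> FO (DFib_act w) p = pb_proj w p"
  "(p, h, p') \<in> Arr (DFib (Tgt w)) \<Longrightarrow> FA (DFib_act w) (p, h, p') = (pb_proj w p, pb_map w p h p', pb_proj w p')"
  by (simp_all add: DFib_act_def)

lemma DFib_act_functor:
  assumes w: "functor_between w C' C" "small_cat C'"
  shows "functor_between (DFib_act w) (DFib C) (DFib C')"
proof -
  have *: "DFib_act w = mk_func (DFib C) (DFib C') (pb_proj w)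
    (\<lambda>(p, h, p'). (pb_proj w p, pb_map w p h p', pb_proj w p'))"
    by (simp add: DFib_act_def mk_func_def functor_betweenD[OF w(1)])
  show ?thesis
    unfolding *
  proof (rule mk_func_functor[OF category_DFib category_DFib])
    fix p assume "p \<in> Obj (DFib C)"
    then show "(\<lambda>(p, h, p'). (pb_proj w p, pb_map w p h p', pb_proj w p')) (Ident (DFib C) p)
        = Ident (DFib C') (pb_proj w p)"
      by (simp add: Obj_DFib pb_map_id[OF _ w(1)])
  next
    fix f g assume fg: "f \<in> Arr (DFib C)" "g \<in> Arr (DFib C)" "Cod (DFib C) f = Dom (DFib C) g"
    obtain p h p' h' p'' where fg': "f = (p, h, p')" "g = (p', h', p'')"
      using fg(3) by (cases f; cases g) auto
    note h = Arr_DFibD[OF fg(1)[unfolded fg']] and h' = Arr_DFibD[OF fg(2)[unfolded fg']]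
    from fg' show "(\<lambda>(p, h, p'). (pb_proj w p, pb_map w p h p', pb_proj w p')) (Comp (DFib C) g f)
        = Comp (DFib C') ((\<lambda>(p, h, p'). (pb_proj w p, pb_map w p h p', pb_proj w p')) g)
           ((\<lambda>(p, h, p'). (pb_proj w p, pb_map w p h p', pb_proj w p')) f)"
      using pb_map_comp[OF Obj_DFibD(1)[OF h'(2)] h'(3,4) w(1) h(3,4)] by simp
  qed (use Obj_DFib_pb_proj[OF w] Arr_DFib_pb_map[OF w] in \<open>auto simp del: comp_func_simps\<close>)
qed

definition DFib_psf :: "(('u::universe) scat, 'u sfunc, 'u sfunc, 'u sfunc \<times> 'u sfunc \<times> 'u sfunc) psf" where
  "DFib_psf = \<lparr>fib = DFib, act = DFib_act, unitor = DFib_unitor, compositor = DFib_compositor\<rparr>"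

lemma DFib_psf_simps [simp]:
  "fib DFib_psf = DFib" "act DFib_psf = DFib_act" "unitor DFib_psf = DFib_unitor"
  "compositor DFib_psf = DFib_compositor"
  by (simp_all add: DFib_psf_def)

lemma DFib_unitor_NC [simp]:
  "p \<in> Obj (DFib C) \<Longrightarrow> NC (DFib_unitor C) p = (p, pb_unit p, pb_proj (id_func C) p)"
  by (simp add: DFib_unitor_def)

lemma DFib_compositor_NC [simp]:
  "p \<in> Obj (DFib (Tgt w)) \<Longrightarrow> NC (DFib_compositor w w') p =
    (pb_proj w' (pb_proj w p), pb_cmp w w' p, pb_proj (comp_func w w') p)"
  by (simp add: DFib_compositor_def)

lemma Arr_DFib_pb_unit:
  assumes "p \<in> Obj (DFib C)" shows "(p, pb_unit p, pb_proj (id_func C) p) \<in> Arr (DFib C)"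
proof -
  note p = Obj_DFibD[OF assms]
  note C = small_catD(1)[OF p(3)]
  show ?thesis
    using assms Obj_DFib_pb_proj[OF id_func_functor[OF C] p(3) assms]
      pb_unit_functor[OF p(1)] pb_proj_unit[OF p(1)] p
    by (simp add: Arr_DFib functor_betweenD(3))
qed

lemma Arr_DFib_pb_cmp:
  assumes w: "functor_between w C' C" "small_cat C'" and w': "functor_between w' C'' C'" "small_cat C''"
    and p: "p \<in> Obj (DFib C)"
  shows "(pb_proj w' (pb_proj w p), pb_cmp w w' p, pb_proj (comp_func w w') p) \<in> Arr (DFib C'')"
  using Obj_DFib_pb_proj[OF w' Obj_DFib_pb_proj[OF w p]] Obj_DFib_pb_proj[OF comp_func_functor[OF w'(1) w(1)] w'(2) p]
    pb_cmp_functor[OF Obj_DFibD(1)[OF p] w(1) w'(1)] pb_proj_cmp[OF Obj_DFibD(1)[OF p] w(1) w'(1)]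
  by (simp add: Arr_DFib)

lemma nat_iso_DFib_unitor:
  assumes C: "small_cat C" shows "nat_iso (DFib_unitor C) (id_func (DFib C)) (DFib_act (id_func C))"
proof (rule nat_isoI[OF id_func_functor[OF category_DFib] DFib_act_functor[OF id_func_functor C]])
  fix p assume p: "p \<in> Obj (DFib C)"
  show "iso (DFib C) (NC (DFib_unitor C) p)"
    using p iso_DFib[OF iso_pb_unit[OF Obj_DFibD(1)[OF p]] Arr_DFib_pb_unit[OF p]] Obj_DFibD[OF p]
    by (simp add: small_catD)
next
  fix f assume f: "f \<in> Arr (DFib C)"
  obtain p h p' where f': "f = (p, h, p')" by (cases f) auto
  note h = Arr_DFibD[OF f[unfolded f']]
  show "Comp (DFib C) (NC (DFib_unitor C) (Cod (DFib C) f)) (FA (id_func (DFib C)) f) =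
      Comp (DFib C) (FA (DFib_act (id_func C)) f) (NC (DFib_unitor C) (Dom (DFib C) f))"
    using pb_unit_natural[OF Obj_DFibD(1)[OF h(2)] h(3,4)] f h
    by (simp add: f')
qed (use C in \<open>auto simp: small_catD DFib_unitor_def\<close>)

lemma nat_iso_DFib_compositor:
  assumes w: "functor_between w C' C" "small_cat C'" and w': "functor_between w' C'' C'" "small_cat C''"
  shows "nat_iso (DFib_compositor w w') (comp_func (DFib_act w') (DFib_act w)) (DFib_act (comp_func w w'))"
proof (rule nat_isoI[OF comp_func_functor[OF DFib_act_functor[OF w] DFib_act_functor[OF w']]
      DFib_act_functor[OF comp_func_functor[OF w'(1) w(1)] w'(2)]])
  note s = functor_betweenD[OF w(1)] functor_betweenD[OF w'(1)]
  fix p assume p: "p \<in> Obj (DFib C)"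
  show "iso (DFib C'') (NC (DFib_compositor w w') p)"
    using p iso_DFib[OF iso_pb_cmp[OF Obj_DFibD(1)[OF p] w(1) w'(1)] Arr_DFib_pb_cmp[OF w w' p]] w w' Obj_DFibD[OF p]
    by (simp add: s)
  show "Dom (DFib C'') (NC (DFib_compositor w w') p) = FO (comp_func (DFib_act w') (DFib_act w)) p"
    and "Cod (DFib C'') (NC (DFib_compositor w w') p) = FO (DFib_act (comp_func w w')) p"
    using p Obj_DFib_pb_proj[OF w p] by (simp_all add: s)
next
  note s = functor_betweenD[OF w(1)] functor_betweenD[OF w'(1)]
  fix f assume f: "f \<in> Arr (DFib C)"
  obtain p h p' where f': "f = (p, h, p')" by (cases f) auto
  note p = Arr_DFibD[OF f[unfolded f']]
  show "Comp (DFib C'') (NC (DFib_compositor w w') (Cod (DFib C) f)) (FA (comp_func (DFib_act w') (DFib_act w)) f) =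
      Comp (DFib C'') (FA (DFib_act (comp_func w w')) f) (NC (DFib_compositor w w') (Dom (DFib C) f))"
    using pb_cmp_natural[OF Obj_DFibD(1)[OF p(2)] p(3,4) w(1) w'(1)] Arr_DFib_pb_map[OF w] f p by (simp add: f' s)
qed (auto simp: DFib_compositor_def functor_betweenD[OF w(1)])

text \<open>On the middle components of the slice arrows the three coherence laws are
  \<open>pb_cmp_proj_unit\<close>, \<open>pb_cmp_map_unit\<close> and
  \<open>pb_cmp_assoc\<close>.\<close>

lemma pseudofunctor_DFib_psf: "pseudofunctor (Cat :: (('u::universe) scat, 'u sfunc) cat) DFib_psf"
proof (rule pseudofunctorI)
  fix w :: "'u sfunc" assume w: "w \<in> Arr Cat"
  then have w': "functor_between w (Src w) (Tgt w)" "small_cat (Src w)" "small_cat (Tgt w)"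
    using Arr_CatD[of w] by auto
  then show "functor_between (act DFib_psf w) (fib DFib_psf (Cod Cat w)) (fib DFib_psf (Dom Cat w))"
    using DFib_act_functor by auto
  fix p assume "p \<in> Obj (fib DFib_psf (Cod Cat w))"
  then have p: "p \<in> Obj (DFib (Tgt w))" by simp
  note p' = Obj_DFibD(1)[OF p]
  note P = Obj_DFib_pb_proj[OF w'(1,2) p]
  show "Comp (fib DFib_psf (Dom Cat w)) (NC (compositor DFib_psf w (Ident Cat (Dom Cat w))) p)
      (NC (unitor DFib_psf (Dom Cat w)) (FO (act DFib_psf w) p)) =
      Ident (fib DFib_psf (Dom Cat w)) (FO (act DFib_psf w) p)"
    using p P pb_cmp_proj_unit[OF p' w'(1)] comp_func_id_right[OF w'(1)] by simp
  show "Comp (fib DFib_psf (Dom Cat w)) (NC (compositor DFib_psf (Ident Cat (Cod Cat w)) w) p)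
      (FA (act DFib_psf w) (NC (unitor DFib_psf (Cod Cat w)) p)) =
      Ident (fib DFib_psf (Dom Cat w)) (FO (act DFib_psf w) p)"
    using p P pb_cmp_map_unit[OF p' w'(1)] comp_func_id_left[OF w'(1)] Arr_DFib_pb_unit[OF p] by simp
  fix w1 w2 :: "'u sfunc" assume w12: "w1 \<in> Arr Cat" "w2 \<in> Arr Cat" "Cod Cat w1 = Dom Cat w" "Cod Cat w2 = Dom Cat w1"
  then have w1: "functor_between w1 (Src w1) (Src w)" "small_cat (Src w1)"
    and w2: "functor_between w2 (Src w2) (Src w1)" "small_cat (Src w2)"
    using Arr_CatD[of w1] Arr_CatD[of w2] by auto
  show "Comp (fib DFib_psf (Dom Cat w2)) (NC (compositor DFib_psf (Comp Cat w w1) w2) p)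
       (FA (act DFib_psf w2) (NC (compositor DFib_psf w w1) p)) =
      Comp (fib DFib_psf (Dom Cat w2)) (NC (compositor DFib_psf w (Comp Cat w1 w2)) p)
       (NC (compositor DFib_psf w1 w2) (FO (act DFib_psf w) p))"
    using p P w12 pb_cmp_assoc[OF p' w'(1) w1(1) w2(1)] Arr_DFib_pb_cmp[OF w'(1,2) w1 p]
      comp_func_assoc[OF w2(1) w1(1) w'(1)] by simp
next
  fix w w1 :: "'u sfunc" assume "w \<in> Arr Cat" "w1 \<in> Arr Cat" "Cod Cat w1 = Dom Cat w"
  then show "nat_iso (compositor DFib_psf w w1) (comp_func (act DFib_psf w1) (act DFib_psf w)) (act DFib_psf (Comp Cat w w1))"
    using nat_iso_DFib_compositor[of w "Src w" "Tgt w" w1 "Src w1"] Arr_CatD[of w] Arr_CatD[of w1] by auto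
qed (auto simp: category_Cat category_DFib nat_iso_DFib_unitor)

subsection \<open>The category of elements\<close>

text \<open>An arrow stores only the element over its codomain, since the element over the domain
  has to be its restriction along \<open>f\<close>. With this encoding the unique lift of
  \<open>f\<close> at \<open>pair c x\<close> is literally \<open>pair f x\<close>.\<close>

definition el_cat :: "('u::universe) scat \<Rightarrow> 'u copsh \<Rightarrow> 'u scat" where
  "el_cat C X = \<lparr>Obj = {pair c x | c x. c \<in> Obj C \<and> x \<in> FO X c},
     Arr = {pair f x | f x. f \<in> Arr C \<and> x \<in> FO X (Cod C f)},
     Dom = (\<lambda>k. pair (Dom C (p1 k)) (ap (FA X (p1 k)) (p2 k))),
     Cod = (\<lambda>k. pair (Cod C (p1 k)) (p2 k)),
     Ident = (\<lambda>z. pair (Ident C (p1 z)) (p2 z)),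
     Comp = (\<lambda>k h. pair (Comp C (p1 k) (p1 h)) (p2 k))\<rparr>"

lemma el_cat_simps [simp]:
  "Obj (el_cat C X) = {pair c x | c x. c \<in> Obj C \<and> x \<in> FO X c}"
  "Arr (el_cat C X) = {pair f x | f x. f \<in> Arr C \<and> x \<in> FO X (Cod C f)}"
  "Dom (el_cat C X) k = pair (Dom C (p1 k)) (ap (FA X (p1 k)) (p2 k))"
  "Cod (el_cat C X) k = pair (Cod C (p1 k)) (p2 k)"
  "Ident (el_cat C X) z = pair (Ident C (p1 z)) (p2 z)"
  "Comp (el_cat C X) k h = pair (Comp C (p1 k) (p1 h)) (p2 k)"
  by (simp_all add: el_cat_def)

definition el_proj :: "('u::universe) scat \<Rightarrow> 'u copsh \<Rightarrow> 'u sfunc" where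
  "el_proj C X = mk_func (el_cat C X) C p1 p1"

definition el_map :: "('u::universe) scat \<Rightarrow> 'u copsh_nt \<Rightarrow> 'u sfunc" where
  "el_map C \<alpha> = mk_func (el_cat C (NSrc \<alpha>)) (el_cat C (NTgt \<alpha>))
     (\<lambda>z. pair (p1 z) (ap (NC \<alpha> (p1 z)) (p2 z))) (\<lambda>k. pair (p1 k) (ap (NC \<alpha> (Cod C (p1 k))) (p2 k)))"

text \<open>Elements of the restricted presheaf are the same as points of the pulled back category
  of elements, except that \<open>pb_cat\<close> also carries the image of \<open>c\<close> under
  \<open>w\<close>. This functor inserts that coordinate; it is the reason why \<open>El\<close> is
  natural only up to isomorphism.\<close>

definition el_pb :: "('u::universe) sfunc \<Rightarrow> 'u copsh \<Rightarrow> 'u sfunc" where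
  "el_pb w X = mk_func (el_cat (Src w) (comp_func X (op_func w))) (pb_cat w (el_proj (Tgt w) X))
     (\<lambda>z. pair (p1 z) (pair (FO w (p1 z)) (p2 z))) (\<lambda>k. pair (p1 k) (pair (FA w (p1 k)) (p2 k)))"

lemma el_func_simps [simp]:
  "Src (el_proj C X) = el_cat C X" "Tgt (el_proj C X) = C"
  "Src (el_map C \<alpha>) = el_cat C (NSrc \<alpha>)" "Tgt (el_map C \<alpha>) = el_cat C (NTgt \<alpha>)"
  "Src (el_pb w X) = el_cat (Src w) (comp_func X (op_func w))" "Tgt (el_pb w X) = pb_cat w (el_proj (Tgt w) X)"
  "c \<in> Obj C \<Longrightarrow> x \<in> FO X c \<Longrightarrow> FO (el_proj C X) (pair c x) = c"
  "f \<in> Arr C \<Longrightarrow> x \<in> FO X (Cod C f) \<Longrightarrow> FA (el_proj C X) (pair f x) = f"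
  "c \<in> Obj C \<Longrightarrow> x \<in> FO (NSrc \<alpha>) c \<Longrightarrow> FO (el_map C \<alpha>) (pair c x) = pair c (ap (NC \<alpha> c) x)"
  "f \<in> Arr C \<Longrightarrow> x \<in> FO (NSrc \<alpha>) (Cod C f) \<Longrightarrow> FA (el_map C \<alpha>) (pair f x) = pair f (ap (NC \<alpha> (Cod C f)) x)"
  "c \<in> Obj (Src w) \<Longrightarrow> x \<in> FO (comp_func X (op_func w)) c \<Longrightarrow> FO (el_pb w X) (pair c x) = pair c (pair (FO w c) x)"
  "f \<in> Arr (Src w) \<Longrightarrow> x \<in> FO (comp_func X (op_func w)) (Cod (Src w) f) \<Longrightarrow>
    FA (el_pb w X) (pair f x) = pair f (pair (FA w f) x)"
  by (simp_all add: el_proj_def el_map_def el_pb_def)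

context
  fixes C :: "('u::universe) scat" and X :: "'u copsh"
  assumes C: "category C" and X: "functor_between X (op_cat C) Set"
begin

lemma psh_simps:
  "f \<in> Arr C \<Longrightarrow> x \<in> FO X (Cod C f) \<Longrightarrow> ap (FA X f) x \<in> FO X (Dom C f)"
  "c \<in> Obj C \<Longrightarrow> x \<in> FO X c \<Longrightarrow> ap (FA X (Ident C c)) x = x"
  "f \<in> Arr C \<Longrightarrow> g \<in> Arr C \<Longrightarrow> Cod C f = Dom C g \<Longrightarrow> x \<in> FO X (Cod C g) \<Longrightarrow>
      ap (FA X (Comp C g f)) x = ap (FA X f) (ap (FA X g) x)"
  using copsh_in[OF X, of f x] copsh_Ident[OF X, of c x] copsh_Comp[OF X, of g f x] by simp_all

lemma category_el_cat: "category (el_cat C X)"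
  by (rule categoryI) (auto simp: C psh_simps Comp_assoc)

lemma el_proj_functor: "functor_between (el_proj C X) (el_cat C X) C"
  unfolding el_proj_def by (rule mk_func_functor[OF category_el_cat C]) (auto simp: C)

lemma small_el_cat:
  assumes sC: "small_cat C" shows "small_cat (el_cat C X)"
  using small_pairs[OF small_catD(2)[OF sC], of "FO X"] small_pairs[OF small_catD(3)[OF sC], of "\<lambda>f. FO X (Cod C f)"]
    copsh_small[OF X] C category_el_cat by (simp add: small_cat_def)

lemma discrete_fibration_el_proj: "discrete_fibration (el_proj C X)"
  unfolding discrete_fibration_def
proof (intro conjI ballI impI)
  show "is_functor (el_proj C X)" using functor_betweenD(1)[OF el_proj_functor] .
  fix e f assume "e \<in> Obj (Src (el_proj C X))" and f: "f \<in> Arr (Tgt (el_proj C X))"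
    "Cod (Tgt (el_proj C X)) f = FO (el_proj C X) e"
  then obtain c x where e: "e = pair c x" "c \<in> Obj C" "x \<in> FO X c" by auto
  have f: "f \<in> Arr C" "Cod C f = c" using f e by simp_all
  show "\<exists>!g. g \<in> Arr (Src (el_proj C X)) \<and> Cod (Src (el_proj C X)) g = e \<and> FA (el_proj C X) g = f"
    by (rule ex1I[of _ "pair f x"]) (use e f in \<open>auto simp: e\<close>)
qed

lemma el_proj_in_DFib: "small_cat C \<Longrightarrow> el_proj C X \<in> Obj (DFib C)"
  using el_proj_functor small_el_cat discrete_fibration_el_proj by (simp add: Obj_DFib)

lemma el_map_Ident: "el_map C (Ident (func_cat (op_cat C) Set) X) = id_func (el_cat C X)"
  by (auto simp: el_map_def id_func_eq_mk mk_func_def intro!: restrict_ext) (simp add: C)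

end

context
  fixes C :: "('u::universe) scat" and \<alpha> :: "'u copsh_nt"
  assumes C: "category C" and \<alpha>: "is_nt \<alpha>" "functor_between (NSrc \<alpha>) (op_cat C) Set"
begin

lemma psh_nt_simps:
  "c \<in> Obj C \<Longrightarrow> x \<in> FO (NSrc \<alpha>) c \<Longrightarrow> ap (NC \<alpha> c) x \<in> FO (NTgt \<alpha>) c"
  "f \<in> Arr C \<Longrightarrow> x \<in> FO (NSrc \<alpha>) (Cod C f) \<Longrightarrow>
     ap (NC \<alpha> (Dom C f)) (ap (FA (NSrc \<alpha>) f) x) = ap (FA (NTgt \<alpha>) f) (ap (NC \<alpha> (Cod C f)) x)"
  using NC_in[OF \<alpha>, of c x] NC_natural_Set[OF \<alpha>, of f x] by simp_all

lemma el_map_functor: "functor_between (el_map C \<alpha>) (el_cat C (NSrc \<alpha>)) (el_cat C (NTgt \<alpha>))"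
  unfolding el_map_def
  by (rule mk_func_functor[OF category_el_cat[OF C \<alpha>(2)] category_el_cat[OF C nt_NTgt[OF \<alpha>]]])
    (auto simp: C psh_simps[OF C \<alpha>(2)] psh_nt_simps)

lemma el_proj_map: "comp_func (el_proj C (NTgt \<alpha>)) (el_map C \<alpha>) = el_proj C (NSrc \<alpha>)"
  by (rule func_eqI[OF comp_func_functor[OF el_map_functor el_proj_functor[OF C nt_NTgt[OF \<alpha>]]]
      el_proj_functor[OF C \<alpha>(2)]]) (auto simp: C psh_nt_simps)

lemma el_map_in_DFib:
  "small_cat C \<Longrightarrow> (el_proj C (NSrc \<alpha>), el_map C \<alpha>, el_proj C (NTgt \<alpha>)) \<in> Arr (DFib C)"
  using el_proj_in_DFib[OF C \<alpha>(2)] el_proj_in_DFib[OF C nt_NTgt[OF \<alpha>]] el_map_functor el_proj_map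
  by (simp add: Arr_DFib)

lemma el_map_Comp:
  assumes \<beta>: "is_nt \<beta>" "NSrc \<beta> = NTgt \<alpha>"
  shows "el_map C (Comp (func_cat (op_cat C) Set) \<beta> \<alpha>) = comp_func (el_map C \<beta>) (el_map C \<alpha>)"
proof -
  have \<beta>': "functor_between (NSrc \<beta>) (op_cat C) Set" using nt_NTgt[OF \<alpha>] \<beta> by simp
  define \<gamma> where "\<gamma> = Comp (func_cat (op_cat C) Set) \<beta> \<alpha>"
  have c: "NSrc \<gamma> = NSrc \<alpha>" "NTgt \<gamma> = NTgt \<beta>"
    "\<And>c x. c \<in> Obj C \<Longrightarrow> x \<in> FO (NSrc \<alpha>) c \<Longrightarrow> ap (NC \<gamma> c) x = ap (NC \<beta> c) (ap (NC \<alpha> c) x)"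
    using copsh_Comp_ap[OF \<alpha> \<beta>] unfolding \<gamma>_def by simp_all
  show ?thesis
    unfolding \<gamma>_def[symmetric] comp_func_eq_mk mk_func_def el_map_def[of C \<gamma>]
    by (auto simp: C psh_nt_simps c \<beta>(2) intro!: restrict_ext)
qed

end

definition El :: "('u::universe) scat \<Rightarrow> ('u copsh, 'u copsh_nt, 'u sfunc, 'u sfunc \<times> 'u sfunc \<times> 'u sfunc) func" where
  "El C = mk_func (func_cat (op_cat C) Set) (DFib C) (el_proj C)
     (\<lambda>\<alpha>. (el_proj C (NSrc \<alpha>), el_map C \<alpha>, el_proj C (NTgt \<alpha>)))"

lemma El_simps [simp]:
  "Src (El C) = func_cat (op_cat C) Set" "Tgt (El C) = DFib C"
  "functor_between X (op_cat C) Set \<Longrightarrow> FO (El C) X = el_proj C X"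
  "is_nt \<alpha> \<Longrightarrow> functor_between (NSrc \<alpha>) (op_cat C) Set \<Longrightarrow>
    FA (El C) \<alpha> = (el_proj C (NSrc \<alpha>), el_map C \<alpha>, el_proj C (NTgt \<alpha>))"
  by (simp_all add: El_def)

lemma El_functor:
  assumes sC: "small_cat C"
  shows "functor_between (El C) (func_cat (op_cat C) Set) (DFib C)"
  unfolding El_def
proof (rule mk_func_functor[OF category_func_cat category_DFib])
  note C = small_catD(1)[OF sC]
  fix \<alpha> \<beta> :: "'a copsh_nt" assume "\<alpha> \<in> Arr (func_cat (op_cat C) Set)" "\<beta> \<in> Arr (func_cat (op_cat C) Set)"
    "Cod (func_cat (op_cat C) Set) \<alpha> = Dom (func_cat (op_cat C) Set) \<beta>"
  then show "(el_proj C (NSrc (Comp (func_cat (op_cat C) Set) \<beta> \<alpha>)), el_map C (Comp (func_cat (op_cat C) Set) \<beta> \<alpha>),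
      el_proj C (NTgt (Comp (func_cat (op_cat C) Set) \<beta> \<alpha>)))
    = Comp (DFib C) (el_proj C (NSrc \<beta>), el_map C \<beta>, el_proj C (NTgt \<beta>)) (el_proj C (NSrc \<alpha>), el_map C \<alpha>, el_proj C (NTgt \<alpha>))"
    using el_map_Comp[OF C, of \<alpha> \<beta>] by simp
next
  note C = small_catD(1)[OF sC]
  fix X :: "'a copsh" assume "X \<in> Obj (func_cat (op_cat C) Set)"
  then show "(el_proj C (NSrc (Ident (func_cat (op_cat C) Set) X)), el_map C (Ident (func_cat (op_cat C) Set) X),
      el_proj C (NTgt (Ident (func_cat (op_cat C) Set) X))) = Ident (DFib C) (el_proj C X)"
    using el_map_Ident[OF C, of X] by simp
qed (use sC small_catD(1)[OF sC] in \<open>simp_all add: category_Set el_proj_in_DFib el_map_in_DFib\<close>)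

text \<open>A map between categories of elements over \<open>C\<close> is determined by its effect on objects, because the
  image of the lift of \<open>f\<close> at \<open>x\<close> is the lift of \<open>f\<close> at the image of \<open>x\<close>.\<close>

lemma el_cat_map_shape:
  fixes X Y :: "('u::universe) copsh"
  assumes C: "category C" and X: "functor_between X (op_cat C) Set" and Y: "functor_between Y (op_cat C) Set"
    and h: "functor_between h (el_cat C X) (el_cat C Y)" "comp_func (el_proj C Y) h = el_proj C X"
  shows "c \<in> Obj C \<Longrightarrow> x \<in> FO X c \<Longrightarrow> p2 (FO h (pair c x)) \<in> FO Y c"
    and "c \<in> Obj C \<Longrightarrow> x \<in> FO X c \<Longrightarrow> FO h (pair c x) = pair c (p2 (FO h (pair c x)))"
    and "f \<in> Arr C \<Longrightarrow> x \<in> FO X (Cod C f) \<Longrightarrow> FA h (pair f x) = pair f (p2 (FO h (pair (Cod C f) x)))"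
    and "f \<in> Arr C \<Longrightarrow> x \<in> FO X (Cod C f) \<Longrightarrow>
      p2 (FO h (pair (Dom C f) (ap (FA X f) x))) = ap (FA Y f) (p2 (FO h (pair (Cod C f) x)))"
proof -
  have O: "\<exists>y\<in>FO Y c. FO h (pair c x) = pair c y" if cx: "c \<in> Obj C" "x \<in> FO X c" for c x
  proof -
    have "pair c x \<in> Obj (el_cat C X)" using cx by simp
    from FO_in_Obj[OF h(1) this] obtain c' y where y: "FO h (pair c x) = pair c' y" "c' \<in> Obj C" "y \<in> FO Y c'"
      by auto
    have "FO (comp_func (el_proj C Y) h) (pair c x) = c" using h(2) cx by simp
    then show ?thesis using y cx functor_betweenD(2)[OF h(1)] by simp
  qed
  have A: "FA h (pair f x) = pair f (p2 (FO h (pair (Cod C f) x))) \<and>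
      FO h (pair (Dom C f) (ap (FA X f) x)) = pair (Dom C f) (ap (FA Y f) (p2 (FO h (pair (Cod C f) x))))"
    if fx: "f \<in> Arr C" "x \<in> FO X (Cod C f)" for f x
  proof -
    have k: "pair f x \<in> Arr (el_cat C X)" using fx by simp
    from FA_in_Arr[OF h(1) this] obtain f' y where y: "FA h (pair f x) = pair f' y" "f' \<in> Arr C" "y \<in> FO Y (Cod C f')"
      by auto
    have "FA (comp_func (el_proj C Y) h) (pair f x) = f" using h(2) fx by simp
    then have "f' = f" using y fx functor_betweenD(2)[OF h(1)] by simp
    moreover have "FO h (pair (Cod C f) x) = pair (Cod C f') y" using Cod_FA[OF h(1) k] y by simp
    moreover have "FO h (pair (Dom C f) (ap (FA X f) x)) = pair (Dom C f') (ap (FA Y f') y)"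
      using Dom_FA[OF h(1) k] y by simp
    ultimately show ?thesis using y by simp
  qed
  show "c \<in> Obj C \<Longrightarrow> x \<in> FO X c \<Longrightarrow> p2 (FO h (pair c x)) \<in> FO Y c"
    and "c \<in> Obj C \<Longrightarrow> x \<in> FO X c \<Longrightarrow> FO h (pair c x) = pair c (p2 (FO h (pair c x)))"
    using O[of c x] by auto
  show "f \<in> Arr C \<Longrightarrow> x \<in> FO X (Cod C f) \<Longrightarrow> FA h (pair f x) = pair f (p2 (FO h (pair (Cod C f) x)))"
    and "f \<in> Arr C \<Longrightarrow> x \<in> FO X (Cod C f) \<Longrightarrow>
      p2 (FO h (pair (Dom C f) (ap (FA X f) x))) = ap (FA Y f) (p2 (FO h (pair (Cod C f) x)))"
    using A[of f x] by auto
qed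

section \<open>The presheaf of fibres of a discrete fibration\<close>

context
  fixes p :: "('u::universe) sfunc" and E C
  assumes p: "functor_between p E C" and d: "discrete_fibration p"
begin

definition lift :: "'u \<Rightarrow> 'u \<Rightarrow> 'u" where
  "lift f e = (THE g. g \<in> Arr E \<and> Cod E g = e \<and> FA p g = f)"

lemma lift:
  assumes "e \<in> Obj E" "f \<in> Arr C" "Cod C f = FO p e"
  shows "lift f e \<in> Arr E" "Cod E (lift f e) = e" "FA p (lift f e) = f" "FO p (Dom E (lift f e)) = Dom C f"
proof -
  show *: "lift f e \<in> Arr E" "Cod E (lift f e) = e" "FA p (lift f e) = f"
    using theI'[OF discrete_fibration_lift[OF d p assms]] by (simp_all add: lift_def)
  show "FO p (Dom E (lift f e)) = Dom C f"
    using Dom_FA[OF p *(1)] * by simp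
qed

text \<open>The form in which uniqueness of lifts is used: an arrow is recovered from its image and
  its codomain. To compute the lift of an identity or a composite it suffices to exhibit an arrow
  with the right image and codomain.\<close>

lemma lift_eq: "g \<in> Arr E \<Longrightarrow> lift (FA p g) (Cod E g) = g"
  unfolding lift_def
  by (rule the1_equality[OF discrete_fibration_lift[OF d p]])
    (simp_all add: functor_betweenD[OF p] functor_simps[OF p])

lemma lift_Ident: "e \<in> Obj E \<Longrightarrow> lift (Ident C (FO p e)) e = Ident E e"
  using lift_eq[of "Ident E e"] by (simp add: functor_betweenD[OF p] functor_simps[OF p])

lemma lift_Comp:
  assumes "e \<in> Obj E" "f \<in> Arr C" "Cod C f = FO p e" "g \<in> Arr C" "Cod C g = Dom C f"
  shows "lift (Comp C f g) e = Comp E (lift f e) (lift g (Dom E (lift f e)))"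
  using lift_eq[of "Comp E (lift f e) (lift g (Dom E (lift f e)))"] lift[of e f] lift[of "Dom E (lift f e)" g] assms
  by (simp add: functor_betweenD[OF p] functor_simps[OF p])

definition fib_psh :: "'u copsh" where
  "fib_psh = mk_copsh (op_cat C) (\<lambda>c. {e \<in> Obj E. FO p e = c}) (\<lambda>f e. Dom E (lift f e))"

lemma fib_psh_functor:
  assumes "small_cat E" shows "functor_between fib_psh (op_cat C) Set"
  unfolding fib_psh_def
proof (rule mk_copsh_functor)
  note s = functor_betweenD[OF p] functor_simps[OF p] lift
  show "category (op_cat C)" by (simp add: s)
  show "small {e \<in> Obj E. FO p e = c}" for c
    using small_catD(2)[OF assms] by (rule small_subset) auto
  show "Dom E (lift f e) \<in> {e \<in> Obj E. FO p e = Cod (op_cat C) f}"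
    if "f \<in> Arr (op_cat C)" "e \<in> {e \<in> Obj E. FO p e = Dom (op_cat C) f}" for f e
    using that by (simp add: s)
  show "Dom E (lift (Ident (op_cat C) c) e) = e" if "e \<in> {e \<in> Obj E. FO p e = c}" for c e
    using that lift_Ident[of e] by (auto simp: s)
  show "Dom E (lift (Comp (op_cat C) g f) e) = Dom E (lift g (Dom E (lift f e)))"
    if "f \<in> Arr (op_cat C)" "g \<in> Arr (op_cat C)" "Cod (op_cat C) f = Dom (op_cat C) g"
      "e \<in> {e \<in> Obj E. FO p e = Dom (op_cat C) f}" for f g e
    using that by (simp add: s lift_Comp)
qed

lemma fib_psh_simps:
  "c \<in> Obj C \<Longrightarrow> FO fib_psh c = {e \<in> Obj E. FO p e = c}"
  "f \<in> Arr C \<Longrightarrow> e \<in> Obj E \<Longrightarrow> FO p e = Cod C f \<Longrightarrow> ap (FA fib_psh f) e = Dom E (lift f e)"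
  by (simp_all add: fib_psh_def)

text \<open>The isomorphism drops the base object from \<open>pair c e\<close> and turns
  \<open>pair f e\<close> into the lift of \<open>f\<close> at \<open>e\<close>. Its inverse pairs
  an object with its image, and an arrow with its image and codomain; on arrows this works by
  \<open>lift_eq\<close>.\<close>

lemma El_surj:
  assumes E: "small_cat E" and C: "small_cat C"
  shows "\<exists>h. iso (DFib C) (el_proj C fib_psh, h, p)"
proof -
  note X = fib_psh_functor[OF E]
  note s = functor_betweenD[OF p] functor_simps[OF p] lift fib_psh_simps
  define h where "h = mk_func (el_cat C fib_psh) E p2 (\<lambda>k. lift (p1 k) (p2 k))"
  have h: "functor_between h (el_cat C fib_psh) E"
    unfolding h_def
  proof (rule mk_func_functor[OF category_el_cat[OF small_catD(1)[OF C] X] small_catD(1)[OF E]])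
    fix z assume "z \<in> Obj (el_cat C fib_psh)"
    then show "lift (p1 (Ident (el_cat C fib_psh) z)) (p2 (Ident (el_cat C fib_psh) z)) = Ident E (p2 z)"
      using lift_Ident by (auto simp: s)
  next
    fix f g assume "f \<in> Arr (el_cat C fib_psh)" "g \<in> Arr (el_cat C fib_psh)" "Cod (el_cat C fib_psh) f = Dom (el_cat C fib_psh) g"
    then show "lift (p1 (Comp (el_cat C fib_psh) g f)) (p2 (Comp (el_cat C fib_psh) g f)) =
        Comp E (lift (p1 g) (p2 g)) (lift (p1 f) (p2 f))"
      by (auto simp: s lift_Comp)
  qed (auto simp: s)
  have ph: "comp_func p h = el_proj C fib_psh"
    by (rule func_eqI[OF comp_func_functor[OF h p] el_proj_functor[OF small_catD(1)[OF C] X]])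
      (auto simp: h_def s)
  have "iso Cat h"
  proof (rule iso_CatI[OF h small_el_cat[OF small_catD(1)[OF C] X C] E])
    show "bij_betw (FO h) (Obj (el_cat C fib_psh)) (Obj E)"
      by (rule bij_betw_byWitness[where f' = "\<lambda>e. pair (FO p e) e"]) (auto simp: h_def s)
    show "bij_betw (FA h) (Arr (el_cat C fib_psh)) (Arr E)"
      by (rule bij_betw_byWitness[where f' = "\<lambda>g. pair (FA p g) (Cod E g)"]) (auto simp: h_def s lift_eq)
  qed
  then have "iso (DFib C) (el_proj C fib_psh, h, p)"
    using h ph p d E C el_proj_in_DFib[OF small_catD(1)[OF C] X C]
    by (intro iso_DFib) (simp_all add: Arr_DFib Obj_DFib s)
  then show ?thesis ..
qed

end

lemma equivalence_El:
  assumes sC: "small_cat C" shows "equivalence (El C)"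
proof (rule equivalenceI[OF El_functor[OF sC]])
  note C = small_catD(1)[OF sC]
  fix \<alpha> \<beta> :: "'a copsh_nt"
  assume *: "\<alpha> \<in> Arr (func_cat (op_cat C) Set)" "\<beta> \<in> Arr (func_cat (op_cat C) Set)"
    "Dom (func_cat (op_cat C) Set) \<alpha> = Dom (func_cat (op_cat C) Set) \<beta>"
    "Cod (func_cat (op_cat C) Set) \<alpha> = Cod (func_cat (op_cat C) Set) \<beta>"
    "FA (El C) \<alpha> = FA (El C) \<beta>"
  then have eq: "el_map C \<alpha> = el_map C \<beta>" by simp
  show "\<alpha> = \<beta>"
  proof (rule copsh_nt_eqI[of _ "op_cat C"])
    fix c x assume "c \<in> Obj (op_cat C)" "x \<in> FO (NSrc \<alpha>) c"
    then have "FO (el_map C \<alpha>) (pair c x) = pair c (ap (NC \<alpha> c) x)"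
      and "FO (el_map C \<beta>) (pair c x) = pair c (ap (NC \<beta> c) x)" using *(3) by simp_all
    then show "ap (NC \<alpha> c) x = ap (NC \<beta> c) x" using eq pair_inject by metis
  qed (use * in simp_all)
next
  note C = small_catD(1)[OF sC]
  fix X Y :: "'a copsh" and k
  assume "X \<in> Obj (func_cat (op_cat C) Set)" "Y \<in> Obj (func_cat (op_cat C) Set)"
    and k: "k \<in> Arr (DFib C)" "Dom (DFib C) k = FO (El C) X" "Cod (DFib C) k = FO (El C) Y"
  then have X: "functor_between X (op_cat C) Set" and Y: "functor_between Y (op_cat C) Set" by simp_all
  obtain h where k': "k = (el_proj C X, h, el_proj C Y)" using k X Y by (cases k) simp
  have h: "functor_between h (el_cat C X) (el_cat C Y)" "comp_func (el_proj C Y) h = el_proj C X"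
    using Arr_DFibD(3,4)[OF k(1)[unfolded k']] by simp_all
  note shape = el_cat_map_shape[OF C X Y h]
  \<comment> \<open>The transformation is read off from \<open>h\<close> on objects alone; the third
    and fourth parts of \<open>shape\<close> then give the action on arrows and naturality.\<close>
  define \<alpha> where "\<alpha> = mk_copsh_nt X Y (\<lambda>c x. p2 (FO h (pair c x)))"
  have \<alpha>: "is_nt \<alpha>"
    unfolding \<alpha>_def by (rule is_nt_mk_copsh_nt[OF X Y]) (use shape in simp_all)
  moreover have \<alpha>': "NSrc \<alpha> = X" "NTgt \<alpha> = Y" by (simp_all add: \<alpha>_def)
  moreover have "el_map C \<alpha> = h"
  proof (rule func_eqI[OF _ h(1)])
    show "functor_between (el_map C \<alpha>) (el_cat C X) (el_cat C Y)"
      using el_map_functor[OF C \<alpha>] X \<alpha>' by simp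
    show "FO (el_map C \<alpha>) z = FO h z" if "z \<in> Obj (el_cat C X)" for z
      using that shape(2) functor_betweenD(2)[OF X] \<alpha>' by (auto simp: \<alpha>_def)
    show "FA (el_map C \<alpha>) z = FA h z" if "z \<in> Arr (el_cat C X)" for z
      using that shape(3) functor_betweenD(2)[OF X] \<alpha>' C by (auto simp: \<alpha>_def)
  qed
  ultimately show "\<exists>\<alpha>. \<alpha> \<in> Arr (func_cat (op_cat C) Set) \<and> Dom (func_cat (op_cat C) Set) \<alpha> = X \<and>
      Cod (func_cat (op_cat C) Set) \<alpha> = Y \<and> FA (El C) \<alpha> = k"
    using X k' by (intro exI[of _ \<alpha>]) simp
next
  fix p assume p: "p \<in> Obj (DFib C)"
  note pD = Obj_DFibD[OF p]
  obtain h where "iso (DFib C) (el_proj C (fib_psh p (Src p) C), h, p)"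
    using El_surj[OF pD(1,4,2,3)] by blast
  then show "\<exists>X k. X \<in> Obj (func_cat (op_cat C) Set) \<and> iso (DFib C) k \<and> Dom (DFib C) k = FO (El C) X \<and> Cod (DFib C) k = p"
    using fib_psh_functor[OF pD(1,4,2)]
    by (intro exI[of _ "fib_psh p (Src p) C"] exI[of _ "(el_proj C (fib_psh p (Src p) C), h, p)"]) simp
qed

section \<open>Pseudonaturality of the category of elements in its base\<close>

definition El_cell :: "('u::universe) sfunc \<Rightarrow>
    ('u copsh, 'u copsh_nt, 'u sfunc, 'u sfunc \<times> 'u sfunc \<times> 'u sfunc) nt" where
  "El_cell w = \<lparr>NSrc = comp_func (El (Src w)) (precomp (op_func w)), NTgt = comp_func (DFib_act w) (El (Tgt w)),
     NC = restrict (\<lambda>X. (el_proj (Src w) (comp_func X (op_func w)), el_pb w X, pb_proj w (el_proj (Tgt w) X)))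
       (Obj (func_cat (op_cat (Tgt w)) Set))\<rparr>"

context
  fixes w :: "('u::universe) sfunc" and C' C :: "'u scat"
  assumes w: "functor_between w C' C" and C': "small_cat C'" and C: "small_cat C"
begin

lemma el_pb_functor:
  assumes X: "functor_between X (op_cat C) Set"
  shows "functor_between (el_pb w X) (el_cat C' (comp_func X (op_func w))) (pb_cat w (el_proj C X))"
proof -
  note s = functor_betweenD[OF w] functor_simps[OF w] functor_betweenD[OF X] small_catD(1)[OF C] small_catD(1)[OF C']
  have Xw: "functor_between (comp_func X (op_func w)) (op_cat C') Set"
    using comp_func_functor[OF op_func_functor[OF w] X] .
  have "functor_between (el_pb w X) (el_cat (Src w) (comp_func X (op_func w))) (pb_cat w (el_proj (Tgt w) X))"
    unfolding el_pb_def
    by (rule mk_func_functor) (auto simp: s category_el_cat[OF _ Xw] category_pb_cat[OF w el_proj_functor[OF _ X]])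
  then show ?thesis by (simp add: s)
qed

lemma el_pb_iso_DFib:
  assumes X: "functor_between X (op_cat C) Set"
  shows "iso (DFib C') (el_proj C' (comp_func X (op_func w)), el_pb w X, pb_proj w (el_proj C X))"
proof -
  note s = functor_betweenD[OF w] functor_simps[OF w] functor_betweenD[OF X] small_catD(1)[OF C] small_catD(1)[OF C']
  have Xw: "functor_between (comp_func X (op_func w)) (op_cat C') Set"
    using comp_func_functor[OF op_func_functor[OF w] X] .
  note el = el_proj_functor[OF small_catD(1)[OF C] X]
  have eq: "comp_func (pb_proj w (el_proj C X)) (el_pb w X) = el_proj C' (comp_func X (op_func w))"
    by (rule func_eqI[OF comp_func_functor[OF el_pb_functor[OF X] pb_proj_functor[OF w el]]
          el_proj_functor[OF small_catD(1)[OF C'] Xw]]) (auto simp: s)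
  have "iso Cat (el_pb w X)"
  proof (rule iso_CatI[OF el_pb_functor[OF X] small_el_cat[OF small_catD(1)[OF C'] Xw C']
        small_cat_pb_cat[OF w el C' small_el_cat[OF small_catD(1)[OF C] X C]]])
    show "bij_betw (FO (el_pb w X)) (Obj (el_cat C' (comp_func X (op_func w)))) (Obj (pb_cat w (el_proj C X)))"
      by (rule bij_betw_byWitness[where f' = "\<lambda>z. pair (p1 z) (p2 (p2 z))"]) (auto simp: s)
    show "bij_betw (FA (el_pb w X)) (Arr (el_cat C' (comp_func X (op_func w)))) (Arr (pb_cat w (el_proj C X)))"
      by (rule bij_betw_byWitness[where f' = "\<lambda>z. pair (p1 z) (p2 (p2 z))"]) (auto simp: s)
  qed
  then show ?thesis
    using eq el_pb_functor[OF X] el_proj_in_DFib[OF small_catD(1)[OF C'] Xw C']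
      Obj_DFib_pb_proj[OF w C' el_proj_in_DFib[OF small_catD(1)[OF C] X C]]
    by (intro iso_DFib) (simp_all add: Arr_DFib)
qed

lemma nat_iso_El_cell:
  "nat_iso (El_cell w) (comp_func (El C') (precomp (op_func w))) (comp_func (DFib_act w) (El C))"
proof (rule nat_isoI[OF comp_func_functor[OF precomp_functor[OF op_func_functor[OF w]] El_functor[OF C']]
      comp_func_functor[OF El_functor[OF C] DFib_act_functor[OF w C']]])
  note s = functor_betweenD[OF w] functor_simps[OF w] small_catD(1)[OF C] small_catD(1)[OF C']
    precomp_FO[OF op_func_functor[OF w]]
  note wop = op_func_functor[OF w]
  fix X :: "'u copsh" assume X: "X \<in> Obj (func_cat (op_cat C) Set)"
  then show "iso (DFib C') (NC (El_cell w) X)"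
    using el_pb_iso_DFib by (simp add: El_cell_def s)
  show "Dom (DFib C') (NC (El_cell w) X) = FO (comp_func (El C') (precomp (op_func w))) X"
    and "Cod (DFib C') (NC (El_cell w) X) = FO (comp_func (DFib_act w) (El C)) X"
    using X comp_func_functor[OF wop, of X Set] el_proj_in_DFib[OF small_catD(1)[OF C] _ C, of X]
    by (simp_all add: El_cell_def s)
next
  note s = functor_betweenD[OF w] functor_simps[OF w] small_catD(1)[OF C] small_catD(1)[OF C']
    precomp_FO[OF op_func_functor[OF w]] precomp_FA[OF op_func_functor[OF w]]
  note wop = op_func_functor[OF w]
  fix \<alpha> :: "'u copsh_nt" assume "\<alpha> \<in> Arr (func_cat (op_cat C) Set)"
  then have \<alpha>: "is_nt \<alpha>" "functor_between (NSrc \<alpha>) (op_cat C) Set" by simp_all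
  note X = \<alpha>(2) and Y = nt_NTgt[OF \<alpha>]
  note Xw = comp_func_functor[OF wop X]
  let ?\<alpha>w = "FA (precomp (op_func w)) \<alpha>"
  have \<alpha>w: "is_nt ?\<alpha>w" "NSrc ?\<alpha>w = comp_func (NSrc \<alpha>) (op_func w)" "NTgt ?\<alpha>w = comp_func (NTgt \<alpha>) (op_func w)"
    "\<And>c. c \<in> Obj C' \<Longrightarrow> NC ?\<alpha>w c = NC \<alpha> (FO w c)"
    using precomp_nt[OF wop \<alpha>] precomp_FA[OF wop \<alpha>] by simp_all
  note m = el_map_functor[OF small_catD(1)[OF C'] \<alpha>w(1), unfolded \<alpha>w(2,3), OF Xw]
  note n = pb_map_functor[OF el_proj_functor[OF small_catD(1)[OF C] Y] el_map_functor[OF small_catD(1)[OF C] \<alpha>] el_proj_map[OF small_catD(1)[OF C] \<alpha>] w]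
  have "comp_func (el_pb w (NTgt \<alpha>)) (el_map C' ?\<alpha>w) =
      comp_func (pb_map w (el_proj C (NSrc \<alpha>)) (el_map C \<alpha>) (el_proj C (NTgt \<alpha>))) (el_pb w (NSrc \<alpha>))"
    by (rule func_eqI[OF comp_func_functor[OF m el_pb_functor[OF Y]] comp_func_functor[OF el_pb_functor[OF X] n]])
      (auto simp: s \<alpha>w psh_nt_simps[OF small_catD(1)[OF C] \<alpha>] functor_betweenD[OF X])
  then show "Comp (DFib C') (NC (El_cell w) (Cod (func_cat (op_cat C) Set) \<alpha>)) (FA (comp_func (El C') (precomp (op_func w))) \<alpha>) =
      Comp (DFib C') (FA (comp_func (DFib_act w) (El C)) \<alpha>) (NC (El_cell w) (Dom (func_cat (op_cat C) Set) \<alpha>))"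
    using \<alpha> X Y \<alpha>w Xw el_map_in_DFib[OF small_catD(1)[OF C] \<alpha> C]
    by (simp add: El_cell_def s(1-10))
qed (simp_all add: El_cell_def functor_betweenD[OF w])

end

lemma pseudonatural_equivalence_El:
  "pseudonatural_equivalence (Cat :: (('u::universe) scat, 'u sfunc) cat) Psh DFib_psf El
     El_cell"
  unfolding pseudonatural_equivalence_def
proof (intro conjI ballI pseudonaturalI pseudofunctor_Psh pseudofunctor_DFib_psf)
  show "equivalence (El C)" if "C \<in> Obj Cat" for C :: "'u scat"
    using that equivalence_El by simp
  show "functor_between (El C) (fib Psh C) (fib DFib_psf C)" if "C \<in> Obj Cat" for C :: "'u scat"
    using that El_functor by simp
next
  fix w :: "'u sfunc" assume w: "w \<in> Arr Cat"
  then show "nat_iso (El_cell w) (comp_func (El (Dom Cat w)) (act Psh w))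
      (comp_func (act DFib_psf w) (El (Cod Cat w)))"
    using nat_iso_El_cell[OF Arr_CatD[OF w]] by simp
next
  fix C :: "'u scat" and X :: "'u copsh" assume "C \<in> Obj Cat" and "X \<in> Obj (fib Psh C)"
  then have sC: "small_cat C" and X: "functor_between X (op_cat C) Set" by simp_all
  note C = small_catD(1)[OF sC]
  \<comment> \<open>The identity functor on the left is the image under \<open>El\<close> of the
    unitor of \<open>Psh\<close>. Both sides send \<open>pair c x\<close> to
    \<open>pair c (pair c x)\<close>.\<close>
  have "comp_func (el_pb (id_func C) X) (id_func (el_cat C X)) = pb_unit (el_proj C X)"
    using el_pb_functor[OF id_func_functor[OF C] sC sC X] pb_unit_functor[OF el_proj_functor[OF C X]]
      X
    by (intro func_eqI[of _ "el_cat C X" "pb_cat (id_func C) (el_proj C X)"] comp_func_functor[OF id_func_functor])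
      (auto simp: category_el_cat[OF C X] functor_betweenD[OF X] comp_func_id_right[OF X])
  then show "Comp (fib DFib_psf C) (NC (El_cell (Ident Cat C)) X)
      (FA (El C) (NC (unitor Psh C) X)) = NC (unitor DFib_psf C) (FO (El C) X)"
    using X sC nt_Ident[OF X] el_map_Ident[OF C X] el_proj_in_DFib[OF C X sC]
    by (simp add: El_cell_def Psh_def id_nt_def comp_func_id_right[OF X])
next
  fix w w' :: "'u sfunc" and X :: "'u copsh"
  assume *: "w \<in> Arr Cat" "w' \<in> Arr Cat" "X \<in> Obj (fib Psh (Cod Cat w))" and eq: "Cod Cat w' = Dom Cat w"
  define C C' C'' where "C = Tgt w" and "C' = Src w" and "C'' = Src w'"
  then have w: "functor_between w C' C" and w': "functor_between w' C'' C'" and X: "functor_between X (op_cat C) Set"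
    and sC: "small_cat C" "small_cat C'" "small_cat C''"
    using * eq Arr_CatD[of w] Arr_CatD[of w'] by simp_all
  note C = sC[THEN small_catD(1)]
  note Xw = comp_func_functor[OF op_func_functor[OF w] X]
  note Xww = comp_func_functor[OF op_func_functor[OF w'] Xw]
  note s = functor_betweenD[OF w] functor_betweenD[OF w'] functor_betweenD[OF X] functor_simps[OF w] functor_simps[OF w']
    precomp_FO[OF op_func_functor[OF w]] precomp_FO[OF op_func_functor[OF w']]
    precomp_FO[OF comp_func_functor[OF op_func_functor[OF w'] op_func_functor[OF w]]]
  have assoc: "comp_func X (op_func (comp_func w w')) = comp_func (comp_func X (op_func w)) (op_func w')"
    using comp_func_assoc[OF op_func_functor[OF w'] op_func_functor[OF w] X] by (simp add: op_func_comp)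
  let ?X' = "comp_func X (op_func w)" and ?X'' = "comp_func (comp_func X (op_func w)) (op_func w')"
  note el = el_proj_functor[OF C(1) X]
  note pbw = el_pb_functor[OF w sC(2,1) X] and pbw' = el_pb_functor[OF w' sC(3,2) Xw]
  note pbww = el_pb_functor[OF comp_func_functor[OF w' w] sC(3,1) X, unfolded assoc]
  have over: "comp_func (pb_proj w (el_proj C X)) (el_pb w X) = el_proj C' ?X'"
    using el_pb_iso_DFib[OF w sC(2,1) X] by (auto simp: iso_def Arr_DFib)
  note m = pb_map_functor[OF pb_proj_functor[OF w el] pbw over w']
  \<comment> \<open>The identity functor on the left is the image of the compositor of
    \<open>Psh\<close>. Both sides send \<open>pair c x\<close> to the pair of \<open>c\<close> with
    \<open>pair c0 x\<close>, where \<open>c0\<close> is the image of \<open>c\<close> under the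
    composite of \<open>w\<close> and \<open>w'\<close>; on the right \<open>pb_cmp\<close> removes
    the extra coordinate over \<open>C'\<close>.\<close>
  have main: "comp_func (el_pb (comp_func w w') X) (id_func (el_cat C'' ?X'')) =
     comp_func (pb_cmp w w' (el_proj C X)) (comp_func (pb_map w' (el_proj C' ?X') (el_pb w X) (pb_proj w (el_proj C X)))
       (el_pb w' ?X'))"
    by (rule func_eqI[OF comp_func_functor[OF id_func_functor[OF category_el_cat[OF C(3) Xww]] pbww]
        comp_func_functor[OF comp_func_functor[OF pbw' m] pb_cmp_functor[OF el w w']]])
      (auto simp: s assoc)
  have iD: "(el_proj C' ?X', el_pb w X, pb_proj w (el_proj C X)) \<in> Arr (DFib C')"
    using el_pb_iso_DFib[OF w sC(2,1) X] by (simp add: iso_def)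
  have "NC (compositor Psh w w') X = Ident (func_cat (op_cat C'') Set) ?X''"
    using X Xw by (simp add: Psh_def id_nt_def s)
  then have comp: "FA (El C'') (NC (compositor Psh w w') X) = Ident (DFib C'') (el_proj C'' ?X'')"
    using Xww FA_Ident[OF El_functor[OF sC(3)], of ?X''] by simp
  show "Comp (fib DFib_psf (Dom Cat w')) (NC (El_cell (Comp Cat w w')) X)
         (FA (El (Dom Cat w')) (NC (compositor Psh w w') X)) =
        Comp (fib DFib_psf (Dom Cat w')) (NC (compositor DFib_psf w w') (FO (El (Cod Cat w)) X))
         (Comp (fib DFib_psf (Dom Cat w')) (FA (act DFib_psf w') (NC (El_cell w) X))
           (NC (El_cell w') (FO (act Psh w) X)))"
    using X Xw main iD el_proj_in_DFib[OF C(1) X sC(1)]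
    by (simp add: El_cell_def s comp assoc)
qed

subsection \<open>Profunctors as presheaves\<close>

definition twist :: "(('u::universe) scat \<times> 'u scat, 'u sfunc \<times> 'u sfunc, 'u scat, 'u sfunc) func" where
  "twist = mk_func (times_cat Cat Cat) Cat (\<lambda>(A, B). prod_cat B (op_cat A)) (\<lambda>(u, v). prod_func v (op_func u))"

lemma twist_simps [simp]:
  "Src twist = times_cat Cat Cat" "Tgt twist = Cat"
  "small_cat A \<Longrightarrow> small_cat B \<Longrightarrow> FO twist (A, B) = prod_cat B (op_cat A)"
  "u \<in> Arr Cat \<Longrightarrow> v \<in> Arr Cat \<Longrightarrow> FA twist (u, v) = prod_func v (op_func u)"
  by (simp_all add: twist_def)

lemma prod_func_op_func_comp:
  assumes "u \<in> Arr Cat" "v \<in> Arr Cat" "u' \<in> Arr Cat" "v' \<in> Arr Cat" "Tgt u' = Src u" "Tgt v' = Src v"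
  shows "prod_func (comp_func v v') (op_func (comp_func u u')) =
    comp_func (prod_func v (op_func u)) (prod_func v' (op_func u'))"
proof -
  have "functor_between u (Src u) (Tgt u)" "functor_between v (Src v) (Tgt v)"
    "functor_between u' (Src u') (Src u)" "functor_between v' (Src v') (Src v)"
    using assms Arr_CatD by metis+
  then show ?thesis
    by (simp add: op_func_comp prod_func_comp[OF _ op_func_functor _ op_func_functor])
qed

text \<open>Passing to opposites reverses the arrows inside a category but not the functors between
  categories, so the construction is covariant in both variables.\<close>

lemma twist_functor:
  "functor_between (twist :: (('u::universe) scat \<times> 'u scat, 'u sfunc \<times> 'u sfunc, 'u scat, 'u sfunc) func)
     (times_cat Cat Cat) Cat"
  unfolding twist_def
proof (rule mk_func_functor[OF category_times_cat[OF category_Cat category_Cat] category_Cat])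
  fix w :: "'u sfunc \<times> 'u sfunc" assume w: "w \<in> Arr (times_cat Cat Cat)"
  obtain u v where uv: "w = (u, v)" by (cases w)
  have "functor_between (prod_func v (op_func u)) (prod_cat (Src v) (op_cat (Src u))) (prod_cat (Tgt v) (op_cat (Tgt u)))"
    using w uv by (intro prod_func_functor op_func_functor Arr_CatD) simp_all
  then show "(\<lambda>(u, v). prod_func v (op_func u)) w \<in> Arr Cat"
    using w uv by (simp add: small_cat_prod_cat functor_betweenD)
next
  fix f g :: "'u sfunc \<times> 'u sfunc"
  assume "f \<in> Arr (times_cat Cat Cat)" "g \<in> Arr (times_cat Cat Cat)"
    "Cod (times_cat Cat Cat) f = Dom (times_cat Cat Cat) g"
  then show "(\<lambda>(u, v). prod_func v (op_func u)) (Comp (times_cat Cat Cat) g f) =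
    Comp Cat ((\<lambda>(u, v). prod_func v (op_func u)) g) ((\<lambda>(u, v). prod_func v (op_func u)) f)"
    using prod_func_op_func_comp[of "fst g" "snd g" "fst f" "snd f"] by (cases f; cases g) simp
qed (auto simp: small_cat_prod_cat prod_func_id small_catD)

text \<open>Not merely an isomorphism: \<open>op_cat\<close> is an involution and commutes with
  \<open>prod_cat\<close> on records, so profunctors and presheaves on
  \<open>prod_cat B (op_cat A)\<close> form the same category.\<close>

lemma reindexes_Prof:
  "reindexes (twist :: (('u::universe) scat \<times> 'u scat, 'u sfunc \<times> 'u sfunc, 'u scat, 'u sfunc) func) Psh Prof"
  unfolding reindexes_def
proof (intro conjI ballI impI)
  fix k :: "'u scat \<times> 'u scat" assume "k \<in> Obj (Src twist)"
  then show "fib Prof k = fib Psh (FO twist k)" "unitor Prof k = unitor Psh (FO twist k)"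
    by (auto simp: Prof_def Psh_def op_cat_prod_cat prod_func_id[symmetric] small_catD op_func_prod_func)
next
  fix w :: "'u sfunc \<times> 'u sfunc" assume "w \<in> Arr (Src twist)"
  then show "act Prof w = act Psh (FA twist w)"
    by (auto simp: Prof_def op_func_prod_func)
next
  fix w w' :: "'u sfunc \<times> 'u sfunc" assume *: "w \<in> Arr (Src twist)" "w' \<in> Arr (Src twist)"
    "Cod (Src twist) w' = Dom (Src twist) w"
  obtain u v u' v' where uv: "w = (u, v)" "w' = (u', v')" by (cases w; cases w')
  have "op_func (comp_func (prod_func v (op_func u)) (prod_func v' (op_func u')))
      = prod_func (op_func (comp_func v v')) (comp_func u u')"
    using * prod_func_op_func_comp[of u v u' v', symmetric] by (simp add: uv op_func_prod_func)
  then show "compositor Prof w w' = compositor Psh (FA twist w) (FA twist w')"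
    using * by (simp add: uv Prof_def Psh_def op_func_prod_func)
qed

lemma reindexes_DFib_prod:
  "reindexes (twist :: (('u::universe) scat \<times> 'u scat, 'u sfunc \<times> 'u sfunc, 'u scat, 'u sfunc) func) DFib_psf DFib_prod"
  by (auto simp: reindexes_def DFib_prod_def)

lemma pseudofunctor_Prof:
  "pseudofunctor (times_cat Cat Cat)
     (Prof :: (('u::universe) scat \<times> 'u scat, 'u sfunc \<times> 'u sfunc, 'u copsh, 'u copsh_nt) psf)"
  by (rule pseudofunctor_reindex[OF pseudofunctor_Psh twist_functor reindexes_Prof])

subsection \<open>Two-sided discrete fibrations\<close>

text \<open>The factorization axiom is asked for arbitrary lifts instead of the \<open>THE\<close>
  terms of the definition; as lifts exist uniquely, \<open>theI'\<close> supplies the particular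
  ones.\<close>

lemma two_sidedI:
  assumes q: "functor_between q E A" and p: "functor_between p E B"
    and l: "\<And>e f. e \<in> Obj E \<Longrightarrow> f \<in> Arr A \<Longrightarrow> Dom A f = FO q e \<Longrightarrow> \<exists>!g. is_left_lift q p e f g"
    and r: "\<And>e f. e \<in> Obj E \<Longrightarrow> f \<in> Arr B \<Longrightarrow> Cod B f = FO p e \<Longrightarrow> \<exists>!g. is_right_lift q p e f g"
    and lr: "\<And>h k m. h \<in> Arr E \<Longrightarrow> is_left_lift q p (Dom E h) (FA q h) k \<Longrightarrow>
      is_right_lift q p (Cod E h) (FA p h) m \<Longrightarrow> Cod E k = Dom E m \<and> Comp E m k = h"
  shows "two_sided_discrete_fibration q p"
proof -
  note s = functor_betweenD[OF q] functor_betweenD[OF p] functor_simps[OF q] functor_simps[OF p]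
  have "Cod E (THE g. is_left_lift q p (Dom E h) (FA q h) g) = Dom E (THE g. is_right_lift q p (Cod E h) (FA p h) g) \<and>
      Comp E (THE g. is_right_lift q p (Cod E h) (FA p h) g) (THE g. is_left_lift q p (Dom E h) (FA q h) g) = h"
    if h: "h \<in> Arr E" for h
    by (rule lr[OF h theI' theI']) (use h l r in \<open>simp_all add: s\<close>)
  then show ?thesis
    unfolding two_sided_discrete_fibration_def Let_def using l r by (simp add: s)
qed

definition llift :: "('u::universe) sfunc \<Rightarrow> 'u sfunc \<Rightarrow> 'u \<Rightarrow> 'u \<Rightarrow> 'u" where
  "llift q p f e = (THE g. is_left_lift q p e f g)"

definition rlift :: "('u::universe) sfunc \<Rightarrow> 'u sfunc \<Rightarrow> 'u \<Rightarrow> 'u \<Rightarrow> 'u" where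
  "rlift q p f e = (THE g. is_right_lift q p e f g)"

context
  fixes q p :: "('u::universe) sfunc" and E A B
  assumes q: "functor_between q E A" and p: "functor_between p E B"
begin

lemmas legs_simps = functor_betweenD[OF q] functor_betweenD[OF p] functor_simps[OF q] functor_simps[OF p]

lemma left_lift_iff:
  "is_left_lift q p e f g \<longleftrightarrow> g \<in> Arr E \<and> Dom E g = e \<and> FA q g = f \<and> FA p g = Ident B (FO p e)"
  by (simp add: is_left_lift_def legs_simps)

lemma right_lift_iff:
  "is_right_lift q p e f g \<longleftrightarrow> g \<in> Arr E \<and> Cod E g = e \<and> FA p g = f \<and> FA q g = Ident A (FO q e)"
  by (simp add: is_right_lift_def legs_simps)

context
  assumes two: "two_sided_discrete_fibration q p"
begin

abbreviation "push f e \<equiv> Cod E (llift q p f e)"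
abbreviation "pull f e \<equiv> Dom E (rlift q p f e)"

lemma ex1_llift:
  "e \<in> Obj E \<Longrightarrow> f \<in> Arr A \<Longrightarrow> Dom A f = FO q e \<Longrightarrow> \<exists>!g. is_left_lift q p e f g"
  using two unfolding two_sided_discrete_fibration_def by (simp add: legs_simps)

lemma ex1_rlift:
  "e \<in> Obj E \<Longrightarrow> f \<in> Arr B \<Longrightarrow> Cod B f = FO p e \<Longrightarrow> \<exists>!g. is_right_lift q p e f g"
  using two unfolding two_sided_discrete_fibration_def by (simp add: legs_simps)

lemma llift:
  assumes "e \<in> Obj E" "f \<in> Arr A" "Dom A f = FO q e"
  shows "llift q p f e \<in> Arr E" "Dom E (llift q p f e) = e" "FA q (llift q p f e) = f" "FA p (llift q p f e) = Ident B (FO p e)"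
    "FO q (push f e) = Cod A f" "FO p (push f e) = FO p e"
proof -
  show *: "llift q p f e \<in> Arr E" "Dom E (llift q p f e) = e" "FA q (llift q p f e) = f" "FA p (llift q p f e) = Ident B (FO p e)"
    using theI'[OF ex1_llift[OF assms]] by (simp_all add: llift_def left_lift_iff)
  show "FO q (push f e) = Cod A f" "FO p (push f e) = FO p e"
    using Cod_FA[OF q *(1)] Cod_FA[OF p *(1)] * assms(1) by (simp_all add: legs_simps)
qed

lemma rlift:
  assumes "e \<in> Obj E" "f \<in> Arr B" "Cod B f = FO p e"
  shows "rlift q p f e \<in> Arr E" "Cod E (rlift q p f e) = e" "FA p (rlift q p f e) = f" "FA q (rlift q p f e) = Ident A (FO q e)"
    "FO p (pull f e) = Dom B f" "FO q (pull f e) = FO q e"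
proof -
  show *: "rlift q p f e \<in> Arr E" "Cod E (rlift q p f e) = e" "FA p (rlift q p f e) = f" "FA q (rlift q p f e) = Ident A (FO q e)"
    using theI'[OF ex1_rlift[OF assms]] by (simp_all add: rlift_def right_lift_iff)
  show "FO p (pull f e) = Dom B f" "FO q (pull f e) = FO q e"
    using Dom_FA[OF q *(1)] Dom_FA[OF p *(1)] * assms(1) by (simp_all add: legs_simps)
qed

text \<open>The tool for recognizing lifts: anything vertical over \<open>B\<close>, such as a
  composite of lifts or the image of a lift under a functor over \<open>B\<close>, is itself a
  lift.\<close>

lemma llift_eq: "g \<in> Arr E \<Longrightarrow> FA p g = Ident B (FO p (Dom E g)) \<Longrightarrow> llift q p (FA q g) (Dom E g) = g"
  unfolding llift_def by (rule the1_equality[OF ex1_llift]) (simp_all add: legs_simps left_lift_iff)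

lemma rlift_eq: "g \<in> Arr E \<Longrightarrow> FA q g = Ident A (FO q (Cod E g)) \<Longrightarrow> rlift q p (FA p g) (Cod E g) = g"
  unfolding rlift_def by (rule the1_equality[OF ex1_rlift]) (simp_all add: legs_simps right_lift_iff)

lemma factor:
  assumes "h \<in> Arr E"
  shows "push (FA q h) (Dom E h) = pull (FA p h) (Cod E h)"
    and "Comp E (rlift q p (FA p h) (Cod E h)) (llift q p (FA q h) (Dom E h)) = h"
  using two assms unfolding two_sided_discrete_fibration_def Let_def
  by (simp_all add: legs_simps llift_def rlift_def)

text \<open>The factorization in \<open>factor\<close> writes an arrow in terms of just these four
  data. Equations between arrows of the apex are proved with it, without computing composites of
  lifts.\<close>

lemma two_sided_arr_eqI:
  assumes "h \<in> Arr E" "h' \<in> Arr E" "Dom E h = Dom E h'" "Cod E h = Cod E h'" "FA q h = FA q h'" "FA p h = FA p h'"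
  shows "h = h'"
  using factor(2)[OF assms(1)] factor(2)[OF assms(2)] unfolding assms(3-) by (rule box_equals[OF refl])

lemma push_Ident: "e \<in> Obj E \<Longrightarrow> push (Ident A (FO q e)) e = e"
  using llift_eq[of "Ident E e"] by (simp add: legs_simps)

lemma pull_Ident: "e \<in> Obj E \<Longrightarrow> pull (Ident B (FO p e)) e = e"
  using rlift_eq[of "Ident E e"] by (simp add: legs_simps)

text \<open>The composite of two left lifts is again vertical over \<open>B\<close>, so
  \<open>llift_eq\<close> identifies it with the left lift of the composite.\<close>

lemma push_Comp:
  assumes "e \<in> Obj E" "f \<in> Arr A" "Dom A f = FO q e" "g \<in> Arr A" "Dom A g = Cod A f"
  shows "push (Comp A g f) e = push g (push f e)"
  using llift_eq[of "Comp E (llift q p g (push f e)) (llift q p f e)"] llift[of e f] llift[of "push f e" g] assms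
  by (simp add: legs_simps)

lemma pull_Comp:
  assumes "e \<in> Obj E" "f \<in> Arr B" "Cod B f = FO p e" "g \<in> Arr B" "Cod B g = Dom B f"
  shows "pull (Comp B f g) e = pull g (pull f e)"
  using rlift_eq[of "Comp E (rlift q p f e) (rlift q p g (pull f e))"] rlift[of e f] rlift[of "pull f e" g] assms
  by (simp add: legs_simps)

text \<open>Apply the factorization axiom to the composite of the two lifts in the opposite order.\<close>

lemma push_pull:
  assumes "e \<in> Obj E" "f \<in> Arr A" "Dom A f = FO q e" "g \<in> Arr B" "Cod B g = FO p e"
  shows "push f (pull g e) = pull g (push f e)"
  using factor(1)[of "Comp E (llift q p f e) (rlift q p g e)"] llift[of e f] rlift[of e g] assms
  by (simp add: legs_simps)

end

end

subsection \<open>Pullback of two-sided discrete fibrations\<close>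

lemma iso_span_cat:
  assumes K: "category K" and h: "iso K h" and s: "((q, p), h, (q', p')) \<in> Arr (span_cat K a b)"
  shows "iso (span_cat K a b) ((q, p), h, (q', p'))"
proof -
  obtain k where k: "k \<in> Arr K" "Dom K k = Cod K h" "Cod K k = Dom K h"
    "Comp K k h = Ident K (Dom K h)" "Comp K h k = Ident K (Cod K h)"
    using h by (auto simp: iso_def in_hom)
  have "Comp K p k = p'" "Comp K q k = q'"
    using Comp_assoc[OF K, of k h p'] Comp_assoc[OF K, of k h q'] k s K by (simp_all add: spans_def)
  then show ?thesis
    unfolding iso_def using s k by (intro conjI bexI[of _ "((q', p'), k, (q, p))"]) (simp_all add: in_hom spans_def)
qed

lemma DFib2_simps [simp]:
  "Dom (DFib2 A B) (s, h, t) = s" "Cod (DFib2 A B) (s, h, t) = t"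
  "Ident (DFib2 A B) s = (s, id_func (Src (fst s)), s)"
  "Comp (DFib2 A B) (s', h', t') (s, h, t) = (s, comp_func h' h, t')"
  by (simp_all add: DFib2_def)

lemma Obj_DFib2:
  "(q, p) \<in> Obj (DFib2 A B) \<longleftrightarrow>
    functor_between q (Src q) A \<and> functor_between p (Src q) B \<and> small_cat (Src q) \<and> small_cat A \<and> small_cat B \<and>
    two_sided_discrete_fibration q p"
  by (simp add: DFib2_def functor_between_def spans_def, rule iffI; elim conjE; simp)

lemma Arr_DFib2:
  "((q, p), h, (q', p')) \<in> Arr (DFib2 A B) \<longleftrightarrow>
    (q, p) \<in> Obj (DFib2 A B) \<and> (q', p') \<in> Obj (DFib2 A B) \<and> functor_between h (Src q) (Src q') \<and>
    comp_func q' h = q \<and> comp_func p' h = p"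
  by (simp add: DFib2_def functor_between_def spans_def, rule iffI; elim conjE; simp)

lemma Obj_DFib2D:
  assumes "(q, p) \<in> Obj (DFib2 A B)"
  shows "functor_between q (Src q) A" "functor_between p (Src q) B" "small_cat (Src q)" "small_cat A" "small_cat B"
    "two_sided_discrete_fibration q p"
  using assms by (simp_all add: Obj_DFib2)

lemma Arr_DFib2D:
  assumes "((q, p), h, (q', p')) \<in> Arr (DFib2 A B)"
  shows "(q, p) \<in> Obj (DFib2 A B)" "(q', p') \<in> Obj (DFib2 A B)" "functor_between h (Src q) (Src q')"
    "comp_func q' h = q" "comp_func p' h = p"
  using assms by (simp_all add: Arr_DFib2)

lemma category_DFib2: "category (DFib2 A B)"
  unfolding DFib2_def by (intro category_full_subcat category_span_cat category_Cat)

lemma iso_DFib2: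
  assumes h: "iso Cat h" and s: "((q, p), h, (q', p')) \<in> Arr (DFib2 A B)"
  shows "iso (DFib2 A B) ((q, p), h, (q', p'))"
proof -
  have "((q, p), h, (q', p')) \<in> Arr (span_cat Cat A B)" using s by (simp add: DFib2_def)
  from iso_span_cat[OF category_Cat h this] show ?thesis
    using s unfolding DFib2_def by (intro iso_full_subcat) (simp_all del: span_cat_simps(2))
qed

text \<open>Universal property of the product: maps of spans are maps over
  \<open>prod_cat A B\<close>. This is what lets the pullback lemmas, stated over one base, apply to
  spans.\<close>

lemma tuple_triangle:
  assumes q: "functor_between q E A" and p: "functor_between p E B"
    and q': "functor_between q' E' A" and p': "functor_between p' E' B" and h: "functor_between h E E'"
  shows "comp_func (tuple_func q' p') h = tuple_func q p \<longleftrightarrow> comp_func q' h = q \<and> comp_func p' h = p"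
proof
  assume *: "comp_func (tuple_func q' p') h = tuple_func q p"
  have "comp_func (proj1 A B) (comp_func (tuple_func q' p') h) = comp_func q' h"
    "comp_func (proj2 A B) (comp_func (tuple_func q' p') h) = comp_func p' h"
    using comp_func_assoc[OF h tuple_func_functor[OF q' p'] proj_functor(1)]
      comp_func_assoc[OF h tuple_func_functor[OF q' p'] proj_functor(2)] functor_betweenD(5)[OF q] functor_betweenD(5)[OF p]
      comp_proj_tuple[OF q' p'] by simp_all
  then show "comp_func q' h = q \<and> comp_func p' h = p"
    using comp_proj_tuple[OF q p] * by simp
qed (use comp_tuple_func[OF q' p' h] in simp)

context
  fixes u v :: "('u::universe) sfunc" and A' A B' B
  assumes u: "functor_between u A' A" and v: "functor_between v B' B"
begin

lemma span_pb_eq: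
  "span_pb u v (q, p) = (comp_func (proj1 A' B') (pb_proj (prod_func u v) (tuple_func q p)),
     comp_func (proj2 A' B') (pb_proj (prod_func u v) (tuple_func q p)))"
  by (simp add: span_pb_def Let_def functor_betweenD[OF u] functor_betweenD[OF v])

context
  fixes q p :: "'u sfunc" and E
  assumes q: "functor_between q E A" and p: "functor_between p E B"
begin

lemma span_pb_functors:
  "functor_between (fst (span_pb u v (q, p))) (pb_cat (prod_func u v) (tuple_func q p)) A'"
  "functor_between (snd (span_pb u v (q, p))) (pb_cat (prod_func u v) (tuple_func q p)) B'"
  unfolding span_pb_eq fst_conv snd_conv
  by (rule comp_func_functor[OF pb_proj_functor[OF prod_func_functor[OF u v] tuple_func_functor[OF q p]]];
      simp add: proj_functor functor_betweenD[OF u] functor_betweenD[OF v])+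

text \<open>A functor into a product is the pairing of its two projections. Hence iterated pullback
  of spans is iterated pullback of functors into products, and \<open>pb_cmp\<close> with its laws
  can be used unchanged.\<close>

lemma tuple_span_pb:
  "tuple_func (fst (span_pb u v (q, p))) (snd (span_pb u v (q, p))) = pb_proj (prod_func u v) (tuple_func q p)"
  unfolding span_pb_eq fst_conv snd_conv
  by (rule tuple_comp_proj[OF pb_proj_functor[OF prod_func_functor[OF u v] tuple_func_functor[OF q p]]])
    (simp_all add: functor_betweenD[OF u] functor_betweenD[OF v])

lemma pb_span_simps:
  "Obj (pb_cat (prod_func u v) (tuple_func q p)) =
    {pair (pair a b) e | a b e. a \<in> Obj A' \<and> b \<in> Obj B' \<and> e \<in> Obj E \<and> FO u a = FO q e \<and> FO v b = FO p e}"
  "Arr (pb_cat (prod_func u v) (tuple_func q p)) =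
    {pair (pair f g) k | f g k. f \<in> Arr A' \<and> g \<in> Arr B' \<and> k \<in> Arr E \<and> FA u f = FA q k \<and> FA v g = FA p k}"
  by (auto simp: functor_betweenD[OF u] functor_betweenD[OF v] functor_betweenD[OF q] functor_betweenD[OF p])

lemma span_pb_simps:
  "\<lbrakk>a \<in> Obj A'; b \<in> Obj B'; e \<in> Obj E; FO u a = FO q e; FO v b = FO p e\<rbrakk> \<Longrightarrow>
    FO (fst (span_pb u v (q, p))) (pair (pair a b) e) = a"
  "\<lbrakk>a \<in> Obj A'; b \<in> Obj B'; e \<in> Obj E; FO u a = FO q e; FO v b = FO p e\<rbrakk> \<Longrightarrow>
    FO (snd (span_pb u v (q, p))) (pair (pair a b) e) = b"
  "\<lbrakk>f \<in> Arr A'; g \<in> Arr B'; k \<in> Arr E; FA u f = FA q k; FA v g = FA p k\<rbrakk> \<Longrightarrow>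
    FA (fst (span_pb u v (q, p))) (pair (pair f g) k) = f"
  "\<lbrakk>f \<in> Arr A'; g \<in> Arr B'; k \<in> Arr E; FA u f = FA q k; FA v g = FA p k\<rbrakk> \<Longrightarrow>
    FA (snd (span_pb u v (q, p))) (pair (pair f g) k) = g"
  unfolding span_pb_eq
  by (simp_all add: functor_betweenD[OF u] functor_betweenD[OF v] functor_betweenD[OF q] functor_betweenD[OF p])

text \<open>Lifts are formed coordinatewise: the coordinate being lifted is given, the one in the
  other foot must be an identity, and the one in \<open>E\<close> must then be a lift in the
  original span. The factorization axiom is inherited from the coordinate in
  \<open>E\<close>.\<close>

lemma two_sided_span_pb:
  assumes two: "two_sided_discrete_fibration q p"
  shows "two_sided_discrete_fibration (fst (span_pb u v (q, p))) (snd (span_pb u v (q, p)))"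
proof -
  let ?E = "pb_cat (prod_func u v) (tuple_func q p)"
  let ?q = "fst (span_pb u v (q, p))" and ?p = "snd (span_pb u v (q, p))"
  note Q = span_pb_functors
  note s = functor_betweenD[OF u] functor_betweenD[OF v] functor_simps[OF u] functor_simps[OF v]
    legs_simps[OF q p]
  have left: "is_left_lift ?q ?p (pair (pair a b) e) f g \<longleftrightarrow>
      g = pair (pair f (Ident B' b)) (llift q p (FA u f) e)"
    if ab: "a \<in> Obj A'" "b \<in> Obj B'" "e \<in> Obj E" "FO u a = FO q e" "FO v b = FO p e" and f: "f \<in> Arr A'" "Dom A' f = a"
    for a b e f g
  proof
    note L = llift[OF q p two, of e "FA u f"]
    have L: "llift q p (FA u f) e \<in> Arr E" "Dom E (llift q p (FA u f) e) = e"
      "FA q (llift q p (FA u f) e) = FA u f" "FA p (llift q p (FA u f) e) = Ident B (FO p e)"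
      using L ab f by (simp_all add: s)
    show "is_left_lift ?q ?p (pair (pair a b) e) f g" if g: "g = pair (pair f (Ident B' b)) (llift q p (FA u f) e)"
      unfolding left_lift_iff[OF Q] pb_span_simps g using ab f L by (simp add: s span_pb_simps)
    assume g: "is_left_lift ?q ?p (pair (pair a b) e) f g"
    then obtain f' g' k where g': "g = pair (pair f' g') k" "f' \<in> Arr A'" "g' \<in> Arr B'" "k \<in> Arr E" "FA u f' = FA q k" "FA v g' = FA p k"
      unfolding left_lift_iff[OF Q] pb_span_simps by auto
    then have "f' = f" "g' = Ident B' b" "Dom E k = e"
      using g ab unfolding left_lift_iff[OF Q] by (simp_all add: s span_pb_simps)
    then show "g = pair (pair f (Ident B' b)) (llift q p (FA u f) e)"
      using llift_eq[OF q p two, of k] g' ab by (simp add: s)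
  qed
  have right: "is_right_lift ?q ?p (pair (pair a b) e) f g \<longleftrightarrow>
      g = pair (pair (Ident A' a) f) (rlift q p (FA v f) e)"
    if ab: "a \<in> Obj A'" "b \<in> Obj B'" "e \<in> Obj E" "FO u a = FO q e" "FO v b = FO p e" and f: "f \<in> Arr B'" "Cod B' f = b"
    for a b e f g
  proof
    note L = rlift[OF q p two, of e "FA v f"]
    have L: "rlift q p (FA v f) e \<in> Arr E" "Cod E (rlift q p (FA v f) e) = e"
      "FA p (rlift q p (FA v f) e) = FA v f" "FA q (rlift q p (FA v f) e) = Ident A (FO q e)"
      using L ab f by (simp_all add: s)
    show "is_right_lift ?q ?p (pair (pair a b) e) f g" if g: "g = pair (pair (Ident A' a) f) (rlift q p (FA v f) e)"
      unfolding right_lift_iff[OF Q] pb_span_simps g using ab f L by (simp add: s span_pb_simps)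
    assume g: "is_right_lift ?q ?p (pair (pair a b) e) f g"
    then obtain f' g' k where g': "g = pair (pair f' g') k" "f' \<in> Arr A'" "g' \<in> Arr B'" "k \<in> Arr E" "FA u f' = FA q k" "FA v g' = FA p k"
      unfolding right_lift_iff[OF Q] pb_span_simps by auto
    then have "g' = f" "f' = Ident A' a" "Cod E k = e"
      using g ab unfolding right_lift_iff[OF Q] by (simp_all add: s span_pb_simps)
    then show "g = pair (pair (Ident A' a) f) (rlift q p (FA v f) e)"
      using rlift_eq[OF q p two, of k] g' ab by (simp add: s)
  qed
  show ?thesis
  proof (rule two_sidedI[OF Q])
    fix z f assume "z \<in> Obj ?E" "f \<in> Arr A'" "Dom A' f = FO ?q z"
    then obtain a b e where "z = pair (pair a b) e" "a \<in> Obj A'" "b \<in> Obj B'" "e \<in> Obj E" "FO u a = FO q e" "FO v b = FO p e"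
      "f \<in> Arr A'" "Dom A' f = a"
      unfolding pb_span_simps by (auto simp: span_pb_simps)
    then show "\<exists>!g. is_left_lift ?q ?p z f g" using left by simp
  next
    fix z f assume "z \<in> Obj ?E" "f \<in> Arr B'" "Cod B' f = FO ?p z"
    then obtain a b e where "z = pair (pair a b) e" "a \<in> Obj A'" "b \<in> Obj B'" "e \<in> Obj E" "FO u a = FO q e" "FO v b = FO p e"
      "f \<in> Arr B'" "Cod B' f = b"
      unfolding pb_span_simps by (auto simp: span_pb_simps)
    then show "\<exists>!g. is_right_lift ?q ?p z f g" using right by simp
  next
    fix h l r assume "h \<in> Arr ?E" and l: "is_left_lift ?q ?p (Dom ?E h) (FA ?q h) l"
      and r: "is_right_lift ?q ?p (Cod ?E h) (FA ?p h) r"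
    then obtain f g k where h: "h = pair (pair f g) k" "f \<in> Arr A'" "g \<in> Arr B'" "k \<in> Arr E" "FA u f = FA q k" "FA v g = FA p k"
      unfolding pb_span_simps by auto
    \<comment> \<open>Both ends of \<open>h\<close> satisfy the pullback condition, so the
      descriptions \<open>left\<close> and \<open>right\<close> apply at the domain and at the
      codomain respectively.\<close>
    have uv: "FO u (Dom A' f) = FO q (Dom E k)" "FO v (Dom B' g) = FO p (Dom E k)"
      "FO u (Cod A' f) = FO q (Cod E k)" "FO v (Cod B' g) = FO p (Cod E k)"
      using FO_eq_if_FA_eq[OF u q h(2,4,5)] FO_eq_if_FA_eq[OF v p h(3,4,6)] by simp_all
    have "l = pair (pair f (Ident B' (Dom B' g))) (llift q p (FA q k) (Dom E k))"
      using left[of "Dom A' f" "Dom B' g" "Dom E k" f l] l h uv by (simp add: s span_pb_simps)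
    moreover have "r = pair (pair (Ident A' (Cod A' f)) g) (rlift q p (FA p k) (Cod E k))"
      using right[of "Cod A' f" "Cod B' g" "Cod E k" g r] r h uv by (simp add: s span_pb_simps)
    ultimately show "Cod ?E l = Dom ?E r \<and> Comp ?E r l = h"
      using factor[OF q p two h(4)] h by (simp add: s)
  qed
qed

end

end

lemma Obj_DFib2_span_pb:
  assumes u: "functor_between u A' A" "small_cat A'" and v: "functor_between v B' B" "small_cat B'"
    and s: "(q, p) \<in> Obj (DFib2 A B)"
  shows "span_pb u v (q, p) \<in> Obj (DFib2 A' B')"
proof -
  note D = Obj_DFib2D[OF s]
  have src: "Src (fst (span_pb u v (q, p))) = pb_cat (prod_func u v) (tuple_func q p)"
    using functor_betweenD(2)[OF span_pb_functors(1)[OF u(1) v(1) D(1,2)]] .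
  have "(fst (span_pb u v (q, p)), snd (span_pb u v (q, p))) \<in> Obj (DFib2 A' B')"
    unfolding Obj_DFib2 src
    by (intro conjI span_pb_functors[OF u(1) v(1) D(1,2)] u v two_sided_span_pb[OF u(1) v(1) D(1,2,6)]
        small_cat_pb_cat[OF prod_func_functor[OF u(1) v(1)] tuple_func_functor[OF D(1,2)] small_cat_prod_cat D(3)])
  then show ?thesis by simp
qed

lemma Arr_DFib2_pb_map:
  assumes u: "functor_between u A' A" "small_cat A'" and v: "functor_between v B' B" "small_cat B'"
    and h: "((q, p), h, (q', p')) \<in> Arr (DFib2 A B)"
  shows "(span_pb u v (q, p), pb_map (prod_func u v) (tuple_func q p) h (tuple_func q' p'), span_pb u v (q', p'))
    \<in> Arr (DFib2 A' B')"
proof -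
  note h = Arr_DFib2D[OF h]
  note D = Obj_DFib2D[OF h(1)] and D' = Obj_DFib2D[OF h(2)]
  note S = span_pb_functors[OF u(1) v(1) D(1,2)] and S' = span_pb_functors[OF u(1) v(1) D'(1,2)]
  have t: "comp_func (tuple_func q' p') h = tuple_func q p"
    using tuple_triangle[OF D(1,2) D'(1,2) h(3)] h by simp
  note W = prod_func_functor[OF u(1) v(1)] and T' = tuple_func_functor[OF D'(1,2)]
  have "comp_func (fst (span_pb u v (q', p'))) (pb_map (prod_func u v) (tuple_func q p) h (tuple_func q' p')) = fst (span_pb u v (q, p))
    \<and> comp_func (snd (span_pb u v (q', p'))) (pb_map (prod_func u v) (tuple_func q p) h (tuple_func q' p')) = snd (span_pb u v (q, p))"
    using tuple_triangle[OF S S' pb_map_functor[OF T' h(3) t W]]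
    by (simp add: tuple_span_pb[OF u(1) v(1) D(1,2)] tuple_span_pb[OF u(1) v(1) D'(1,2)] pb_proj_map[OF T' h(3) t W])
  then show ?thesis
    using Obj_DFib2_span_pb[OF u v h(1)] Obj_DFib2_span_pb[OF u v h(2)] pb_map_functor[OF T' h(3) t W]
      functor_betweenD(2)[OF S(1)] functor_betweenD(2)[OF S'(1)]
    by (cases "span_pb u v (q, p)"; cases "span_pb u v (q', p')") (simp add: Arr_DFib2)
qed

section \<open>Pullback of spans as a pseudofunctor in both feet\<close>

abbreviation tup :: "('u::universe) span \<Rightarrow> 'u sfunc" where
  "tup s \<equiv> tuple_func (fst s) (snd s)"

lemma tup_functor:
  assumes "s \<in> Obj (DFib2 A B)"
  shows "functor_between (tup s) (Src (fst s)) (prod_cat A B)"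
  using assms Obj_DFib2D(1,2)[of "fst s" "snd s" A B] by (simp add: tuple_func_functor)

lemma Arr_DFib2I:
  assumes "s \<in> Obj (DFib2 A B)" "t \<in> Obj (DFib2 A B)" and h: "functor_between h (Src (fst s)) (Src (fst t))"
    and "comp_func (tup t) h = tup s"
  shows "(s, h, t) \<in> Arr (DFib2 A B)"
  using assms tuple_triangle[OF Obj_DFib2D(1,2)[of "fst s" "snd s" A B] Obj_DFib2D(1,2)[of "fst t" "snd t" A B] h]
  by (cases s; cases t) (simp add: Arr_DFib2)

lemma Arr_DFib2_tupD:
  assumes "(s, h, t) \<in> Arr (DFib2 A B)"
  shows "s \<in> Obj (DFib2 A B)" "t \<in> Obj (DFib2 A B)" "functor_between h (Src (fst s)) (Src (fst t))"
    "comp_func (tup t) h = tup s"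
proof -
  note D = Arr_DFib2D[of "fst s" "snd s" h "fst t" "snd t", unfolded prod.collapse, OF assms]
  show "s \<in> Obj (DFib2 A B)" "t \<in> Obj (DFib2 A B)" "functor_between h (Src (fst s)) (Src (fst t))"
    using D by simp_all
  show "comp_func (tup t) h = tup s"
    using tuple_triangle[OF Obj_DFib2D(1,2)[of "fst s" "snd s" A B] Obj_DFib2D(1,2)[of "fst t" "snd t" A B] D(3)] D by simp
qed

lemma Obj_DFib2_small:
  "s \<in> Obj (DFib2 A B) \<Longrightarrow> small_cat (Src (fst s))" "s \<in> Obj (DFib2 A B) \<Longrightarrow> small_cat A"
  "s \<in> Obj (DFib2 A B) \<Longrightarrow> small_cat B"
  using Obj_DFib2D[of "fst s" "snd s" A B] by simp_all

context
  fixes u v :: "('u::universe) sfunc" and A' A B' B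
  assumes u: "functor_between u A' A" "small_cat A'" and v: "functor_between v B' B" "small_cat B'"
begin

lemma span_pb_in_DFib2: "s \<in> Obj (DFib2 A B) \<Longrightarrow> span_pb u v s \<in> Obj (DFib2 A' B')"
  using Obj_DFib2_span_pb[OF u v, of "fst s" "snd s"] by simp

lemma
  assumes "s \<in> Obj (DFib2 A B)"
  shows Src_span_pb: "Src (fst (span_pb u v s)) = pb_cat (prod_func u v) (tup s)"
    and tup_span_pb: "tup (span_pb u v s) = pb_proj (prod_func u v) (tup s)"
  using functor_betweenD(2)[OF span_pb_functors(1)[OF u(1) v(1) Obj_DFib2D(1,2)[of "fst s" "snd s"]]]
    tuple_span_pb[OF u(1) v(1) Obj_DFib2D(1,2)[of "fst s" "snd s"]] assms by simp_all

lemma pb_map_in_DFib2: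
  assumes "(s, h, t) \<in> Arr (DFib2 A B)"
  shows "(span_pb u v s, pb_map (prod_func u v) (tup s) h (tup t), span_pb u v t) \<in> Arr (DFib2 A' B')"
  using Arr_DFib2_pb_map[OF u v, of "fst s" "snd s" h "fst t" "snd t"] assms by simp

lemma DFib2_act_eq_mk:
  "DFib2_act u v = mk_func (DFib2 A B) (DFib2 A' B') (span_pb u v)
    (\<lambda>(s, h, t). (span_pb u v s, pb_map (prod_func u v) (tup s) h (tup t), span_pb u v t))"
  by (simp add: DFib2_act_def mk_func_def functor_betweenD[OF u(1)] functor_betweenD[OF v(1)] case_prod_unfold)

lemma DFib2_act_functor: "functor_between (DFib2_act u v) (DFib2 A B) (DFib2 A' B')"
  unfolding DFib2_act_eq_mk
proof (rule mk_func_functor[OF category_DFib2 category_DFib2])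
  fix s assume s: "s \<in> Obj (DFib2 A B)"
  show "(\<lambda>(s, h, t). (span_pb u v s, pb_map (prod_func u v) (tup s) h (tup t), span_pb u v t)) (Ident (DFib2 A B) s)
      = Ident (DFib2 A' B') (span_pb u v s)"
    using pb_map_id[OF tup_functor[OF s] prod_func_functor[OF u(1) v(1)]] by (simp add: Src_span_pb[OF s])
next
  fix f g assume fg: "f \<in> Arr (DFib2 A B)" "g \<in> Arr (DFib2 A B)" "Cod (DFib2 A B) f = Dom (DFib2 A B) g"
  obtain s h t h' t' where fg': "f = (s, h, t)" "g = (t, h', t')"
    using fg(3) by (cases f; cases g) auto
  note h = Arr_DFib2_tupD[OF fg(1)[unfolded fg']] and h' = Arr_DFib2_tupD[OF fg(2)[unfolded fg']]
  show "(\<lambda>(s, h, t). (span_pb u v s, pb_map (prod_func u v) (tup s) h (tup t), span_pb u v t)) (Comp (DFib2 A B) g f)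
    = Comp (DFib2 A' B') ((\<lambda>(s, h, t). (span_pb u v s, pb_map (prod_func u v) (tup s) h (tup t), span_pb u v t)) g)
       ((\<lambda>(s, h, t). (span_pb u v s, pb_map (prod_func u v) (tup s) h (tup t), span_pb u v t)) f)"
    using pb_map_comp[OF tup_functor[OF h'(2)] h'(3,4) prod_func_functor[OF u(1) v(1)] h(3,4)] by (simp add: fg')
qed (use span_pb_in_DFib2 pb_map_in_DFib2 in \<open>auto simp del: tuple_func_simps\<close>)

lemma DFib2_act_simps:
  "s \<in> Obj (DFib2 A B) \<Longrightarrow> FO (DFib2_act u v) s = span_pb u v s"
  "(s, h, t) \<in> Arr (DFib2 A B) \<Longrightarrow> FA (DFib2_act u v) (s, h, t) =
    (span_pb u v s, pb_map (prod_func u v) (tup s) h (tup t), span_pb u v t)"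
  unfolding DFib2_act_eq_mk by simp_all

end

lemma DFib2_act_ends [simp]: "Src (DFib2_act u v) = DFib2 (Tgt u) (Tgt v)" "Tgt (DFib2_act u v) = DFib2 (Src u) (Src v)"
  by (simp_all add: DFib2_act_def)

context
  fixes A B :: "('u::universe) scat"
  assumes A: "small_cat A" and B: "small_cat B"
begin

lemma id_func_functor_small: "functor_between (id_func A) A A" "functor_between (id_func B) B B"
  using A B small_catD(1) by auto

lemma prod_func_id_small: "prod_func (id_func A) (id_func B) = id_func (prod_cat A B)"
  using A B small_catD(1) prod_func_id by blast

lemma DFib2_unitor_NC: "s \<in> Obj (DFib2 A B) \<Longrightarrow>
    NC (DFib2_unitor A B) s = (s, pb_unit (tup s), span_pb (id_func A) (id_func B) s)"
  by (simp add: DFib2_unitor_def case_prod_unfold)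

lemma DFib2_unitor_in:
  assumes s: "s \<in> Obj (DFib2 A B)"
  shows "(s, pb_unit (tup s), span_pb (id_func A) (id_func B) s) \<in> Arr (DFib2 A B)"
  using pb_unit_functor[OF tup_functor[OF s]] pb_proj_unit[OF tup_functor[OF s]]
    functor_betweenD(5)[OF tup_functor[OF s]] span_pb_in_DFib2[OF id_func_functor_small(1) A id_func_functor_small(2) B s]
  by (intro Arr_DFib2I) (simp_all add: s Src_span_pb[OF id_func_functor_small(1) A id_func_functor_small(2) B s] tup_span_pb[OF id_func_functor_small(1) A id_func_functor_small(2) B s] prod_func_id_small)

lemma nat_iso_DFib2_unitor:
  "nat_iso (DFib2_unitor A B) (id_func (DFib2 A B)) (DFib2_act (id_func A) (id_func B))"
proof (rule nat_isoI[OF id_func_functor[OF category_DFib2] DFib2_act_functor[OF id_func_functor_small(1) A id_func_functor_small(2) B]])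
  note act = DFib2_act_simps[OF id_func_functor_small(1) A id_func_functor_small(2) B]
  fix s assume s: "s \<in> Obj (DFib2 A B)"
  have "iso Cat (pb_unit (tup s))"
    using iso_pb_unit[OF tup_functor[OF s] Obj_DFib2_small(1)[OF s] small_cat_prod_cat[OF A B]]
      functor_betweenD(5)[OF tup_functor[OF s]] by simp
  then show "iso (DFib2 A B) (NC (DFib2_unitor A B) s)"
    using iso_DFib2[of "pb_unit (tup s)" "fst s" "snd s" "fst (span_pb (id_func A) (id_func B) s)"
        "snd (span_pb (id_func A) (id_func B) s)" A B] DFib2_unitor_in[OF s]
    by (simp add: DFib2_unitor_NC s)
  show "Dom (DFib2 A B) (NC (DFib2_unitor A B) s) = FO (id_func (DFib2 A B)) s"
    "Cod (DFib2 A B) (NC (DFib2_unitor A B) s) = FO (DFib2_act (id_func A) (id_func B)) s"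
    by (simp_all add: DFib2_unitor_NC s act)
next
  note act = DFib2_act_simps[OF id_func_functor_small(1) A id_func_functor_small(2) B]
  fix f assume f: "f \<in> Arr (DFib2 A B)"
  obtain s h t where f': "f = (s, h, t)" by (cases f) auto
  note h = Arr_DFib2_tupD[OF f[unfolded f']]
  show "Comp (DFib2 A B) (NC (DFib2_unitor A B) (Cod (DFib2 A B) f)) (FA (id_func (DFib2 A B)) f) =
      Comp (DFib2 A B) (FA (DFib2_act (id_func A) (id_func B)) f) (NC (DFib2_unitor A B) (Dom (DFib2 A B) f))"
    using pb_unit_natural[OF tup_functor[OF h(2)] h(3,4)] functor_betweenD(5)[OF tup_functor[OF h(2)]] f h
    by (simp add: f' act DFib2_unitor_NC prod_func_id_small)
qed (simp add: DFib2_unitor_def, simp add: DFib2_unitor_def, simp add: DFib2_unitor_def)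

end

context
  fixes u v u' v' :: "('u::universe) sfunc" and A'' A' A B'' B' B
  assumes u: "functor_between u A' A" "small_cat A'" and v: "functor_between v B' B" "small_cat B'"
    and u': "functor_between u' A'' A'" "small_cat A''" and v': "functor_between v' B'' B'" "small_cat B''"
begin

lemma DFib2_compositor_NC: "s \<in> Obj (DFib2 A B) \<Longrightarrow>
    NC (DFib2_compositor u v u' v') s = (span_pb u' v' (span_pb u v s), pb_cmp (prod_func u v) (prod_func u' v') (tup s),
      span_pb (comp_func u u') (comp_func v v') s)"
  by (simp add: DFib2_compositor_def case_prod_unfold functor_betweenD[OF u(1)] functor_betweenD[OF v(1)])

lemma DFib2_compositor_in:
  assumes s: "s \<in> Obj (DFib2 A B)"
  shows "(span_pb u' v' (span_pb u v s), pb_cmp (prod_func u v) (prod_func u' v') (tup s),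
      span_pb (comp_func u u') (comp_func v v') s) \<in> Arr (DFib2 A'' B'')"
proof (rule Arr_DFib2I)
  note s1 = span_pb_in_DFib2[OF u v s]
  show "span_pb u' v' (span_pb u v s) \<in> Obj (DFib2 A'' B'')"
    and "span_pb (comp_func u u') (comp_func v v') s \<in> Obj (DFib2 A'' B'')"
    using span_pb_in_DFib2[OF u' v' s1] span_pb_in_DFib2[OF comp_func_functor[OF u'(1) u(1)] u'(2) comp_func_functor[OF v'(1) v(1)] v'(2) s] by simp_all
  note e = Src_span_pb[OF u' v' s1] tup_span_pb[OF u' v' s1] tup_span_pb[OF u v s]
    Src_span_pb[OF comp_func_functor[OF u'(1) u(1)] u'(2) comp_func_functor[OF v'(1) v(1)] v'(2) s] tup_span_pb[OF comp_func_functor[OF u'(1) u(1)] u'(2) comp_func_functor[OF v'(1) v(1)] v'(2) s]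
  note W = prod_func_functor[OF u(1) v(1)] and W' = prod_func_functor[OF u'(1) v'(1)]
  show "functor_between (pb_cmp (prod_func u v) (prod_func u' v') (tup s)) (Src (fst (span_pb u' v' (span_pb u v s))))
      (Src (fst (span_pb (comp_func u u') (comp_func v v') s)))"
    using pb_cmp_functor[OF tup_functor[OF s] W W'] by (simp add: e prod_func_comp[OF u(1) v(1) u'(1) v'(1)])
  show "comp_func (tup (span_pb (comp_func u u') (comp_func v v') s)) (pb_cmp (prod_func u v) (prod_func u' v') (tup s))
      = tup (span_pb u' v' (span_pb u v s))"
    using pb_proj_cmp[OF tup_functor[OF s] W W'] by (simp add: e prod_func_comp[OF u(1) v(1) u'(1) v'(1)])
qed

lemma nat_iso_DFib2_compositor:
  "nat_iso (DFib2_compositor u v u' v') (comp_func (DFib2_act u' v') (DFib2_act u v))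
     (DFib2_act (comp_func u u') (comp_func v v'))"
proof (rule nat_isoI[OF comp_func_functor[OF DFib2_act_functor[OF u v] DFib2_act_functor[OF u' v']]
      DFib2_act_functor[OF comp_func_functor[OF u'(1) u(1)] u'(2) comp_func_functor[OF v'(1) v(1)] v'(2)]])
  note act = DFib2_act_simps[OF u v] DFib2_act_simps[OF u' v'] DFib2_act_simps[OF comp_func_functor[OF u'(1) u(1)] u'(2) comp_func_functor[OF v'(1) v(1)] v'(2)]
    functor_betweenD[OF DFib2_act_functor[OF u v]] span_pb_in_DFib2[OF u v]
  note W = prod_func_functor[OF u(1) v(1)] and W' = prod_func_functor[OF u'(1) v'(1)]
  fix s assume s: "s \<in> Obj (DFib2 A B)"
  have "iso Cat (pb_cmp (prod_func u v) (prod_func u' v') (tup s))"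
    using iso_pb_cmp[OF tup_functor[OF s] W W' Obj_DFib2_small(1)[OF s] small_cat_prod_cat[OF u(2) v(2)] small_cat_prod_cat[OF u'(2) v'(2)]] .
  then show "iso (DFib2 A'' B'') (NC (DFib2_compositor u v u' v') s)"
    using iso_DFib2[of "pb_cmp (prod_func u v) (prod_func u' v') (tup s)" "fst (span_pb u' v' (span_pb u v s))"
        "snd (span_pb u' v' (span_pb u v s))" "fst (span_pb (comp_func u u') (comp_func v v') s)"
        "snd (span_pb (comp_func u u') (comp_func v v') s)" A'' B''] DFib2_compositor_in[OF s]
    by (simp add: DFib2_compositor_NC s)
  show "Dom (DFib2 A'' B'') (NC (DFib2_compositor u v u' v') s) = FO (comp_func (DFib2_act u' v') (DFib2_act u v)) s"
    "Cod (DFib2 A'' B'') (NC (DFib2_compositor u v u' v') s) = FO (DFib2_act (comp_func u u') (comp_func v v')) s"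
    using s act by (simp_all add: DFib2_compositor_NC functor_betweenD[OF u(1)] functor_betweenD[OF v(1)])
next
  note act = DFib2_act_simps[OF u v] DFib2_act_simps[OF u' v'] DFib2_act_simps[OF comp_func_functor[OF u'(1) u(1)] u'(2) comp_func_functor[OF v'(1) v(1)] v'(2)]
    pb_map_in_DFib2[OF u v] tup_span_pb[OF u v]
  note W = prod_func_functor[OF u(1) v(1)] and W' = prod_func_functor[OF u'(1) v'(1)]
  fix f assume f: "f \<in> Arr (DFib2 A B)"
  obtain s h t where f': "f = (s, h, t)" by (cases f) auto
  note h = Arr_DFib2_tupD[OF f[unfolded f']]
  show "Comp (DFib2 A'' B'') (NC (DFib2_compositor u v u' v') (Cod (DFib2 A B) f)) (FA (comp_func (DFib2_act u' v') (DFib2_act u v)) f)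
    = Comp (DFib2 A'' B'') (FA (DFib2_act (comp_func u u') (comp_func v v')) f)
       (NC (DFib2_compositor u v u' v') (Dom (DFib2 A B) f))"
    using pb_cmp_natural[OF tup_functor[OF h(2)] h(3,4) W W'] f h
    by (simp add: f' act DFib2_compositor_NC prod_func_comp[OF u(1) v(1) u'(1) v'(1)] functor_betweenD[OF u(1)] functor_betweenD[OF v(1)])
qed (simp_all add: DFib2_compositor_def functor_betweenD[OF u(1)] functor_betweenD[OF v(1)])

end

lemma DFib_span_simps [simp]:
  "fib DFib_span (A, B) = DFib2 A B" "act DFib_span (u, v) = DFib2_act u v"
  "unitor DFib_span (A, B) = DFib2_unitor A B" "compositor DFib_span (u, v) (u', v') = DFib2_compositor u v u' v'"
  by (simp_all add: DFib_span_def)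

text \<open>After \<open>tup_span_pb\<close> and \<open>prod_func_comp\<close> the three coherence
  laws are again \<open>pb_cmp_proj_unit\<close>, \<open>pb_cmp_map_unit\<close> and
  \<open>pb_cmp_assoc\<close>, now for \<open>tup s\<close> pulled back along products of
  functors.\<close>

lemma pseudofunctor_DFib_span:
  "pseudofunctor (times_cat Cat Cat)
     (DFib_span :: (('u::universe) scat \<times> 'u scat, 'u sfunc \<times> 'u sfunc,
          'u span, 'u span \<times> 'u sfunc \<times> 'u span) psf)"
proof (rule pseudofunctorI)
  fix w :: "'u sfunc \<times> 'u sfunc" assume w: "w \<in> Arr (times_cat Cat Cat)"
  obtain u v where uv: "w = (u, v)" by (cases w)
  have u: "functor_between u (Src u) (Tgt u)" "small_cat (Src u)" "small_cat (Tgt u)"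
    and v: "functor_between v (Src v) (Tgt v)" "small_cat (Src v)" "small_cat (Tgt v)"
    using w uv Arr_CatD[of u] Arr_CatD[of v] by auto
  show "functor_between (act DFib_span w) (fib DFib_span (Cod (times_cat Cat Cat) w)) (fib DFib_span (Dom (times_cat Cat Cat) w))"
    using DFib2_act_functor[OF u(1,2) v(1,2)] by (simp add: uv)
  note W = prod_func_functor[OF u(1) v(1)]
  fix s assume "s \<in> Obj (fib DFib_span (Cod (times_cat Cat Cat) w))"
  then have s: "s \<in> Obj (DFib2 (Tgt u) (Tgt v))" by (simp add: uv)
  note s1 = span_pb_in_DFib2[OF u(1,2) v(1,2) s]
  note act = DFib2_act_simps[OF u(1,2) v(1,2)] tup_span_pb[OF u(1,2) v(1,2) s] Src_span_pb[OF u(1,2) v(1,2) s]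
  have id: "functor_between (id_func (Src u)) (Src u) (Src u)" "functor_between (id_func (Src v)) (Src v) (Src v)"
    "functor_between (id_func (Tgt u)) (Tgt u) (Tgt u)" "functor_between (id_func (Tgt v)) (Tgt v) (Tgt v)"
    using u v small_catD(1) by blast+
  show "Comp (fib DFib_span (Dom (times_cat Cat Cat) w))
        (NC (compositor DFib_span w (Ident (times_cat Cat Cat) (Dom (times_cat Cat Cat) w))) s)
        (NC (unitor DFib_span (Dom (times_cat Cat Cat) w)) (FO (act DFib_span w) s)) =
      Ident (fib DFib_span (Dom (times_cat Cat Cat) w)) (FO (act DFib_span w) s)"
    using s s1 pb_cmp_proj_unit[OF tup_functor[OF s] W]
    by (simp add: uv act DFib2_unitor_NC[OF u(2) v(2)] prod_func_id_small[OF u(2) v(2)]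
        DFib2_compositor_NC[OF u(1,2) v(1,2) id(1) u(2) id(2) v(2) s] comp_func_id_right[OF u(1)] comp_func_id_right[OF v(1)])
  show "Comp (fib DFib_span (Dom (times_cat Cat Cat) w))
        (NC (compositor DFib_span (Ident (times_cat Cat Cat) (Cod (times_cat Cat Cat) w)) w) s)
        (FA (act DFib_span w) (NC (unitor DFib_span (Cod (times_cat Cat Cat) w)) s)) =
      Ident (fib DFib_span (Dom (times_cat Cat Cat) w)) (FO (act DFib_span w) s)"
    using s s1 pb_cmp_map_unit[OF tup_functor[OF s] W] DFib2_unitor_in[OF u(3) v(3) s]
    by (simp add: uv act DFib2_unitor_NC[OF u(3) v(3)] prod_func_id_small[OF u(3) v(3)] tup_span_pb[OF id(3) u(3) id(4) v(3) s]
        DFib2_compositor_NC[OF id(3) u(3) id(4) v(3) u(1,2) v(1,2) s] comp_func_id_left[OF u(1)] comp_func_id_left[OF v(1)])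
  fix w1 w2 :: "'u sfunc \<times> 'u sfunc" assume w12: "w1 \<in> Arr (times_cat Cat Cat)" "w2 \<in> Arr (times_cat Cat Cat)"
    "Cod (times_cat Cat Cat) w1 = Dom (times_cat Cat Cat) w" "Cod (times_cat Cat Cat) w2 = Dom (times_cat Cat Cat) w1"
  obtain u1 v1 u2 v2 where uv12: "w1 = (u1, v1)" "w2 = (u2, v2)" by (cases w1; cases w2)
  have u1: "functor_between u1 (Src u1) (Src u)" "small_cat (Src u1)"
    and v1: "functor_between v1 (Src v1) (Src v)" "small_cat (Src v1)"
    and u2: "functor_between u2 (Src u2) (Src u1)" "small_cat (Src u2)"
    and v2: "functor_between v2 (Src v2) (Src v1)" "small_cat (Src v2)"
    using w12 uv uv12 Arr_CatD[of u1] Arr_CatD[of v1] Arr_CatD[of u2] Arr_CatD[of v2] by auto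
  note uu1 = comp_func_functor[OF u1(1) u(1)] and vv1 = comp_func_functor[OF v1(1) v(1)]
  note u12 = comp_func_functor[OF u2(1) u1(1)] and v12 = comp_func_functor[OF v2(1) v1(1)]
  note W1 = prod_func_functor[OF u1(1) v1(1)] and W2 = prod_func_functor[OF u2(1) v2(1)]
  show "Comp (fib DFib_span (Dom (times_cat Cat Cat) w2)) (NC (compositor DFib_span (Comp (times_cat Cat Cat) w w1) w2) s)
        (FA (act DFib_span w2) (NC (compositor DFib_span w w1) s)) =
      Comp (fib DFib_span (Dom (times_cat Cat Cat) w2)) (NC (compositor DFib_span w (Comp (times_cat Cat Cat) w1 w2)) s)
        (NC (compositor DFib_span w1 w2) (FO (act DFib_span w) s))"
    using s s1 pb_cmp_assoc[OF tup_functor[OF s] W W1 W2] DFib2_compositor_in[OF u(1,2) v(1,2) u1 v1 s]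
    by (simp add: uv uv12 act DFib2_compositor_NC[OF uu1 u1(2) vv1 v1(2) u2 v2 s] DFib2_compositor_NC[OF u(1,2) v(1,2) u1 v1 s]
        DFib2_compositor_NC[OF u(1,2) v(1,2) u12 u2(2) v12 v2(2) s] DFib2_compositor_NC[OF u1 v1 u2 v2 s1]
        DFib2_act_simps[OF u2 v2] tup_span_pb[OF u1 v1 s1] tup_span_pb[OF uu1 u1(2) vv1 v1(2) s]
        prod_func_comp[OF u(1) v(1) u1(1) v1(1)] prod_func_comp[OF u1(1) v1(1) u2(1) v2(1)]
        comp_func_assoc[OF u2(1) u1(1) u(1)] comp_func_assoc[OF v2(1) v1(1) v(1)])
next
  fix w w1 :: "'u sfunc \<times> 'u sfunc" assume w12: "w \<in> Arr (times_cat Cat Cat)" "w1 \<in> Arr (times_cat Cat Cat)"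
    "Cod (times_cat Cat Cat) w1 = Dom (times_cat Cat Cat) w"
  obtain u v u1 v1 where uv: "w = (u, v)" "w1 = (u1, v1)" by (cases w; cases w1)
  have "functor_between u (Src u) (Tgt u)" "small_cat (Src u)"
    "functor_between v (Src v) (Tgt v)" "small_cat (Src v)"
    "functor_between u1 (Src u1) (Src u)" "small_cat (Src u1)"
    "functor_between v1 (Src v1) (Src v)" "small_cat (Src v1)"
    using w12 uv Arr_CatD[of u] Arr_CatD[of v] Arr_CatD[of u1] Arr_CatD[of v1] by auto
  from nat_iso_DFib2_compositor[OF this]
  show "nat_iso (compositor DFib_span w w1) (comp_func (act DFib_span w1) (act DFib_span w))
      (act DFib_span (Comp (times_cat Cat Cat) w w1))" by (simp add: uv)
qed (auto simp: category_times_cat category_Cat category_DFib2 nat_iso_DFib2_unitor)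

subsection \<open>The fibres of a two-sided discrete fibration\<close>

text \<open>Functors over \<open>(u, v)\<close> preserve lifts; the cases of interest are maps of spans, where \<open>u\<close> and \<open>v\<close>
  are identities, and the projection from the pullback of a span along \<open>(u, v)\<close>.\<close>

context
  fixes q p q' p' u v m :: "('u::universe) sfunc" and E A B E' A' B'
  assumes q: "functor_between q E A" and p: "functor_between p E B" and two: "two_sided_discrete_fibration q p"
    and q': "functor_between q' E' A'" and p': "functor_between p' E' B'" and two': "two_sided_discrete_fibration q' p'"
    and u: "functor_between u A' A" and v: "functor_between v B' B" and m: "functor_between m E' E"
    and over: "comp_func q m = comp_func u q'" "comp_func p m = comp_func v p'"
begin

lemma over_lift_simps:
  "e \<in> Obj E' \<Longrightarrow> FO q (FO m e) = FO u (FO q' e)" "e \<in> Obj E' \<Longrightarrow> FO p (FO m e) = FO v (FO p' e)"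
  "k \<in> Arr E' \<Longrightarrow> FA q (FA m k) = FA u (FA q' k)" "k \<in> Arr E' \<Longrightarrow> FA p (FA m k) = FA v (FA p' k)"
proof -
  have "FO (comp_func q m) e = FO (comp_func u q') e" "FO (comp_func p m) e = FO (comp_func v p') e"
    "FA (comp_func q m) k = FA (comp_func u q') k" "FA (comp_func p m) k = FA (comp_func v p') k" for e k
    using over by simp_all
  then show "e \<in> Obj E' \<Longrightarrow> FO q (FO m e) = FO u (FO q' e)" "e \<in> Obj E' \<Longrightarrow> FO p (FO m e) = FO v (FO p' e)"
    "k \<in> Arr E' \<Longrightarrow> FA q (FA m k) = FA u (FA q' k)" "k \<in> Arr E' \<Longrightarrow> FA p (FA m k) = FA v (FA p' k)"
    using comp_func_simps(3,4)[of _ m] comp_func_simps(3,4)[of _ q'] comp_func_simps(3,4)[of _ p']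
    by (metis functor_betweenD(2) m q' p')+
qed

text \<open>The image under \<open>m\<close> of a left lift is sent by \<open>p\<close> to an
  identity, so it is a left lift by \<open>llift_eq\<close>; its codomain is the asserted
  object.\<close>

lemma map_push:
  assumes e: "e \<in> Obj E'" and f: "f \<in> Arr A'" "Dom A' f = FO q' e"
  shows "FO m (Cod E' (llift q' p' f e)) = Cod E (llift q p (FA u f) (FO m e))"
proof -
  note L = llift[OF q' p' two' e f]
  have "llift q p (FA q (FA m (llift q' p' f e))) (Dom E (FA m (llift q' p' f e))) = FA m (llift q' p' f e)"
    by (rule llift_eq[OF q p two]) (use L e in \<open>simp_all add: functor_simps[OF m] over_lift_simps functor_simps[OF v] functor_simps[OF p']\<close>)
  then show ?thesis using L by (simp add: functor_simps[OF m] over_lift_simps)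
qed

lemma map_pull:
  assumes e: "e \<in> Obj E'" and f: "f \<in> Arr B'" "Cod B' f = FO p' e"
  shows "FO m (Dom E' (rlift q' p' f e)) = Dom E (rlift q p (FA v f) (FO m e))"
proof -
  note L = rlift[OF q' p' two' e f]
  have "rlift q p (FA p (FA m (rlift q' p' f e))) (Cod E (FA m (rlift q' p' f e))) = FA m (rlift q' p' f e)"
    by (rule rlift_eq[OF q p two]) (use L e in \<open>simp_all add: functor_simps[OF m] over_lift_simps functor_simps[OF u] functor_simps[OF q']\<close>)
  then show ?thesis using L by (simp add: functor_simps[OF m] over_lift_simps)
qed

end

text \<open>An element is pushed forward first and pulled back afterwards. The choice of order does
  not matter, by \<open>push_pull\<close>, and functoriality rests on that.\<close>

definition fib2 :: "('u::universe) span \<Rightarrow> 'u copsh" where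
  "fib2 = (\<lambda>(q, p). mk_copsh (prod_cat (op_cat (Tgt p)) (Tgt q))
     (\<lambda>z. {e \<in> Obj (Src q). FO p e = p1 z \<and> FO q e = p2 z})
     (\<lambda>k e. Dom (Src q) (rlift q p (p1 k) (Cod (Src q) (llift q p (p2 k) e)))))"

context
  fixes q p :: "('u::universe) sfunc" and E A B
  assumes q: "functor_between q E A" and p: "functor_between p E B" and two: "two_sided_discrete_fibration q p"
begin

lemma fib2_simps:
  "b \<in> Obj B \<Longrightarrow> a \<in> Obj A \<Longrightarrow> FO (fib2 (q, p)) (pair b a) = {e \<in> Obj E. FO p e = b \<and> FO q e = a}"
  "g \<in> Arr B \<Longrightarrow> f \<in> Arr A \<Longrightarrow> e \<in> Obj E \<Longrightarrow> FO p e = Cod B g \<Longrightarrow> FO q e = Dom A f \<Longrightarrow>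
    ap (FA (fib2 (q, p)) (pair g f)) e = Dom E (rlift q p g (Cod E (llift q p f e)))"
  by (simp_all add: fib2_def legs_simps[OF q p])

lemma fib2_functor:
  assumes E: "small_cat E" shows "functor_between (fib2 (q, p)) (prod_cat (op_cat B) A) Set"
proof -
  note s = legs_simps[OF q p]
  have "functor_between (mk_copsh (prod_cat (op_cat B) A) (\<lambda>z. {e \<in> Obj E. FO p e = p1 z \<and> FO q e = p2 z})
     (\<lambda>k e. Dom E (rlift q p (p1 k) (Cod E (llift q p (p2 k) e))))) (prod_cat (op_cat B) A) Set"
  proof (rule mk_copsh_functor)
    show "category (prod_cat (op_cat B) A)" by (simp add: category_prod_cat s)
    show "small {e \<in> Obj E. FO p e = p1 z \<and> FO q e = p2 z}" for z
      by (rule small_subset[OF small_catD(2)[OF E]]) auto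
  next
    fix k e assume "k \<in> Arr (prod_cat (op_cat B) A)"
      "e \<in> {e \<in> Obj E. FO p e = p1 (Dom (prod_cat (op_cat B) A) k) \<and> FO q e = p2 (Dom (prod_cat (op_cat B) A) k)}"
    then obtain g f where "k = pair g f" "g \<in> Arr B" "f \<in> Arr A" "e \<in> Obj E" "FO p e = Cod B g" "FO q e = Dom A f"
      by auto
    then show "Dom E (rlift q p (p1 k) (Cod E (llift q p (p2 k) e))) \<in>
        {e \<in> Obj E. FO p e = p1 (Cod (prod_cat (op_cat B) A) k) \<and> FO q e = p2 (Cod (prod_cat (op_cat B) A) k)}"
      using llift[OF q p two, of e f] rlift[OF q p two, of "Cod E (llift q p f e)" g] by (simp add: s)
  next
    fix z e assume "z \<in> Obj (prod_cat (op_cat B) A)" "e \<in> {e \<in> Obj E. FO p e = p1 z \<and> FO q e = p2 z}"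
    then obtain b a where "z = pair b a" "e \<in> Obj E" "b = FO p e" "a = FO q e" by auto
    then show "Dom E (rlift q p (p1 (Ident (prod_cat (op_cat B) A) z)) (Cod E (llift q p (p2 (Ident (prod_cat (op_cat B) A) z)) e))) = e"
      using push_Ident[OF q p two, of e] pull_Ident[OF q p two, of e] by simp
  next
    fix k k' e assume "k \<in> Arr (prod_cat (op_cat B) A)" "k' \<in> Arr (prod_cat (op_cat B) A)"
      "Cod (prod_cat (op_cat B) A) k = Dom (prod_cat (op_cat B) A) k'"
      "e \<in> {e \<in> Obj E. FO p e = p1 (Dom (prod_cat (op_cat B) A) k) \<and> FO q e = p2 (Dom (prod_cat (op_cat B) A) k)}"
    then obtain g f g' f' where k: "k = pair g f" "k' = pair g' f'" "g \<in> Arr B" "f \<in> Arr A" "g' \<in> Arr B" "f' \<in> Arr A"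
      and c: "Cod B g' = Dom B g" "Dom A f' = Cod A f" and e: "e \<in> Obj E" "FO p e = Cod B g" "FO q e = Dom A f"
      by auto
    let ?e = "Cod E (llift q p f e)"
    have e1: "?e \<in> Obj E" "FO p ?e = Cod B g" "FO q ?e = Cod A f" using llift[OF q p two, of e f] k e by (simp_all add: s)
    have "Dom E (rlift q p (Comp B g g') (Cod E (llift q p (Comp A f' f) e))) =
        Dom E (rlift q p (Comp B g g') (Cod E (llift q p f' ?e)))"
      using push_Comp[OF q p two, of e f f'] k c e by simp
    also have "\<dots> = Dom E (rlift q p g' (Dom E (rlift q p g (Cod E (llift q p f' ?e)))))"
      using llift[OF q p two, of ?e f'] k c e1 by (intro pull_Comp[OF q p two]) (simp_all add: s)
    \<comment> \<open>The one place where the two actions must be interchanged: the pull along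
      \<open>g\<close> has to precede the push along \<open>f'\<close> for the composite to split
      into the actions of \<open>k\<close> and \<open>k'\<close>.\<close>
    also have "\<dots> = Dom E (rlift q p g' (Cod E (llift q p f' (Dom E (rlift q p g ?e)))))"
      using push_pull[OF q p two, of ?e f' g] k c e1 by simp
    finally show "Dom E (rlift q p (p1 (Comp (prod_cat (op_cat B) A) k' k)) (Cod E (llift q p (p2 (Comp (prod_cat (op_cat B) A) k' k)) e)))
      = Dom E (rlift q p (p1 k') (Cod E (llift q p (p2 k') (Dom E (rlift q p (p1 k) (Cod E (llift q p (p2 k) e)))))))"
      by (simp add: k)
  qed
  then show ?thesis by (simp add: fib2_def s)
qed

text \<open>Pulling back along an identity changes nothing. This and \<open>fib2_pull\<close>
  isolate the two actions, so that \<open>Fib_full\<close> can use naturality in one variable at a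
  time.\<close>

lemma fib2_push: "f \<in> Arr A \<Longrightarrow> e \<in> Obj E \<Longrightarrow> FO q e = Dom A f \<Longrightarrow>
    ap (FA (fib2 (q, p)) (pair (Ident B (FO p e)) f)) e = Cod E (llift q p f e)"
  using llift[OF q p two, of e f] pull_Ident[OF q p two, of "Cod E (llift q p f e)"] fib2_simps(2)
  by (simp add: legs_simps[OF q p])

lemma fib2_pull: "g \<in> Arr B \<Longrightarrow> e \<in> Obj E \<Longrightarrow> FO p e = Cod B g \<Longrightarrow>
    ap (FA (fib2 (q, p)) (pair g (Ident A (FO q e)))) e = Dom E (rlift q p g e)"
  using push_Ident[OF q p two, of e] fib2_simps(2) by (simp add: legs_simps[OF q p])

end

lemma fib2_functor_DFib2:
  "s \<in> Obj (DFib2 A B) \<Longrightarrow> functor_between (fib2 s) (prod_cat (op_cat B) A) Set"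
  using fib2_functor[OF Obj_DFib2D(1,2,6,3)[of "fst s" "snd s" A B]] by simp

lemma fib2_FO:
  "s \<in> Obj (DFib2 A B) \<Longrightarrow> b \<in> Obj B \<Longrightarrow> a \<in> Obj A \<Longrightarrow>
    FO (fib2 s) (pair b a) = {e \<in> Obj (Src (fst s)). FO (snd s) e = b \<and> FO (fst s) e = a}"
  using fib2_simps(1)[OF Obj_DFib2D(1,2,6)[of "fst s" "snd s" A B]] by simp

definition fib2_map :: "('u::universe) span \<times> 'u sfunc \<times> 'u span \<Rightarrow> 'u copsh_nt" where
  "fib2_map = (\<lambda>(s, h, t). mk_copsh_nt (fib2 s) (fib2 t) (\<lambda>_. FO h))"

lemma fib2_map_simps [simp]: "NSrc (fib2_map (s, h, t)) = fib2 s" "NTgt (fib2_map (s, h, t)) = fib2 t"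
  by (simp_all add: fib2_map_def)

lemma fib2_map_ap:
  assumes "s \<in> Obj (DFib2 A B)" "z \<in> Obj (prod_cat (op_cat B) A)" "e \<in> FO (fib2 s) z"
  shows "ap (NC (fib2_map (s, h, t)) z) e = FO h e"
  using assms functor_betweenD(2)[OF fib2_functor_DFib2[OF assms(1)]] by (simp add: fib2_map_def)

lemma fib2_map_nt:
  assumes "(s, h, t) \<in> Arr (DFib2 A B)"
  shows "is_nt (fib2_map (s, h, t))"
proof -
  obtain q p q' p' where st: "s = (q, p)" "t = (q', p')" by (cases s; cases t)
  note H = Arr_DFib2D[OF assms[unfolded st]]
  note D = Obj_DFib2D[OF H(1)] and D' = Obj_DFib2D[OF H(2)]
  note s = functor_betweenD(3-5)[OF D(1)] functor_betweenD(3-5)[OF D(2)] functor_simps[OF D(1)] functor_simps[OF D(2)]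
    functor_simps[OF H(3)]
  note push = map_push[OF D'(1,2,6) D(1,2,6) id_func_functor id_func_functor H(3)]
    and pull = map_pull[OF D'(1,2,6) D(1,2,6) id_func_functor id_func_functor H(3)]
    and over = over_lift_simps[OF D'(1,2,6) D(1,2,6) id_func_functor id_func_functor H(3)]
  \<comment> \<open>A map of spans is a functor over the pair of identities; this is the form in
    which \<open>map_push\<close> and \<open>map_pull\<close> accept it.\<close>
  have idc: "comp_func q' h = comp_func (id_func A) q" "comp_func p' h = comp_func (id_func B) p"
    using H comp_func_id_left[OF D(1)] comp_func_id_left[OF D(2)] by simp_all
  note cats = functor_betweenD(5)[OF D(1)] functor_betweenD(5)[OF D(2)]
  show ?thesis
    unfolding fib2_map_def prod.case st
  proof (rule is_nt_mk_copsh_nt[OF fib2_functor[OF D(1,2,6,3)] fib2_functor[OF D'(1,2,6,3)]])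
    fix z e assume "z \<in> Obj (prod_cat (op_cat B) A)" and e: "e \<in> FO (fib2 (q, p)) z"
    then obtain b a where z: "z = pair b a" "b \<in> Obj B" "a \<in> Obj A" by auto
    then have "e \<in> Obj (Src q)" "FO p e = b" "FO q e = a" using e fib2_simps(1)[OF D(1,2,6)] by simp_all
    then show "FO h e \<in> FO (fib2 (q', p')) z"
      using over(1,2)[OF cats idc] fib2_simps(1)[OF D'(1,2,6)] z FO_in_Obj[OF H(3)] by simp
  next
    fix k e assume "k \<in> Arr (prod_cat (op_cat B) A)" "e \<in> FO (fib2 (q, p)) (Dom (prod_cat (op_cat B) A) k)"
    then obtain g f where k: "k = pair g f" "g \<in> Arr B" "f \<in> Arr A" and "e \<in> FO (fib2 (q, p)) (pair (Cod B g) (Dom A f))"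
      by auto
    then have e: "e \<in> Obj (Src q)" "FO p e = Cod B g" "FO q e = Dom A f"
      using fib2_simps(1)[OF D(1,2,6)] by (simp_all add: cats)
    let ?e = "Cod (Src q) (llift q p f e)"
    have e1: "?e \<in> Obj (Src q)" "FO p ?e = Cod B g" using llift[OF D(1,2,6), of e f] k e by (simp_all add: s)
    show "FO h (ap (FA (fib2 (q, p)) k) e) = ap (FA (fib2 (q', p')) k) (FO h e)"
    proof -
      have he: "FO h e \<in> Obj (Src q')" "FO p' (FO h e) = Cod B g" "FO q' (FO h e) = Dom A f"
        using over(1,2)[OF cats idc e(1)] e k FO_in_Obj[OF H(3) e(1)] by (simp_all add: cats)
      have "FO h (ap (FA (fib2 (q, p)) k) e) = FO h (Dom (Src q) (rlift q p g ?e))"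
        using fib2_simps(2)[OF D(1,2,6) k(2,3) e] k(1) by simp
      also have "\<dots> = Dom (Src q') (rlift q' p' g (FO h ?e))"
        using pull[OF cats idc e1(1) k(2)] e1(2) k(2) by simp
      also have "FO h ?e = Cod (Src q') (llift q' p' f (FO h e))"
        using push[OF cats idc e(1) k(3)] e(3) k(3) by simp
      also have "Dom (Src q') (rlift q' p' g (Cod (Src q') (llift q' p' f (FO h e)))) = ap (FA (fib2 (q', p')) k) (FO h e)"
        using fib2_simps(2)[OF D'(1,2,6) k(2,3) he] k(1) by simp
      finally show ?thesis .
    qed
  qed
qed

section \<open>The fibre functor, full and faithful\<close>

definition Fib :: "('u::universe) scat \<Rightarrow> 'u scat \<Rightarrow>
    ('u span, 'u span \<times> 'u sfunc \<times> 'u span, 'u copsh, 'u copsh_nt) func" where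
  "Fib A B = mk_func (DFib2 A B) (func_cat (prod_cat (op_cat B) A) Set) fib2 fib2_map"

lemma Fib_simps [simp]:
  "Src (Fib A B) = DFib2 A B" "Tgt (Fib A B) = func_cat (prod_cat (op_cat B) A) Set"
  "s \<in> Obj (DFib2 A B) \<Longrightarrow> FO (Fib A B) s = fib2 s"
  "h \<in> Arr (DFib2 A B) \<Longrightarrow> FA (Fib A B) h = fib2_map h"
  by (simp_all add: Fib_def)

lemma fib2_map_in:
  assumes "(s, h, t) \<in> Arr (DFib2 A B)" shows "fib2_map (s, h, t) \<in> Arr (func_cat (prod_cat (op_cat B) A) Set)"
  using fib2_map_nt[OF assms] fib2_functor_DFib2[OF Arr_DFib2_tupD(1)[OF assms]] by simp

lemma Fib_functor:
  assumes A: "small_cat A" and B: "small_cat B"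
  shows "functor_between (Fib A B) (DFib2 A B) (func_cat (prod_cat (op_cat B) A) Set)"
  unfolding Fib_def
proof (rule mk_func_functor[OF category_DFib2])
  show cat: "category (func_cat (prod_cat (op_cat B) A) Set)"
    using A B by (intro category_func_cat category_prod_cat category_Set) (simp_all add: small_catD)
  fix h assume h: "h \<in> Arr (DFib2 A B)"
  then show "fib2_map h \<in> Arr (func_cat (prod_cat (op_cat B) A) Set)"
    using fib2_map_in[of "fst h" "fst (snd h)" "snd (snd h)" A B] by (simp del: func_cat_simps)
  show "Dom (func_cat (prod_cat (op_cat B) A) Set) (fib2_map h) = fib2 (Dom (DFib2 A B) h)"
    "Cod (func_cat (prod_cat (op_cat B) A) Set) (fib2_map h) = fib2 (Cod (DFib2 A B) h)"
    by (cases h, simp)+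
next
  fix s assume s: "s \<in> Obj (DFib2 A B)"
  have i: "(s, id_func (Src (fst s)), s) \<in> Arr (DFib2 A B)"
    using Ident_in_Arr[OF category_DFib2 s] by simp
  note X = fib2_functor_DFib2[OF s]
  show "fib2_map (Ident (DFib2 A B) s) = Ident (func_cat (prod_cat (op_cat B) A) Set) (fib2 s)"
  proof (rule copsh_nt_eqI[of _ "prod_cat (op_cat B) A"])
    fix z e assume z: "z \<in> Obj (prod_cat (op_cat B) A)" and "e \<in> FO (NSrc (fib2_map (Ident (DFib2 A B) s))) z"
    then have e: "e \<in> FO (fib2 s) z" by simp
    then have "e \<in> Obj (Src (fst s))" using z fib2_FO[OF s] by auto
    then show "ap (NC (fib2_map (Ident (DFib2 A B) s)) z) e = ap (NC (Ident (func_cat (prod_cat (op_cat B) A) Set) (fib2 s)) z) e"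
      using fib2_map_ap[OF s z e] copsh_Ident_ap[OF X z e] by (simp del: func_cat_simps)
  qed (use fib2_map_nt[OF i] X nt_Ident[OF X] in \<open>simp_all\<close>)
next
  fix f g assume fg: "f \<in> Arr (DFib2 A B)" "g \<in> Arr (DFib2 A B)" "Cod (DFib2 A B) f = Dom (DFib2 A B) g"
  obtain s h t h' t' where fg': "f = (s, h, t)" "g = (t, h', t')"
    using fg(3) by (cases f; cases g) auto
  note h = fg(1)[unfolded fg'] and h' = fg(2)[unfolded fg']
  note s = Arr_DFib2_tupD[OF h] and s' = Arr_DFib2_tupD[OF h']
  note X = fib2_functor_DFib2[OF s(1)]
  have gf: "(s, comp_func h' h, t') \<in> Arr (DFib2 A B)"
    using Comp_in_Arr[OF category_DFib2 fg] by (simp add: fg')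
  show "fib2_map (Comp (DFib2 A B) g f) = Comp (func_cat (prod_cat (op_cat B) A) Set) (fib2_map g) (fib2_map f)"
    unfolding fg'
  proof (rule copsh_nt_eqI[of _ "prod_cat (op_cat B) A"])
    fix z e assume z: "z \<in> Obj (prod_cat (op_cat B) A)" and "e \<in> FO (NSrc (fib2_map (Comp (DFib2 A B) (t, h', t') (s, h, t)))) z"
    then have e: "e \<in> FO (fib2 s) z" by simp
    then have eO: "e \<in> Obj (Src (fst s))" using z fib2_FO[OF s(1)] by auto
    have "ap (NC (fib2_map (s, h, t)) z) e \<in> FO (fib2 t) z"
      using NC_in[OF fib2_map_nt[OF h] _ z, of e] X e by simp
    then have he: "FO h e \<in> FO (fib2 t) z" using fib2_map_ap[OF s(1) z e] by simp
    have "ap (NC (Comp (func_cat (prod_cat (op_cat B) A) Set) (fib2_map (t, h', t')) (fib2_map (s, h, t))) z) e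
        = ap (NC (fib2_map (t, h', t')) z) (ap (NC (fib2_map (s, h, t)) z) e)"
      by (rule copsh_Comp_ap[OF fib2_map_nt[OF h] _ fib2_map_nt[OF h'] _ z]) (use X e in simp_all)
    also have "\<dots> = FO h' (FO h e)"
      using fib2_map_ap[OF s(1) z e] fib2_map_ap[OF s'(1) z he] by simp
    also have "\<dots> = ap (NC (fib2_map (Comp (DFib2 A B) (t, h', t') (s, h, t))) z) e"
      using fib2_map_ap[OF s(1) z e] eO functor_betweenD(2)[OF s(3)] by simp
    finally show "ap (NC (fib2_map (Comp (DFib2 A B) (t, h', t') (s, h, t))) z) e =
        ap (NC (Comp (func_cat (prod_cat (op_cat B) A) Set) (fib2_map (t, h', t')) (fib2_map (s, h, t))) z) e" by simp
  next
    show "is_nt (Comp (func_cat (prod_cat (op_cat B) A) Set) (fib2_map (t, h', t')) (fib2_map (s, h, t)))"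
      using nt_Comp[OF fib2_map_nt[OF h] _ fib2_map_nt[OF h'], of "prod_cat (op_cat B) A" Set] X by simp
  qed (use fib2_map_nt[OF gf] X in simp_all)
qed (use fib2_functor_DFib2 in simp)

text \<open>Each object lies in the fibre over its own images, so equal components give equal maps
  on objects; on arrows \<open>two_sided_arr_eqI\<close> finishes, since both maps commute with the
  legs.\<close>

lemma Fib_faithful:
  assumes h: "(s, h, t) \<in> Arr (DFib2 A B)" and h': "(s, h', t) \<in> Arr (DFib2 A B)"
    and eq: "fib2_map (s, h, t) = fib2_map (s, h', t)"
  shows "h = h'"
proof -
  obtain q p q' p' where st: "s = (q, p)" "t = (q', p')" by (cases s; cases t)
  note H = Arr_DFib2D[OF h[unfolded st]] and H' = Arr_DFib2D[OF h'[unfolded st]]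
  note D = Obj_DFib2D[OF H(1)] and D' = Obj_DFib2D[OF H(2)]
  note s = functor_betweenD(3-5)[OF D(1)] functor_betweenD(3-5)[OF D(2)] functor_simps[OF D(1)] functor_simps[OF D(2)]
  have O: "FO h e = FO h' e" if e: "e \<in> Obj (Src q)" for e
  proof -
    let ?z = "pair (FO p e) (FO q e)"
    have z: "?z \<in> Obj (prod_cat (op_cat B) A)" and e: "e \<in> FO (fib2 s) ?z"
      using e fib2_simps(1)[OF D(1,2,6)] by (simp_all add: s st)
    show ?thesis
      using fib2_map_ap[OF H(1)[folded st] z e, of h t] fib2_map_ap[OF H(1)[folded st] z e, of h' t] eq by simp
  qed
  have A: "FA h k = FA h' k" if k: "k \<in> Arr (Src q)" for k
  proof (rule two_sided_arr_eqI[OF D'(1,2,6)])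
    have "FA (comp_func q' h) k = FA (comp_func q' h') k" "FA (comp_func p' h) k = FA (comp_func p' h') k"
      using H(4,5) H'(4,5) by simp_all
    then show "FA q' (FA h k) = FA q' (FA h' k)" "FA p' (FA h k) = FA p' (FA h' k)"
      using k functor_betweenD(2)[OF H(3)] functor_betweenD(2)[OF H'(3)] by simp_all
  qed (use k in \<open>simp_all add: functor_simps[OF H(3)] functor_simps[OF H'(3)] O s\<close>)
  show ?thesis by (rule func_eqI[OF H(3) H'(3) O A])
qed

lemma Fib_full:
  assumes s: "s \<in> Obj (DFib2 A B)" and t: "t \<in> Obj (DFib2 A B)" and \<alpha>: "is_nt \<alpha>" "NSrc \<alpha> = fib2 s" "NTgt \<alpha> = fib2 t"
  shows "\<exists>h. (s, h, t) \<in> Arr (DFib2 A B) \<and> fib2_map (s, h, t) = \<alpha>"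
proof -
  obtain q p q' p' where st: "s = (q, p)" "t = (q', p')" by (cases s; cases t)
  note D = Obj_DFib2D[OF s[unfolded st]] and D' = Obj_DFib2D[OF t[unfolded st]]
  let ?E = "Src q" and ?E' = "Src q'"
  note X = fib2_functor_DFib2[OF s]
  note S = functor_betweenD(3-5)[OF D(1)] functor_betweenD(3-5)[OF D(2)] functor_simps[OF D(1)] functor_simps[OF D(2)]
    functor_betweenD(3-5)[OF D'(1)] functor_betweenD(3-5)[OF D'(2)] functor_simps[OF D'(1)] functor_simps[OF D'(2)]
  \<comment> \<open>The component of \<open>\<alpha>\<close> at the fibre to which \<open>e\<close>
    belongs.\<close>
  define h0 where "h0 e = ap (NC \<alpha> (pair (FO p e) (FO q e))) e" for e
  \<comment> \<open>The only possible value: a map of spans preserves lifts, hence sends the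
    factorization of \<open>k\<close> to the factorization of its image.\<close>
  define h1 where "h1 k = Comp ?E' (rlift q' p' (FA p k) (h0 (Cod ?E k))) (llift q' p' (FA q k) (h0 (Dom ?E k)))" for k
  have \<alpha>': "functor_between (NSrc \<alpha>) (prod_cat (op_cat B) A) Set" using X \<alpha> by simp
  have h0: "h0 e \<in> Obj ?E'" "FO q' (h0 e) = FO q e" "FO p' (h0 e) = FO p e" if e: "e \<in> Obj ?E" for e
    using NC_in[OF \<alpha>(1) \<alpha>', of "pair (FO p e) (FO q e)" e] fib2_simps(1)[OF D(1,2,6)] fib2_simps(1)[OF D'(1,2,6)]
      e \<alpha> by (auto simp: S st h0_def)
  have push: "h0 (Cod ?E (llift q p f e)) = Cod ?E' (llift q' p' f (h0 e))"
    if e: "e \<in> Obj ?E" and f: "f \<in> Arr A" "Dom A f = FO q e" for e f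
  proof -
    let ?k = "pair (Ident B (FO p e)) f"
    have k: "?k \<in> Arr (prod_cat (op_cat B) A)" using e f by (simp add: S)
    have "e \<in> FO (NSrc \<alpha>) (Dom (prod_cat (op_cat B) A) ?k)"
      using e f fib2_simps(1)[OF D(1,2,6)] \<alpha> by (simp add: S st)
    from NC_natural_Set[OF \<alpha>(1) \<alpha>' k this]
    have "ap (NC \<alpha> (pair (FO p e) (Cod A f))) (Cod ?E (llift q p f e)) = ap (FA (fib2 (q', p')) ?k) (h0 e)"
      using e f fib2_push[OF D(1,2,6), of f e] \<alpha> by (simp add: S st h0_def)
    then show ?thesis
      using llift[OF D(1,2,6) e f] fib2_push[OF D'(1,2,6), of f "h0 e"] h0[OF e] f by (simp add: h0_def)
  qed
  have pull: "h0 (Dom ?E (rlift q p g e)) = Dom ?E' (rlift q' p' g (h0 e))"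
    if e: "e \<in> Obj ?E" and g: "g \<in> Arr B" "Cod B g = FO p e" for e g
  proof -
    let ?k = "pair g (Ident A (FO q e))"
    have k: "?k \<in> Arr (prod_cat (op_cat B) A)" using e g by (simp add: S)
    have "e \<in> FO (NSrc \<alpha>) (Dom (prod_cat (op_cat B) A) ?k)"
      using e g fib2_simps(1)[OF D(1,2,6)] \<alpha> by (simp add: S st)
    from NC_natural_Set[OF \<alpha>(1) \<alpha>' k this]
    have "ap (NC \<alpha> (pair (Dom B g) (FO q e))) (Dom ?E (rlift q p g e)) = ap (FA (fib2 (q', p')) ?k) (h0 e)"
      using e g fib2_pull[OF D(1,2,6), of g e] \<alpha> by (simp add: S st h0_def)
    then show ?thesis
      using rlift[OF D(1,2,6) e g] fib2_pull[OF D'(1,2,6), of g "h0 e"] h0[OF e] g by (simp add: h0_def)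
  qed
  have h1: "h1 k \<in> Arr ?E' \<and> Dom ?E' (h1 k) = h0 (Dom ?E k) \<and> Cod ?E' (h1 k) = h0 (Cod ?E k) \<and>
      FA q' (h1 k) = FA q k \<and> FA p' (h1 k) = FA p k" if k: "k \<in> Arr ?E" for k
  proof -
    have kO: "Dom ?E k \<in> Obj ?E" "Cod ?E k \<in> Obj ?E" using k by (simp_all add: S)
    note l = llift[OF D'(1,2,6) h0(1)[OF kO(1)], of "FA q k"] and r = rlift[OF D'(1,2,6) h0(1)[OF kO(2)], of "FA p k"]
    have l: "llift q' p' (FA q k) (h0 (Dom ?E k)) \<in> Arr ?E'" "Dom ?E' (llift q' p' (FA q k) (h0 (Dom ?E k))) = h0 (Dom ?E k)"
      "FA q' (llift q' p' (FA q k) (h0 (Dom ?E k))) = FA q k" "FA p' (llift q' p' (FA q k) (h0 (Dom ?E k))) = Ident B (FO p (Dom ?E k))"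
      using l k h0[OF kO(1)] by (simp_all add: S)
    have r: "rlift q' p' (FA p k) (h0 (Cod ?E k)) \<in> Arr ?E'" "Cod ?E' (rlift q' p' (FA p k) (h0 (Cod ?E k))) = h0 (Cod ?E k)"
      "FA p' (rlift q' p' (FA p k) (h0 (Cod ?E k))) = FA p k" "FA q' (rlift q' p' (FA p k) (h0 (Cod ?E k))) = Ident A (FO q (Cod ?E k))"
      using r k h0[OF kO(2)] by (simp_all add: S)
    \<comment> \<open>Composability of the two lifts. In \<open>E\<close> the two middle objects
      coincide by \<open>factor\<close>, and naturality of \<open>\<alpha>\<close>, through
      \<open>push\<close> and \<open>pull\<close>, carries this equality to
      \<open>E'\<close>.\<close>
    have c: "Cod ?E' (llift q' p' (FA q k) (h0 (Dom ?E k))) = Dom ?E' (rlift q' p' (FA p k) (h0 (Cod ?E k)))"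
      using push[OF kO(1), of "FA q k"] pull[OF kO(2), of "FA p k"] factor(1)[OF D(1,2,6) k] k by (simp add: S)
    show ?thesis
      unfolding h1_def using l r c k by (simp add: S)
  qed
  define h where "h = mk_func ?E ?E' h0 h1"
  \<comment> \<open>Preservation of identities and composites needs no computation with lifts: both
    sides have the same ends and the same images under the legs.\<close>
  have h: "functor_between h ?E ?E'"
    unfolding h_def
  proof (rule mk_func_functor)
    fix e assume e: "e \<in> Obj ?E"
    show "h1 (Ident ?E e) = Ident ?E' (h0 e)"
      by (rule two_sided_arr_eqI[OF D'(1,2,6)]) (use h1[of "Ident ?E e"] h0[OF e] e in \<open>simp_all add: S\<close>)
  next
    fix k k' assume k: "k \<in> Arr ?E" "k' \<in> Arr ?E" "Cod ?E k = Dom ?E k'"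
    show "h1 (Comp ?E k' k) = Comp ?E' (h1 k') (h1 k)"
      by (rule two_sided_arr_eqI[OF D'(1,2,6)])
        (use h1[of "Comp ?E k' k"] h1[OF k(1)] h1[OF k(2)] k in \<open>simp_all add: S\<close>)
  qed (simp_all add: S h0 h1)
  have "comp_func q' h = q"
    by (rule func_eqI[OF comp_func_functor[OF h D'(1)] D(1)]) (simp_all add: h_def h0 h1)
  moreover have "comp_func p' h = p"
    by (rule func_eqI[OF comp_func_functor[OF h D'(2)] D(2)]) (simp_all add: h_def h0 h1)
  ultimately have harr: "(s, h, t) \<in> Arr (DFib2 A B)"
    using s t h by (simp add: st Arr_DFib2)
  have "fib2_map (s, h, t) = \<alpha>"
  proof (rule copsh_nt_eqI[OF fib2_map_nt[OF harr] _ \<alpha>(1)])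
    fix z e assume z: "z \<in> Obj (prod_cat (op_cat B) A)" and "e \<in> FO (NSrc (fib2_map (s, h, t))) z"
    then have e: "e \<in> FO (fib2 s) z" by simp
    then have "e \<in> Obj ?E" "z = pair (FO p e) (FO q e)"
      using z fib2_simps(1)[OF D(1,2,6)] by (auto simp: st)
    then show "ap (NC (fib2_map (s, h, t)) z) e = ap (NC \<alpha> z) e"
      using fib2_map_ap[OF s z e] by (simp add: h_def h0_def)
  qed (use X \<alpha> in simp_all)
  then show ?thesis using harr by blast
qed

subsection \<open>The two-sided category of elements\<close>

text \<open>An arrow from \<open>x\<close> to \<open>x'\<close> over \<open>g\<close> in \<open>B\<close> and \<open>f\<close> in \<open>A\<close> records that \<open>f\<close> pushes \<open>x\<close> to the
  element to which \<open>g\<close> pulls \<open>x'\<close>.\<close>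

definition el2_cat :: "('u::universe) scat \<Rightarrow> 'u scat \<Rightarrow> 'u copsh \<Rightarrow> 'u scat" where
  "el2_cat A B X = \<lparr>
     Obj = {pair (pair b a) x | b a x. b \<in> Obj B \<and> a \<in> Obj A \<and> x \<in> FO X (pair b a)},
     Arr = {pair (pair g f) (pair x x') | g f x x'. g \<in> Arr B \<and> f \<in> Arr A \<and>
       x \<in> FO X (pair (Dom B g) (Dom A f)) \<and> x' \<in> FO X (pair (Cod B g) (Cod A f)) \<and>
       ap (FA X (pair (Ident B (Dom B g)) f)) x = ap (FA X (pair g (Ident A (Cod A f)))) x'},
     Dom = (\<lambda>k. pair (pair (Dom B (p1 (p1 k))) (Dom A (p2 (p1 k)))) (p1 (p2 k))),
     Cod = (\<lambda>k. pair (pair (Cod B (p1 (p1 k))) (Cod A (p2 (p1 k)))) (p2 (p2 k))),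
     Ident = (\<lambda>z. pair (pair (Ident B (p1 (p1 z))) (Ident A (p2 (p1 z)))) (pair (p2 z) (p2 z))),
     Comp = (\<lambda>k h. pair (pair (Comp B (p1 (p1 k)) (p1 (p1 h))) (Comp A (p2 (p1 k)) (p2 (p1 h))))
       (pair (p1 (p2 h)) (p2 (p2 k))))\<rparr>"

lemma el2_cat_simps [simp]:
  "Obj (el2_cat A B X) = {pair (pair b a) x | b a x. b \<in> Obj B \<and> a \<in> Obj A \<and> x \<in> FO X (pair b a)}"
  "Arr (el2_cat A B X) = {pair (pair g f) (pair x x') | g f x x'. g \<in> Arr B \<and> f \<in> Arr A \<and>
       x \<in> FO X (pair (Dom B g) (Dom A f)) \<and> x' \<in> FO X (pair (Cod B g) (Cod A f)) \<and>
       ap (FA X (pair (Ident B (Dom B g)) f)) x = ap (FA X (pair g (Ident A (Cod A f)))) x'}"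
  "Dom (el2_cat A B X) k = pair (pair (Dom B (p1 (p1 k))) (Dom A (p2 (p1 k)))) (p1 (p2 k))"
  "Cod (el2_cat A B X) k = pair (pair (Cod B (p1 (p1 k))) (Cod A (p2 (p1 k)))) (p2 (p2 k))"
  "Ident (el2_cat A B X) z = pair (pair (Ident B (p1 (p1 z))) (Ident A (p2 (p1 z)))) (pair (p2 z) (p2 z))"
  "Comp (el2_cat A B X) k h = pair (pair (Comp B (p1 (p1 k)) (p1 (p1 h))) (Comp A (p2 (p1 k)) (p2 (p1 h))))
       (pair (p1 (p2 h)) (p2 (p2 k)))"
  by (simp_all add: el2_cat_def)

definition el2_A :: "('u::universe) scat \<Rightarrow> 'u scat \<Rightarrow> 'u copsh \<Rightarrow> 'u sfunc" where
  "el2_A A B X = mk_func (el2_cat A B X) A (\<lambda>z. p2 (p1 z)) (\<lambda>k. p2 (p1 k))"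

definition el2_B :: "('u::universe) scat \<Rightarrow> 'u scat \<Rightarrow> 'u copsh \<Rightarrow> 'u sfunc" where
  "el2_B A B X = mk_func (el2_cat A B X) B (\<lambda>z. p1 (p1 z)) (\<lambda>k. p1 (p1 k))"

context
  fixes A B :: "('u::universe) scat" and X :: "'u copsh"
  assumes A: "category A" and B: "category B" and X: "functor_between X (prod_cat (op_cat B) A) Set"
begin

lemma prof_in: "g \<in> Arr B \<Longrightarrow> f \<in> Arr A \<Longrightarrow> x \<in> FO X (pair (Cod B g) (Dom A f)) \<Longrightarrow>
    ap (FA X (pair g f)) x \<in> FO X (pair (Dom B g) (Cod A f))"
  using copsh_in[OF X, of "pair g f" x] by simp

lemma prof_Ident: "b \<in> Obj B \<Longrightarrow> a \<in> Obj A \<Longrightarrow> x \<in> FO X (pair b a) \<Longrightarrow>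
    ap (FA X (pair (Ident B b) (Ident A a))) x = x"
  using copsh_Ident[OF X, of "pair b a" x] by simp

lemma prof_Comp: "g \<in> Arr B \<Longrightarrow> g' \<in> Arr B \<Longrightarrow> Cod B g' = Dom B g \<Longrightarrow> f \<in> Arr A \<Longrightarrow> f' \<in> Arr A \<Longrightarrow>
    Cod A f = Dom A f' \<Longrightarrow> x \<in> FO X (pair (Cod B g) (Dom A f)) \<Longrightarrow>
    ap (FA X (pair g' f')) (ap (FA X (pair g f)) x) = ap (FA X (pair (Comp B g g') (Comp A f' f))) x"
  using copsh_Comp[OF X, of "pair g f" "pair g' f'" x] by simp

text \<open>Both sides equal \<open>ap (FA X (pair g f')) x'\<close>: the condition on the first
  arrow rewrites the left side to it, the condition on the second arrow the right side.\<close>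

lemma el2_cond_Comp:
  assumes k: "g \<in> Arr B" "f \<in> Arr A" "x \<in> FO X (pair (Dom B g) (Dom A f))" "x' \<in> FO X (pair (Cod B g) (Cod A f))"
      "ap (FA X (pair (Ident B (Dom B g)) f)) x = ap (FA X (pair g (Ident A (Cod A f)))) x'"
    and k': "g' \<in> Arr B" "f' \<in> Arr A" "x'' \<in> FO X (pair (Cod B g') (Cod A f'))"
      "ap (FA X (pair (Ident B (Dom B g')) f')) x' = ap (FA X (pair g' (Ident A (Cod A f')))) x''"
    and c: "Cod B g = Dom B g'" "Cod A f = Dom A f'"
  shows "ap (FA X (pair (Ident B (Dom B g)) (Comp A f' f))) x = ap (FA X (pair (Comp B g' g) (Ident A (Cod A f')))) x''"
proof -
  let ?b = "Ident B (Dom B g)" and ?a = "Ident A (Cod A f')"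
  have "ap (FA X (pair ?b (Comp A f' f))) x = ap (FA X (pair ?b f')) (ap (FA X (pair ?b f)) x)"
    using prof_Comp[of ?b ?b f f' x] k k' c A B by simp
  also have "\<dots> = ap (FA X (pair ?b f')) (ap (FA X (pair g (Ident A (Cod A f)))) x')"
    using k by simp
  also have "\<dots> = ap (FA X (pair g f')) x'"
    using prof_Comp[of g ?b "Ident A (Cod A f)" f' x'] k k' c A B by simp
  also have "\<dots> = ap (FA X (pair g ?a)) (ap (FA X (pair (Ident B (Dom B g')) f')) x')"
    using prof_Comp[of "Ident B (Dom B g')" g f' ?a x'] k k' c A B by simp
  also have "\<dots> = ap (FA X (pair g ?a)) (ap (FA X (pair g' ?a)) x'')"
    using k' by simp
  also have "\<dots> = ap (FA X (pair (Comp B g' g) ?a)) x''"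
    using prof_Comp[of g' g ?a ?a x''] k k' c A B by simp
  finally show ?thesis .
qed

lemma category_el2_cat: "category (el2_cat A B X)"
proof (rule categoryI)
  fix h k assume "h \<in> Arr (el2_cat A B X)" "k \<in> Arr (el2_cat A B X)" "Cod (el2_cat A B X) h = Dom (el2_cat A B X) k"
  then obtain g f x x' g' f' x'' where "h = pair (pair g f) (pair x x')" "k = pair (pair g' f') (pair x' x'')"
    and k: "g \<in> Arr B" "f \<in> Arr A" "x \<in> FO X (pair (Dom B g) (Dom A f))" "x' \<in> FO X (pair (Cod B g) (Cod A f))"
      "ap (FA X (pair (Ident B (Dom B g)) f)) x = ap (FA X (pair g (Ident A (Cod A f)))) x'"
    and k': "g' \<in> Arr B" "f' \<in> Arr A" "x'' \<in> FO X (pair (Cod B g') (Cod A f'))"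
      "ap (FA X (pair (Ident B (Dom B g')) f')) x' = ap (FA X (pair g' (Ident A (Cod A f')))) x''"
    and c: "Cod B g = Dom B g'" "Cod A f = Dom A f'"
    by auto
  then show "Comp (el2_cat A B X) k h \<in> Arr (el2_cat A B X)"
    and "Dom (el2_cat A B X) (Comp (el2_cat A B X) k h) = Dom (el2_cat A B X) h"
    and "Cod (el2_cat A B X) (Comp (el2_cat A B X) k h) = Cod (el2_cat A B X) k"
    using el2_cond_Comp[OF k k' c] A B by simp_all
qed (auto simp: A B prof_Ident Comp_assoc)

lemma el2_functors:
  "functor_between (el2_A A B X) (el2_cat A B X) A" "functor_between (el2_B A B X) (el2_cat A B X) B"
  unfolding el2_A_def el2_B_def
  by (rule mk_func_functor[OF category_el2_cat]; use A B in auto)+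

lemma el2_simps:
  "b \<in> Obj B \<Longrightarrow> a \<in> Obj A \<Longrightarrow> x \<in> FO X (pair b a) \<Longrightarrow> FO (el2_A A B X) (pair (pair b a) x) = a"
  "b \<in> Obj B \<Longrightarrow> a \<in> Obj A \<Longrightarrow> x \<in> FO X (pair b a) \<Longrightarrow> FO (el2_B A B X) (pair (pair b a) x) = b"
  "pair (pair g f) m \<in> Arr (el2_cat A B X) \<Longrightarrow> FA (el2_A A B X) (pair (pair g f) m) = f"
  "pair (pair g f) m \<in> Arr (el2_cat A B X) \<Longrightarrow> FA (el2_B A B X) (pair (pair g f) m) = g"
  by (simp_all add: el2_A_def el2_B_def)

text \<open>If the component in \<open>B\<close> is an identity, then one side of the arrow
  condition is just the target element, by \<open>prof_Ident\<close>, so this element is forced to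
  be the pushforward of \<open>x\<close>. The equivalence gives existence and uniqueness of the lift
  at once.\<close>

lemma el2_left_lift:
  assumes e: "b \<in> Obj B" "a \<in> Obj A" "x \<in> FO X (pair b a)" and f: "f \<in> Arr A" "Dom A f = a"
  shows "is_left_lift (el2_A A B X) (el2_B A B X) (pair (pair b a) x) f k \<longleftrightarrow>
    k = pair (pair (Ident B b) f) (pair x (ap (FA X (pair (Ident B b) f)) x))"
proof
  let ?k = "pair (pair (Ident B b) f) (pair x (ap (FA X (pair (Ident B b) f)) x))"
  have y: "ap (FA X (pair (Ident B b) f)) x \<in> FO X (pair b (Cod A f))"
    using prof_in[of "Ident B b" f x] e f A B by simp
  have "?k \<in> Arr (el2_cat A B X)"
    using e f y prof_Ident[OF _ _ y] A B by simp
  then show "is_left_lift (el2_A A B X) (el2_B A B X) (pair (pair b a) x) f k" if "k = ?k"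
    unfolding left_lift_iff[OF el2_functors] that using e f A B el2_simps by simp
  assume k: "is_left_lift (el2_A A B X) (el2_B A B X) (pair (pair b a) x) f k"
  then have "k \<in> Arr (el2_cat A B X)" unfolding left_lift_iff[OF el2_functors] by blast
  then obtain g' f' x0 x' where k': "k = pair (pair g' f') (pair x0 x')" "g' \<in> Arr B" "f' \<in> Arr A"
    "x0 \<in> FO X (pair (Dom B g') (Dom A f'))" "x' \<in> FO X (pair (Cod B g') (Cod A f'))"
    "ap (FA X (pair (Ident B (Dom B g')) f')) x0 = ap (FA X (pair g' (Ident A (Cod A f')))) x'" by auto
  with k have "f' = f" "x0 = x" "g' = Ident B b"
    unfolding left_lift_iff[OF el2_functors] using el2_simps e by simp_all
  then show "k = ?k"
    using k' prof_Ident[of b "Cod A f" x'] e f A B by simp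
qed

lemma el2_right_lift:
  assumes e: "b \<in> Obj B" "a \<in> Obj A" "x \<in> FO X (pair b a)" and g: "g \<in> Arr B" "Cod B g = b"
  shows "is_right_lift (el2_A A B X) (el2_B A B X) (pair (pair b a) x) g k \<longleftrightarrow>
    k = pair (pair g (Ident A a)) (pair (ap (FA X (pair g (Ident A a))) x) x)"
proof
  let ?k = "pair (pair g (Ident A a)) (pair (ap (FA X (pair g (Ident A a))) x) x)"
  have y: "ap (FA X (pair g (Ident A a))) x \<in> FO X (pair (Dom B g) a)"
    using prof_in[of g "Ident A a" x] e g A B by simp
  have "?k \<in> Arr (el2_cat A B X)"
    using e g y prof_Ident[OF _ _ y] A B by simp
  then show "is_right_lift (el2_A A B X) (el2_B A B X) (pair (pair b a) x) g k" if "k = ?k"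
    unfolding right_lift_iff[OF el2_functors] that using e g A B el2_simps by simp
  assume k: "is_right_lift (el2_A A B X) (el2_B A B X) (pair (pair b a) x) g k"
  then have "k \<in> Arr (el2_cat A B X)" unfolding right_lift_iff[OF el2_functors] by blast
  then obtain g' f' x0 x' where k': "k = pair (pair g' f') (pair x0 x')" "g' \<in> Arr B" "f' \<in> Arr A"
    "x0 \<in> FO X (pair (Dom B g') (Dom A f'))" "x' \<in> FO X (pair (Cod B g') (Cod A f'))"
    "ap (FA X (pair (Ident B (Dom B g')) f')) x0 = ap (FA X (pair g' (Ident A (Cod A f')))) x'" by auto
  with k have "g' = g" "x' = x" "f' = Ident A a"
    unfolding right_lift_iff[OF el2_functors] using el2_simps e by simp_all
  then show "k = ?k"
    using k' prof_Ident[of "Dom B g" a x0] e g A B by simp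
qed

text \<open>Once the lifts are explicit, the factorization axiom is the condition in the definition
  of an arrow: the left lift ends at the element at which the right lift starts.\<close>

lemma two_sided_el2: "two_sided_discrete_fibration (el2_A A B X) (el2_B A B X)"
proof (rule two_sidedI[OF el2_functors])
  fix z f assume "z \<in> Obj (el2_cat A B X)" "f \<in> Arr A" "Dom A f = FO (el2_A A B X) z"
  then obtain b a x where "z = pair (pair b a) x" "b \<in> Obj B" "a \<in> Obj A" "x \<in> FO X (pair b a)" "f \<in> Arr A" "Dom A f = a"
    using el2_simps by auto
  then show "\<exists>!k. is_left_lift (el2_A A B X) (el2_B A B X) z f k" using el2_left_lift by simp
next
  fix z g assume "z \<in> Obj (el2_cat A B X)" "g \<in> Arr B" "Cod B g = FO (el2_B A B X) z"
  then obtain b a x where "z = pair (pair b a) x" "b \<in> Obj B" "a \<in> Obj A" "x \<in> FO X (pair b a)" "g \<in> Arr B" "Cod B g = b"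
    using el2_simps by auto
  then show "\<exists>!k. is_right_lift (el2_A A B X) (el2_B A B X) z g k" using el2_right_lift by simp
next
  fix h k m assume h: "h \<in> Arr (el2_cat A B X)"
    and k: "is_left_lift (el2_A A B X) (el2_B A B X) (Dom (el2_cat A B X) h) (FA (el2_A A B X) h) k"
    and m: "is_right_lift (el2_A A B X) (el2_B A B X) (Cod (el2_cat A B X) h) (FA (el2_B A B X) h) m"
  from h obtain g f x x' where h': "h = pair (pair g f) (pair x x')" "g \<in> Arr B" "f \<in> Arr A"
    "x \<in> FO X (pair (Dom B g) (Dom A f))" "x' \<in> FO X (pair (Cod B g) (Cod A f))"
    "ap (FA X (pair (Ident B (Dom B g)) f)) x = ap (FA X (pair g (Ident A (Cod A f)))) x'" by auto
  have "FA (el2_A A B X) h = f" "FA (el2_B A B X) h = g" using h h' el2_simps by simp_all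
  then have "k = pair (pair (Ident B (Dom B g)) f) (pair x (ap (FA X (pair (Ident B (Dom B g)) f)) x))"
    and "m = pair (pair g (Ident A (Cod A f))) (pair (ap (FA X (pair g (Ident A (Cod A f)))) x') x')"
    using k m h' el2_left_lift[of "Dom B g" "Dom A f" x f k] el2_right_lift[of "Cod B g" "Cod A f" x' g m] A B
    by simp_all
  then show "Cod (el2_cat A B X) k = Dom (el2_cat A B X) m \<and> Comp (el2_cat A B X) m k = h"
    using h' A B by simp
qed

lemma small_el2_cat:
  assumes sA: "small_cat A" and sB: "small_cat B" shows "small_cat (el2_cat A B X)"
  unfolding small_cat_def
proof (intro conjI category_el2_cat)
  note P = small_cat_prod_cat[OF sB sA]
  have X': "small (FO X (pair b a))" if "b \<in> Obj B" "a \<in> Obj A" for b a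
    using copsh_small[OF X, of "pair b a"] that by simp
  have "small {pair z x | z x. z \<in> Obj (prod_cat B A) \<and> x \<in> FO X z}"
    by (rule small_pairs[OF small_catD(2)[OF P]]) (use X' in auto)
  then show "small (Obj (el2_cat A B X))" by (rule small_subset) auto
  \<comment> \<open>A larger set than the arrows: the equation between the two transported elements
    is omitted, which leaves a dependent sum over the arrows of the product.\<close>
  have "small {pair k m | k m. k \<in> Arr (prod_cat B A) \<and>
      m \<in> {pair x x' | x x'. x \<in> FO X (Dom (prod_cat B A) k) \<and> x' \<in> FO X (Cod (prod_cat B A) k)}}"
    by (intro small_pairs[OF small_catD(3)[OF P]] small_pairs) (use X' A B in auto)
  then show "small (Arr (el2_cat A B X))" by (rule small_subset) auto
qed

lemma el2_in_DFib2:
  assumes "small_cat A" "small_cat B" shows "(el2_A A B X, el2_B A B X) \<in> Obj (DFib2 A B)"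
  using assms small_el2_cat two_sided_el2 el2_functors functor_betweenD(2)[OF el2_functors(1)]
  by (simp add: Obj_DFib2)

text \<open>The fibre over \<open>b\<close> and \<open>a\<close> consists of the elements of
  \<open>X\<close> there, tagged with \<open>pair b a\<close>; the isomorphism drops the
  tag.\<close>

lemma fib2_el2:
  assumes sA: "small_cat A" and sB: "small_cat B"
  shows "\<exists>\<alpha>. iso (func_cat (prod_cat (op_cat B) A) Set) \<alpha> \<and> NSrc \<alpha> = fib2 (el2_A A B X, el2_B A B X) \<and> NTgt \<alpha> = X"
proof -
  let ?F = "fib2 (el2_A A B X, el2_B A B X)"
  note el = el2_functors two_sided_el2
  note F = fib2_functor[OF el small_el2_cat[OF sA sB]]
  have FO: "z \<in> FO ?F (pair b a) \<longleftrightarrow> (\<exists>x\<in>FO X (pair b a). z = pair (pair b a) x)" if "b \<in> Obj B" "a \<in> Obj A" for b a z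
    using fib2_simps(1)[OF el that] that el2_simps(1,2) by auto
  define \<alpha> where "\<alpha> = mk_copsh_nt ?F X (\<lambda>_. p2)"
  have \<alpha>: "is_nt \<alpha>"
    unfolding \<alpha>_def
  proof (rule is_nt_mk_copsh_nt[OF F X])
    fix c z assume "c \<in> Obj (prod_cat (op_cat B) A)" "z \<in> FO ?F c"
    then show "p2 z \<in> FO X c" using FO by auto
  next
    fix k z assume "k \<in> Arr (prod_cat (op_cat B) A)" "z \<in> FO ?F (Dom (prod_cat (op_cat B) A) k)"
    then obtain g f x where k: "k = pair g f" "g \<in> Arr B" "f \<in> Arr A" and z: "z = pair (pair (Cod B g) (Dom A f)) x"
      and x: "x \<in> FO X (pair (Cod B g) (Dom A f))"
      using FO A B by auto
    have gO: "Cod B g \<in> Obj B" "Dom A f \<in> Obj A" "Cod A f \<in> Obj A" using k A B by simp_all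
    let ?y = "ap (FA X (pair (Ident B (Cod B g)) f)) x"
    have y: "?y \<in> FO X (pair (Cod B g) (Cod A f))" using prof_in[of "Ident B (Cod B g)" f x] x k gO B by simp
    have l: "llift (el2_A A B X) (el2_B A B X) f z = pair (pair (Ident B (Cod B g)) f) (pair x ?y)"
      unfolding llift_def z by (rule the_equality; simp only: el2_left_lift[OF gO(1,2) x k(3) refl])
    have r: "rlift (el2_A A B X) (el2_B A B X) g (pair (pair (Cod B g) (Cod A f)) ?y) =
        pair (pair g (Ident A (Cod A f))) (pair (ap (FA X (pair g (Ident A (Cod A f)))) ?y) ?y)"
      unfolding rlift_def by (rule the_equality; simp only: el2_right_lift[OF gO(1,3) y k(2) refl])
    have "ap (FA ?F k) z = pair (pair (Dom B g) (Cod A f)) (ap (FA X (pair g (Ident A (Cod A f)))) ?y)"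
      unfolding k(1) using fib2_simps(2)[OF el k(2,3), of z] z x gO el2_simps(1,2) l r B A by simp
    \<comment> \<open>The fibre action performs the push along \<open>f\<close> and the pull along
      \<open>g\<close> in turn; functoriality of \<open>X\<close> merges them into the action of
      \<open>pair g f\<close>.\<close>
    moreover have "ap (FA X (pair g (Ident A (Cod A f)))) ?y = ap (FA X (pair g f)) x"
      using prof_Comp[of "Ident B (Cod B g)" g f "Ident A (Cod A f)" x] k gO x A B by simp
    ultimately show "p2 (ap (FA ?F k) z) = ap (FA X k) (p2 z)" by (simp add: k z)
  qed
  have "iso (func_cat (prod_cat (op_cat B) A) Set) \<alpha>"
  proof (rule iso_copsh_ntI[OF \<alpha>])
    show "functor_between (NSrc \<alpha>) (prod_cat (op_cat B) A) Set" using F by (simp add: \<alpha>_def)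
    fix c assume "c \<in> Obj (prod_cat (op_cat B) A)"
    then obtain b a where c: "c = pair b a" "b \<in> Obj B" "a \<in> Obj A" by auto
    have "ap (NC \<alpha> c) z = p2 z" if "z \<in> FO ?F c" for z
      using that c functor_betweenD(2)[OF F] by (simp add: \<alpha>_def)
    then have "bij_betw (ap (NC \<alpha> c)) (FO ?F c) (FO X c) \<longleftrightarrow> bij_betw p2 (FO ?F c) (FO X c)"
      by (intro bij_betw_cong) simp
    moreover have "bij_betw p2 (FO ?F c) (FO X c)"
      by (rule bij_betw_byWitness[where f' = "\<lambda>x. pair c x"]) (use c FO in auto)
    ultimately show "bij_betw (ap (NC \<alpha> c)) (FO (NSrc \<alpha>) c) (FO (NTgt \<alpha>) c)" by (simp add: \<alpha>_def)
  qed
  then show ?thesis by (intro exI[of _ \<alpha>]) (simp add: \<alpha>_def)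
qed

end

lemma equivalence_Fib:
  assumes A: "small_cat A" and B: "small_cat B" shows "equivalence (Fib A B)"
proof (rule equivalenceI[OF Fib_functor[OF A B]])
  fix f g assume fg: "f \<in> Arr (DFib2 A B)" "g \<in> Arr (DFib2 A B)" "Dom (DFib2 A B) f = Dom (DFib2 A B) g"
    "Cod (DFib2 A B) f = Cod (DFib2 A B) g" "FA (Fib A B) f = FA (Fib A B) g"
  obtain s h t h' where fg': "f = (s, h, t)" "g = (s, h', t)" using fg(3,4) by (cases f; cases g) auto
  show "f = g" using Fib_faithful[of s h t A B h'] fg by (simp add: fg')
next
  fix s t k assume s: "s \<in> Obj (DFib2 A B)" and t: "t \<in> Obj (DFib2 A B)"
    and "k \<in> Arr (func_cat (prod_cat (op_cat B) A) Set)" "Dom (func_cat (prod_cat (op_cat B) A) Set) k = FO (Fib A B) s"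
    "Cod (func_cat (prod_cat (op_cat B) A) Set) k = FO (Fib A B) t"
  then have "is_nt k" "NSrc k = fib2 s" "NTgt k = fib2 t" by simp_all
  from Fib_full[OF s t this] obtain h where "(s, h, t) \<in> Arr (DFib2 A B)" "fib2_map (s, h, t) = k" by blast
  then show "\<exists>f. f \<in> Arr (DFib2 A B) \<and> Dom (DFib2 A B) f = s \<and> Cod (DFib2 A B) f = t \<and> FA (Fib A B) f = k"
    by (intro exI[of _ "(s, h, t)"]) simp
next
  fix X :: "'a copsh" assume "X \<in> Obj (func_cat (prod_cat (op_cat B) A) Set)"
  then have X: "functor_between X (prod_cat (op_cat B) A) Set" by simp
  note AB = small_catD(1)[OF A] small_catD(1)[OF B]
  obtain \<alpha> where "iso (func_cat (prod_cat (op_cat B) A) Set) \<alpha>" "NSrc \<alpha> = fib2 (el2_A A B X, el2_B A B X)" "NTgt \<alpha> = X"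
    using fib2_el2[OF AB X A B] by blast
  then show "\<exists>s k. s \<in> Obj (DFib2 A B) \<and> iso (func_cat (prod_cat (op_cat B) A) Set) k \<and>
      Dom (func_cat (prod_cat (op_cat B) A) Set) k = FO (Fib A B) s \<and> Cod (func_cat (prod_cat (op_cat B) A) Set) k = X"
    using el2_in_DFib2[OF AB X A B] by (intro exI[of _ "(el2_A A B X, el2_B A B X)"] exI[of _ \<alpha>]) simp
qed

subsection \<open>Pseudonaturality of the fibre functors\<close>

text \<open>The second leg of the pullback square. Applied to a span pulled back along
  \<open>(u, v)\<close>, it is the functor over \<open>(u, v)\<close> whose preservation of lifts
  makes the cell below natural.\<close>

definition pb_snd :: "('u::universe) sfunc \<Rightarrow> 'u sfunc \<Rightarrow> 'u sfunc" where
  "pb_snd w p = mk_func (pb_cat w p) (Src p) p2 p2"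

lemma pb_snd_functor:
  assumes w: "functor_between w C' C" and p: "functor_between p E C"
  shows "functor_between (pb_snd w p) (pb_cat w p) E"
proof -
  have "functor_between (pb_snd w p) (pb_cat w p) (Src p)"
    unfolding pb_snd_def by (rule mk_func_functor[OF category_pb_cat[OF w p]]) (auto simp: functor_betweenD[OF p])
  then show ?thesis by (simp add: functor_betweenD[OF p])
qed

text \<open>A point of the fibre of the pulled back span over \<open>pair b a\<close> is
  \<open>pair (pair a b) e\<close>, with \<open>e\<close> in the fibre of \<open>s\<close> over the
  images of \<open>b\<close> and \<open>a\<close>; \<open>p2\<close> drops the tag. The tag has the
  coordinate of \<open>A'\<close> first, whereas profunctors are indexed with that of
  \<open>B'\<close> first.\<close>

definition fib2_cell :: "('u::universe) sfunc \<Rightarrow> 'u sfunc \<Rightarrow> 'u span \<Rightarrow> 'u copsh_nt" where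
  "fib2_cell u v s = mk_copsh_nt (fib2 (span_pb u v s)) (comp_func (fib2 s) (prod_func (op_func v) u)) (\<lambda>_. p2)"

lemma fib2_cell_simps [simp]:
  "NSrc (fib2_cell u v s) = fib2 (span_pb u v s)"
  "NTgt (fib2_cell u v s) = comp_func (fib2 s) (prod_func (op_func v) u)"
  by (simp_all add: fib2_cell_def)

definition Fib_cell :: "('u::universe) sfunc \<Rightarrow> 'u sfunc \<Rightarrow>
    ('u span, 'u span \<times> 'u sfunc \<times> 'u span, 'u copsh, 'u copsh_nt) nt" where
  "Fib_cell u v = \<lparr>NSrc = comp_func (Fib (Src u) (Src v)) (DFib2_act u v),
     NTgt = comp_func (precomp (prod_func (op_func v) u)) (Fib (Tgt u) (Tgt v)),
     NC = restrict (fib2_cell u v) (Obj (DFib2 (Tgt u) (Tgt v)))\<rparr>"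

context
  fixes u v :: "('u::universe) sfunc" and A' A B' B
  assumes u: "functor_between u A' A" "small_cat A'" "small_cat A" and v: "functor_between v B' B" "small_cat B'" "small_cat B"
begin

lemma prof_act: "functor_between (prod_func (op_func v) u) (prod_cat (op_cat B') A') (prod_cat (op_cat B) A)"
  using prod_func_functor[OF op_func_functor[OF v(1)] u(1)] .

context
  fixes s assumes s: "s \<in> Obj (DFib2 A B)"
begin

lemma fib2_span_pb_functor: "functor_between (fib2 (span_pb u v s)) (prod_cat (op_cat B') A') Set"
  using fib2_functor_DFib2[OF span_pb_in_DFib2[OF u(1,2) v(1,2) s]] .

lemma fib2_precomp_functor:
  "functor_between (comp_func (fib2 s) (prod_func (op_func v) u)) (prod_cat (op_cat B') A') Set"
  using comp_func_functor[OF prof_act fib2_functor_DFib2[OF s]] .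

lemma fib2_span_pb_iff:
  assumes "b \<in> Obj B'" "a \<in> Obj A'"
  shows "z \<in> FO (fib2 (span_pb u v s)) (pair b a) \<longleftrightarrow>
    (\<exists>e \<in> Obj (Src (fst s)). z = pair (pair a b) e \<and> FO (fst s) e = FO u a \<and> FO (snd s) e = FO v b)"
proof -
  obtain q p where st: "s = (q, p)" by (cases s)
  note D = Obj_DFib2D[OF s[unfolded st]]
  have "FO (fib2 (span_pb u v s)) (pair b a) =
      {e \<in> Obj (pb_cat (prod_func u v) (tuple_func q p)). FO (snd (span_pb u v (q, p))) e = b \<and> FO (fst (span_pb u v (q, p))) e = a}"
    using fib2_FO[OF span_pb_in_DFib2[OF u(1,2) v(1,2) s] assms] Src_span_pb[OF u(1,2) v(1,2) s] by (simp add: st)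
  also have "z \<in> \<dots> \<longleftrightarrow> (\<exists>e \<in> Obj (Src (fst s)). z = pair (pair a b) e \<and> FO (fst s) e = FO u a \<and> FO (snd s) e = FO v b)"
    unfolding pb_span_simps[OF u(1) v(1) D(1,2)] using span_pb_simps[OF u(1) v(1) D(1,2)] assms
    by (auto simp: st)
  finally show ?thesis .
qed

lemma fib2_precomp_FO:
  assumes "b \<in> Obj B'" "a \<in> Obj A'"
  shows "FO (comp_func (fib2 s) (prod_func (op_func v) u)) (pair b a) =
    {e \<in> Obj (Src (fst s)). FO (snd s) e = FO v b \<and> FO (fst s) e = FO u a}"
  using fib2_FO[OF s] assms
  by (simp add: functor_betweenD[OF u(1)] functor_betweenD[OF v(1)] functor_simps[OF u(1)] functor_simps[OF v(1)])

lemma fib2_cell_ap: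
  assumes "c \<in> Obj (prod_cat (op_cat B') A')" "z \<in> FO (fib2 (span_pb u v s)) c"
  shows "ap (NC (fib2_cell u v s) c) z = p2 z"
  using assms functor_betweenD(2)[OF fib2_span_pb_functor] by (simp add: fib2_cell_def)

lemma fib2_cell_nt: "is_nt (fib2_cell u v s)"
proof -
  obtain q p where st: "s = (q, p)" by (cases s)
  note D = Obj_DFib2D[OF s[unfolded st]]
  define Q P where "Q = fst (span_pb u v (q, p))" and "P = snd (span_pb u v (q, p))"
  define E' where "E' = pb_cat (prod_func u v) (tuple_func q p)"
  have QP: "span_pb u v s = (Q, P)" by (simp add: Q_def P_def st)
  note S = span_pb_functors[OF u(1) v(1) D(1,2), folded Q_def P_def E'_def]
  note S2 = two_sided_span_pb[OF u(1) v(1) D(1,2,6), folded Q_def P_def]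
  \<comment> \<open>On objects this functor is \<open>p2\<close>, the map used by the cell. It lies
    over \<open>(u, v)\<close>, so \<open>map_push\<close> and \<open>map_pull\<close> apply, and
    together they are the naturality of the cell.\<close>
  define m where "m = pb_snd (prod_func u v) (tuple_func q p)"
  have m: "functor_between m E' (Src q)"
    unfolding m_def E'_def by (rule pb_snd_functor[OF prod_func_functor[OF u(1) v(1)] tuple_func_functor[OF D(1,2)]])
  have mO: "FO m z = p2 z" if "z \<in> Obj E'" for z
    using that unfolding m_def pb_snd_def E'_def by simp
  have mA: "FA m z = p2 z" if "z \<in> Arr E'" for z
    using that unfolding m_def pb_snd_def E'_def by simp
  have overQ: "comp_func q m = comp_func u Q"
  proof (rule func_eqI[OF comp_func_functor[OF m D(1)] comp_func_functor[OF S(1) u(1)]])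
    show "FO (comp_func q m) z = FO (comp_func u Q) z" if z: "z \<in> Obj E'" for z
    proof -
      obtain a b e where z': "z = pair (pair a b) e" "a \<in> Obj A'" "b \<in> Obj B'" "e \<in> Obj (Src q)" "FO u a = FO q e" "FO v b = FO p e"
        using z unfolding E'_def pb_span_simps[OF u(1) v(1) D(1,2)] by blast
      show ?thesis
        using z mO[OF z] span_pb_simps(1)[OF u(1) v(1) D(1,2) z'(2-6)] z' functor_betweenD(2)[OF m] functor_betweenD(2)[OF S(1)]
        by (simp add: Q_def)
    qed
    show "FA (comp_func q m) z = FA (comp_func u Q) z" if z: "z \<in> Arr E'" for z
    proof -
      obtain f g k where z': "z = pair (pair f g) k" "f \<in> Arr A'" "g \<in> Arr B'" "k \<in> Arr (Src q)" "FA u f = FA q k" "FA v g = FA p k"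
        using z unfolding E'_def pb_span_simps[OF u(1) v(1) D(1,2)] by blast
      show ?thesis
        using z mA[OF z] span_pb_simps(3)[OF u(1) v(1) D(1,2) z'(2-6)] z' functor_betweenD(2)[OF m] functor_betweenD(2)[OF S(1)]
        by (simp add: Q_def)
    qed
  qed
  have overP: "comp_func p m = comp_func v P"
  proof (rule func_eqI[OF comp_func_functor[OF m D(2)] comp_func_functor[OF S(2) v(1)]])
    show "FO (comp_func p m) z = FO (comp_func v P) z" if z: "z \<in> Obj E'" for z
    proof -
      obtain a b e where z': "z = pair (pair a b) e" "a \<in> Obj A'" "b \<in> Obj B'" "e \<in> Obj (Src q)" "FO u a = FO q e" "FO v b = FO p e"
        using z unfolding E'_def pb_span_simps[OF u(1) v(1) D(1,2)] by blast
      show ?thesis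
        using z mO[OF z] span_pb_simps(2)[OF u(1) v(1) D(1,2) z'(2-6)] z' functor_betweenD(2)[OF m] functor_betweenD(2)[OF S(2)]
        by (simp add: P_def)
    qed
    show "FA (comp_func p m) z = FA (comp_func v P) z" if z: "z \<in> Arr E'" for z
    proof -
      obtain f g k where z': "z = pair (pair f g) k" "f \<in> Arr A'" "g \<in> Arr B'" "k \<in> Arr (Src q)" "FA u f = FA q k" "FA v g = FA p k"
        using z unfolding E'_def pb_span_simps[OF u(1) v(1) D(1,2)] by blast
      show ?thesis
        using z mA[OF z] span_pb_simps(4)[OF u(1) v(1) D(1,2) z'(2-6)] z' functor_betweenD(2)[OF m] functor_betweenD(2)[OF S(2)]
        by (simp add: P_def)
    qed
  qed
  note push = map_push[OF D(1,2,6) S S2 u(1) v(1) m overQ overP]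
    and pull = map_pull[OF D(1,2,6) S S2 u(1) v(1) m overQ overP]
    and over = over_lift_simps[OF D(1,2,6) S S2 u(1) v(1) m overQ overP]
  show ?thesis
    unfolding fib2_cell_def
  proof (rule is_nt_mk_copsh_nt[OF fib2_span_pb_functor fib2_precomp_functor])
    fix c z assume "c \<in> Obj (prod_cat (op_cat B') A')" and z: "z \<in> FO (fib2 (span_pb u v s)) c"
    then obtain b a where c: "c = pair b a" "b \<in> Obj B'" "a \<in> Obj A'" by auto
    then show "p2 z \<in> FO (comp_func (fib2 s) (prod_func (op_func v) u)) c"
      using z fib2_span_pb_iff[OF c(2,3)] fib2_precomp_FO[OF c(2,3)] by auto
  next
    fix k z assume "k \<in> Arr (prod_cat (op_cat B') A')" and z: "z \<in> FO (fib2 (span_pb u v s)) (Dom (prod_cat (op_cat B') A') k)"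
    then obtain g f where k: "k = pair g f" "g \<in> Arr B'" "f \<in> Arr A'" by auto
    have "z \<in> FO (fib2 (Q, P)) (pair (Cod B' g) (Dom A' f))" using z k QP by simp
    then have z: "z \<in> Obj E'" "FO P z = Cod B' g" "FO Q z = Dom A' f"
      using fib2_simps(1)[OF S S2] k functor_betweenD(4,5)[OF u(1)] functor_betweenD(4,5)[OF v(1)] by simp_all
    let ?z = "Cod E' (llift Q P f z)"
    have l: "llift Q P f z \<in> Arr E'" "FO P ?z = Cod B' g"
      using llift[OF S S2 z(1) k(3)] z by simp_all
    have z1: "?z \<in> Obj E'" using l functor_betweenD(4)[OF S(1)] by simp
    have r: "Dom E' (rlift Q P g ?z) \<in> Obj E'"
      using rlift(1)[OF S S2 z1 k(2)] l functor_betweenD(4)[OF S(1)] by simp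
    have mz: "FO m z \<in> Obj (Src q)" "FO p (FO m z) = Cod B (FA v g)" "FO q (FO m z) = Dom A (FA u f)"
      using FO_in_Obj[OF m z(1)] over(1,2)[OF z(1)] z k
      by (simp_all add: functor_simps[OF u(1)] functor_simps[OF v(1)])
    have "p2 (ap (FA (fib2 (Q, P)) (pair g f)) z) = FO m (Dom E' (rlift Q P g ?z))"
      using fib2_simps(2)[OF S S2 k(2,3) z] mO[OF r] by simp
    also have "\<dots> = Dom (Src q) (rlift q p (FA v g) (Cod (Src q) (llift q p (FA u f) (FO m z))))"
      using pull[OF z1 k(2)] push[OF z(1) k(3)] l z by simp
    also have "\<dots> = ap (FA (fib2 (q, p)) (pair (FA v g) (FA u f))) (FO m z)"
      using fib2_simps(2)[OF D(1,2,6) _ _ mz] k FA_in_Arr[OF u(1)] FA_in_Arr[OF v(1)] by simp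
    finally show "p2 (ap (FA (fib2 (span_pb u v s)) k) z) = ap (FA (comp_func (fib2 s) (prod_func (op_func v) u)) k) (p2 z)"
      using mO[OF z(1)] k
      by (simp add: QP[unfolded st] st functor_betweenD(2)[OF u(1)] functor_betweenD(2)[OF v(1)] del: comp_func_simps(3))
  qed
qed

lemma iso_fib2_cell: "iso (func_cat (prod_cat (op_cat B') A') Set) (fib2_cell u v s)"
proof (rule iso_copsh_ntI[OF fib2_cell_nt])
  show "functor_between (NSrc (fib2_cell u v s)) (prod_cat (op_cat B') A') Set"
    using fib2_span_pb_functor by simp
  fix c assume c: "c \<in> Obj (prod_cat (op_cat B') A')"
  then obtain b a where c': "c = pair b a" "b \<in> Obj B'" "a \<in> Obj A'" by auto
  have "bij_betw p2 (FO (fib2 (span_pb u v s)) c) (FO (comp_func (fib2 s) (prod_func (op_func v) u)) c)"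
    by (rule bij_betw_byWitness[where f' = "\<lambda>e. pair (pair a b) e"])
      (use fib2_span_pb_iff[OF c'(2,3)] fib2_precomp_FO[OF c'(2,3)] c'(1) in auto)
  then show "bij_betw (ap (NC (fib2_cell u v s) c)) (FO (NSrc (fib2_cell u v s)) c) (FO (NTgt (fib2_cell u v s)) c)"
    using bij_betw_cong[of "FO (fib2 (span_pb u v s)) c" "ap (NC (fib2_cell u v s) c)" p2] fib2_cell_ap[OF c] by simp
qed

end

lemma Fib_cell_NC: "s \<in> Obj (DFib2 A B) \<Longrightarrow> NC (Fib_cell u v) s = fib2_cell u v s"
  by (simp add: Fib_cell_def functor_betweenD[OF u(1)] functor_betweenD[OF v(1)])

lemma nat_iso_Fib_cell:
  "nat_iso (Fib_cell u v) (comp_func (Fib A' B') (DFib2_act u v)) (comp_func (precomp (prod_func (op_func v) u)) (Fib A B))"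
proof (rule nat_isoI[OF comp_func_functor[OF DFib2_act_functor[OF u(1,2) v(1,2)] Fib_functor[OF u(2) v(2)]]
      comp_func_functor[OF Fib_functor[OF u(3) v(3)] precomp_functor[OF prof_act]]])
  note ends = functor_betweenD(2,3)[OF u(1)] functor_betweenD(2,3)[OF v(1)]
  note act = DFib2_act_simps[OF u(1,2) v(1,2)]
  fix s assume s: "s \<in> Obj (DFib2 A B)"
  show "iso (func_cat (prod_cat (op_cat B') A') Set) (NC (Fib_cell u v) s)"
    using iso_fib2_cell[OF s] by (simp add: Fib_cell_NC s)
  show "Dom (func_cat (prod_cat (op_cat B') A') Set) (NC (Fib_cell u v) s) = FO (comp_func (Fib A' B') (DFib2_act u v)) s"
    using s span_pb_in_DFib2[OF u(1,2) v(1,2) s] by (simp add: Fib_cell_NC act ends)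
  show "Cod (func_cat (prod_cat (op_cat B') A') Set) (NC (Fib_cell u v) s) =
      FO (comp_func (precomp (prod_func (op_func v) u)) (Fib A B)) s"
    using s precomp_FO[OF prof_act fib2_functor_DFib2[OF s]] by (simp add: Fib_cell_NC ends)
next
  note ends = functor_betweenD(2,3)[OF u(1)] functor_betweenD(2,3)[OF v(1)]
  note act = DFib2_act_simps[OF u(1,2) v(1,2)]
  fix f assume f: "f \<in> Arr (DFib2 A B)"
  obtain s h t where f': "f = (s, h, t)" by (cases f) auto
  note h = f[unfolded f']
  note st = Arr_DFib2_tupD[OF h]
  note s1 = span_pb_in_DFib2[OF u(1,2) v(1,2) st(1)]
  note h1 = pb_map_in_DFib2[OF u(1,2) v(1,2) h]
  let ?h1 = "pb_map (prod_func u v) (tup s) h (tup t)"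
  let ?K = "func_cat (prod_cat (op_cat B') A') Set"
  note nth = fib2_map_nt[OF h] and nth1 = fib2_map_nt[OF h1]
  note pnt = precomp_nt[OF prof_act nth, unfolded fib2_map_simps, OF fib2_functor_DFib2[OF st(1)]]
  have pends: "NSrc (FA (precomp (prod_func (op_func v) u)) (fib2_map (s, h, t))) = comp_func (fib2 s) (prod_func (op_func v) u)"
    "NTgt (FA (precomp (prod_func (op_func v) u)) (fib2_map (s, h, t))) = comp_func (fib2 t) (prod_func (op_func v) u)"
    "\<And>c. c \<in> Obj (prod_cat (op_cat B') A') \<Longrightarrow> NC (FA (precomp (prod_func (op_func v) u)) (fib2_map (s, h, t))) c =
      NC (fib2_map (s, h, t)) (FO (prod_func (op_func v) u) c)"
    using precomp_FA[OF prof_act nth] fib2_functor_DFib2[OF st(1)] by simp_all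
  note F1 = fib2_span_pb_functor[OF st(1)]
  \<comment> \<open>At \<open>pair (pair a b) e\<close> both sides give the image of
    \<open>e\<close> under \<open>h\<close>: one side applies \<open>h\<close> under the tag and
    then drops the tag, the other drops it first.\<close>
  have "Comp ?K (fib2_cell u v t) (fib2_map (span_pb u v s, ?h1, span_pb u v t)) =
      Comp ?K (FA (precomp (prod_func (op_func v) u)) (fib2_map (s, h, t))) (fib2_cell u v s)"
  proof (rule copsh_nt_eqI[of _ "prod_cat (op_cat B') A'"])
    fix c z assume c: "c \<in> Obj (prod_cat (op_cat B') A')"
      and "z \<in> FO (NSrc (Comp ?K (fib2_cell u v t) (fib2_map (span_pb u v s, ?h1, span_pb u v t)))) c"
    then have z: "z \<in> FO (fib2 (span_pb u v s)) c" by simp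
    obtain b a where c': "c = pair b a" "b \<in> Obj B'" "a \<in> Obj A'" using c by auto
    obtain e where e: "e \<in> Obj (Src (fst s))" "z = pair (pair a b) e" "FO (fst s) e = FO u a" "FO (snd s) e = FO v b"
      using z fib2_span_pb_iff[OF st(1) c'(2,3)] c'(1) by auto
    have zO: "z \<in> Obj (pb_cat (prod_func u v) (tup s))"
      using fib2_FO[OF s1 c'(2,3)] z Src_span_pb[OF u(1,2) v(1,2) st(1)] c'(1) by simp
    have h1z: "FO ?h1 z = pair (pair a b) (FO h e)" using pb_func_simps(11)[OF zO] e by simp
    have "ap (NC (fib2_map (span_pb u v s, ?h1, span_pb u v t)) c) z \<in> FO (fib2 (span_pb u v t)) c"
      using NC_in[OF nth1 _ c, of z] F1 z by simp
    then have h1in: "FO ?h1 z \<in> FO (fib2 (span_pb u v t)) c" using fib2_map_ap[OF s1 c z] by simp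
    have "ap (NC (Comp ?K (fib2_cell u v t) (fib2_map (span_pb u v s, ?h1, span_pb u v t))) c) z =
        ap (NC (fib2_cell u v t) c) (ap (NC (fib2_map (span_pb u v s, ?h1, span_pb u v t)) c) z)"
      by (rule copsh_Comp_ap[OF nth1 _ fib2_cell_nt[OF st(2)] _ c]) (use F1 z in simp_all)
    also have "\<dots> = FO h e"
      using fib2_map_ap[OF s1 c z] fib2_cell_ap[OF st(2) c h1in] h1z by simp
    also have "\<dots> = ap (NC (fib2_map (s, h, t)) (FO (prod_func (op_func v) u) c)) e"
    proof (rule fib2_map_ap[OF st(1), symmetric])
      show W: "FO (prod_func (op_func v) u) c \<in> Obj (prod_cat (op_cat B) A)" using FO_in_Obj[OF prof_act c] .
      show "e \<in> FO (fib2 s) (FO (prod_func (op_func v) u) c)"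
        using fib2_precomp_FO[OF st(1) c'(2,3)] e c functor_betweenD(2)[OF prof_act] c'(1) by simp
    qed
    also have "\<dots> = ap (NC (FA (precomp (prod_func (op_func v) u)) (fib2_map (s, h, t))) c) (ap (NC (fib2_cell u v s) c) z)"
      using fib2_cell_ap[OF st(1) c z] e pends(3)[OF c] by simp
    also have "\<dots> = ap (NC (Comp ?K (FA (precomp (prod_func (op_func v) u)) (fib2_map (s, h, t))) (fib2_cell u v s)) c) z"
      by (rule copsh_Comp_ap[OF fib2_cell_nt[OF st(1)] _ pnt _ c, symmetric]) (use F1 z pends in simp_all)
    finally show "ap (NC (Comp ?K (fib2_cell u v t) (fib2_map (span_pb u v s, ?h1, span_pb u v t))) c) z =
        ap (NC (Comp ?K (FA (precomp (prod_func (op_func v) u)) (fib2_map (s, h, t))) (fib2_cell u v s)) c) z" .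
  next
    show "is_nt (Comp ?K (fib2_cell u v t) (fib2_map (span_pb u v s, ?h1, span_pb u v t)))"
      using nt_Comp[OF nth1 _ fib2_cell_nt[OF st(2)], of "prod_cat (op_cat B') A'" Set] F1 by simp
    show "is_nt (Comp ?K (FA (precomp (prod_func (op_func v) u)) (fib2_map (s, h, t))) (fib2_cell u v s))"
      using nt_Comp[OF fib2_cell_nt[OF st(1)] _ pnt, of "prod_cat (op_cat B') A'" Set] F1 pends by simp
  qed (use F1 pends in simp_all)
  then show "Comp ?K (NC (Fib_cell u v) (Cod (DFib2 A B) f)) (FA (comp_func (Fib A' B') (DFib2_act u v)) f) =
      Comp ?K (FA (comp_func (precomp (prod_func (op_func v) u)) (Fib A B)) f) (NC (Fib_cell u v) (Dom (DFib2 A B) f))"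
    using h h1 st by (simp add: f' Fib_cell_NC act ends del: func_cat_simps)
qed (simp_all add: Fib_cell_def functor_betweenD(2,3)[OF u(1)] functor_betweenD(2,3)[OF v(1)])

end

text \<open>The unit of the pullback adds a tag to \<open>e\<close> and the cell removes it. The
  right side is an identity because the unitor of \<open>Prof\<close> is one.\<close>

lemma fib2_cell_unit:
  assumes A: "small_cat A" and B: "small_cat B" and s: "s \<in> Obj (DFib2 A B)"
  shows "Comp (func_cat (prod_cat (op_cat B) A) Set) (fib2_cell (id_func A) (id_func B) s)
      (fib2_map (s, pb_unit (tup s), span_pb (id_func A) (id_func B) s))
    = Ident (func_cat (prod_cat (op_cat B) A) Set) (fib2 s)"
proof (rule copsh_nt_eqI[of _ "prod_cat (op_cat B) A"])
  let ?K = "func_cat (prod_cat (op_cat B) A) Set"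
  let ?m = "fib2_map (s, pb_unit (tup s), span_pb (id_func A) (id_func B) s)"
  have i: "functor_between (id_func A) A A" "functor_between (id_func B) B B" using A B small_catD(1) by auto
  note X = fib2_functor_DFib2[OF s]
  have W: "prod_func (op_func (id_func B)) (id_func A) = id_func (prod_cat (op_cat B) A)"
    using A B by (simp add: prod_func_id small_catD)
  note m = fib2_map_nt[OF DFib2_unitor_in[OF A B s]]
  note c = fib2_cell_nt[OF i(1) A A i(2) B B s]
  show "is_nt (Comp ?K (fib2_cell (id_func A) (id_func B) s) ?m)"
    using nt_Comp[OF m _ c, of "prod_cat (op_cat B) A" Set] X by simp
  show "is_nt (Ident ?K (fib2 s))" using nt_Ident[OF X] by simp
  show "functor_between (NSrc (Comp ?K (fib2_cell (id_func A) (id_func B) s) ?m)) (prod_cat (op_cat B) A) Set"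
    using X by simp
  show "NSrc (Comp ?K (fib2_cell (id_func A) (id_func B) s) ?m) = NSrc (Ident ?K (fib2 s))" by simp
  show "NTgt (Comp ?K (fib2_cell (id_func A) (id_func B) s) ?m) = NTgt (Ident ?K (fib2 s))"
    using W comp_func_id_right[OF X] by simp
  fix z e assume z: "z \<in> Obj (prod_cat (op_cat B) A)" and "e \<in> FO (NSrc (Comp ?K (fib2_cell (id_func A) (id_func B) s) ?m)) z"
  then have e: "e \<in> FO (fib2 s) z" by simp
  then have eO: "e \<in> Obj (Src (fst s))" using z fib2_FO[OF s] by auto
  have "ap (NC ?m z) e \<in> FO (fib2 (span_pb (id_func A) (id_func B) s)) z"
    using NC_in[OF m _ z, of e] X e by simp
  then have me: "FO (pb_unit (tup s)) e \<in> FO (fib2 (span_pb (id_func A) (id_func B) s)) z"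
    using fib2_map_ap[OF s z e] by simp
  have "ap (NC (Comp ?K (fib2_cell (id_func A) (id_func B) s) ?m) z) e = ap (NC (fib2_cell (id_func A) (id_func B) s) z) (ap (NC ?m z) e)"
    by (rule copsh_Comp_ap[OF m _ c _ z]) (use X e in simp_all)
  also have "\<dots> = p2 (FO (pb_unit (tup s)) e)"
    using fib2_map_ap[OF s z e] fib2_cell_ap[OF i(1) A A i(2) B B s z me] by simp
  also have "\<dots> = ap (NC (Ident ?K (fib2 s)) z) e"
    using eO copsh_Ident_ap[OF X z e] by simp
  finally show "ap (NC (Comp ?K (fib2_cell (id_func A) (id_func B) s) ?m) z) e = ap (NC (Ident ?K (fib2 s)) z) e" .
qed

text \<open>Both sides strip two layers of tags and return \<open>p2 (p2 x)\<close>: on the left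
  \<open>pb_cmp\<close> merges the layers before the cell acts, on the right two cells act in turn.
  The compositor of \<open>Prof\<close>, an identity, is left out here.\<close>

lemma fib2_cell_comp:
  assumes u: "functor_between u A' A" "small_cat A'" "small_cat A" and v: "functor_between v B' B" "small_cat B'" "small_cat B"
    and u': "functor_between u' A'' A'" "small_cat A''" and v': "functor_between v' B'' B'" "small_cat B''"
    and s: "s \<in> Obj (DFib2 A B)"
  shows "Comp (func_cat (prod_cat (op_cat B'') A'') Set) (fib2_cell (comp_func u u') (comp_func v v') s)
      (fib2_map (span_pb u' v' (span_pb u v s), pb_cmp (prod_func u v) (prod_func u' v') (tup s),
        span_pb (comp_func u u') (comp_func v v') s))
    = Comp (func_cat (prod_cat (op_cat B'') A'') Set) (FA (precomp (prod_func (op_func v') u')) (fib2_cell u v s))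
      (fib2_cell u' v' (span_pb u v s))"
proof (rule copsh_nt_eqI[of _ "prod_cat (op_cat B'') A''"])
  let ?K = "func_cat (prod_cat (op_cat B'') A'') Set"
  let ?uu = "comp_func u u'" and ?vv = "comp_func v v'"
  let ?c = "pb_cmp (prod_func u v) (prod_func u' v') (tup s)"
  let ?m = "fib2_map (span_pb u' v' (span_pb u v s), ?c, span_pb ?uu ?vv s)"
  note uu = comp_func_functor[OF u'(1) u(1)] and vv = comp_func_functor[OF v'(1) v(1)]
  note s1 = span_pb_in_DFib2[OF u(1,2) v(1,2) s]
  note s2 = span_pb_in_DFib2[OF u' v' s1]
  note X = fib2_functor_DFib2[OF s2]
  note F1 = fib2_functor_DFib2[OF s1]
  note m = fib2_map_nt[OF DFib2_compositor_in[OF u(1,2) v(1,2) u' v' s]]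
  note c = fib2_cell_nt[OF uu u'(2) u(3) vv v'(2) v(3) s]
  note c1 = fib2_cell_nt[OF u v s]
  note c2 = fib2_cell_nt[OF u'(1,2) u(2) v'(1,2) v(2) s1]
  note W = prof_act[OF u v] and W' = prof_act[OF u'(1,2) u(2) v'(1,2) v(2)]
  let ?p = "FA (precomp (prod_func (op_func v') u')) (fib2_cell u v s)"
  have p: "is_nt ?p" "NSrc ?p = comp_func (fib2 (span_pb u v s)) (prod_func (op_func v') u')"
    "NTgt ?p = comp_func (comp_func (fib2 s) (prod_func (op_func v) u)) (prod_func (op_func v') u')"
    "\<And>z. z \<in> Obj (prod_cat (op_cat B'') A'') \<Longrightarrow> NC ?p z = NC (fib2_cell u v s) (FO (prod_func (op_func v') u') z)"
    using precomp_nt[OF W' c1] precomp_FA[OF W' c1] F1 by simp_all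
  show "is_nt (Comp ?K (fib2_cell ?uu ?vv s) ?m)"
    using nt_Comp[OF m _ c, of "prod_cat (op_cat B'') A''" Set] X by simp
  show "is_nt (Comp ?K ?p (fib2_cell u' v' (span_pb u v s)))"
    using nt_Comp[OF c2 _ p(1), of "prod_cat (op_cat B'') A''" Set] X p by simp
  show "functor_between (NSrc (Comp ?K (fib2_cell ?uu ?vv s) ?m)) (prod_cat (op_cat B'') A'') Set"
    using X by simp
  show "NSrc (Comp ?K (fib2_cell ?uu ?vv s) ?m) = NSrc (Comp ?K ?p (fib2_cell u' v' (span_pb u v s)))" by simp
  have "prod_func (op_func ?vv) ?uu = comp_func (prod_func (op_func v) u) (prod_func (op_func v') u')"
    unfolding op_func_comp
    using prod_func_comp[OF op_func_functor[OF v(1)] u(1) op_func_functor[OF v'(1)] u'(1)] by simp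
  then show "NTgt (Comp ?K (fib2_cell ?uu ?vv s) ?m) = NTgt (Comp ?K ?p (fib2_cell u' v' (span_pb u v s)))"
    using p(3) comp_func_assoc[OF W' W fib2_functor_DFib2[OF s]] by simp
  fix z x assume z: "z \<in> Obj (prod_cat (op_cat B'') A'')" and "x \<in> FO (NSrc (Comp ?K (fib2_cell ?uu ?vv s) ?m)) z"
  then have x: "x \<in> FO (fib2 (span_pb u' v' (span_pb u v s))) z" by simp
  have "x \<in> Obj (Src (fst (span_pb u' v' (span_pb u v s))))" using z x fib2_FO[OF s2] by auto
  then have cx: "FO ?c x = pair (p1 x) (p2 (p2 x))"
    using pb_func_simps(15) Src_span_pb[OF u' v' s1] tup_span_pb[OF u(1,2) v(1,2) s] by simp
  have "ap (NC ?m z) x \<in> FO (fib2 (span_pb ?uu ?vv s)) z"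
    using NC_in[OF m _ z, of x] X x by simp
  then have mx: "FO ?c x \<in> FO (fib2 (span_pb ?uu ?vv s)) z"
    using fib2_map_ap[OF s2 z x] by simp
  have "ap (NC (Comp ?K (fib2_cell ?uu ?vv s) ?m) z) x = ap (NC (fib2_cell ?uu ?vv s) z) (ap (NC ?m z) x)"
    by (rule copsh_Comp_ap[OF m _ c _ z]) (use X x in simp_all)
  also have "\<dots> = p2 (p2 x)"
    using fib2_map_ap[OF s2 z x] fib2_cell_ap[OF uu u'(2) u(3) vv v'(2) v(3) s z mx] cx by simp
  also have "\<dots> = ap (NC ?p z) (ap (NC (fib2_cell u' v' (span_pb u v s)) z) x)"
  proof -
    have "ap (NC (fib2_cell u' v' (span_pb u v s)) z) x \<in> FO (comp_func (fib2 (span_pb u v s)) (prod_func (op_func v') u')) z"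
      using NC_in[OF c2 _ z, of x] X x by simp
    then have "p2 x \<in> FO (fib2 (span_pb u v s)) (FO (prod_func (op_func v') u') z)"
      using fib2_cell_ap[OF u'(1,2) u(2) v'(1,2) v(2) s1 z x] z functor_betweenD(2)[OF W'] by simp
    then show ?thesis
      using fib2_cell_ap[OF u'(1,2) u(2) v'(1,2) v(2) s1 z x] p(4)[OF z]
        fib2_cell_ap[OF u v s FO_in_Obj[OF W' z]] by simp
  qed
  also have "\<dots> = ap (NC (Comp ?K ?p (fib2_cell u' v' (span_pb u v s))) z) x"
    by (rule copsh_Comp_ap[OF c2 _ p(1) _ z, symmetric]) (use X x p in simp_all)
  finally show "ap (NC (Comp ?K (fib2_cell ?uu ?vv s) ?m) z) x = ap (NC (Comp ?K ?p (fib2_cell u' v' (span_pb u v s))) z) x" .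
qed

lemma Prof_simps [simp]:
  "fib Prof (A, B) = func_cat (prod_cat (op_cat B) A) Set" "act Prof (u, v) = precomp (prod_func (op_func v) u)"
  by (simp_all add: Prof_def)

lemma pseudonatural_equivalence_Fib:
  "pseudonatural_equivalence (times_cat Cat Cat)
     (DFib_span :: (('u::universe) scat \<times> 'u scat, 'u sfunc \<times> 'u sfunc,
          'u span, 'u span \<times> 'u sfunc \<times> 'u span) psf) Prof (\<lambda>(A, B). Fib A B) (\<lambda>(u, v). Fib_cell u v)"
  unfolding pseudonatural_equivalence_def
proof (rule conjI[OF pseudonaturalI[OF pseudofunctor_DFib_span pseudofunctor_Prof] ballI])
  fix k :: "'u scat \<times> 'u scat" assume k: "k \<in> Obj (times_cat Cat Cat)"
  obtain A B where AB: "k = (A, B)" by (cases k)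
  have A: "small_cat A" and B: "small_cat B" using k AB by simp_all
  show "equivalence (case k of (A, B) \<Rightarrow> Fib A B)"
    and "functor_between (case k of (A, B) \<Rightarrow> Fib A B) (fib DFib_span k) (fib Prof k)"
    using equivalence_Fib[OF A B] Fib_functor[OF A B] by (simp_all add: AB)
next
  fix w :: "'u sfunc \<times> 'u sfunc" assume w: "w \<in> Arr (times_cat Cat Cat)"
  obtain u v where uv: "w = (u, v)" by (cases w)
  have "functor_between u (Src u) (Tgt u)" "small_cat (Src u)" "small_cat (Tgt u)"
    "functor_between v (Src v) (Tgt v)" "small_cat (Src v)" "small_cat (Tgt v)"
    using w uv Arr_CatD[of u] Arr_CatD[of v] by auto
  from nat_iso_Fib_cell[OF this]
  show "nat_iso (case w of (u, v) \<Rightarrow> Fib_cell u v)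
      (comp_func (case Dom (times_cat Cat Cat) w of (A, B) \<Rightarrow> Fib A B) (act DFib_span w))
      (comp_func (act Prof w) (case Cod (times_cat Cat Cat) w of (A, B) \<Rightarrow> Fib A B))"
    by (simp add: uv)
next
  fix k :: "'u scat \<times> 'u scat" and s assume k: "k \<in> Obj (times_cat Cat Cat)" and s: "s \<in> Obj (fib DFib_span k)"
  obtain A B where AB: "k = (A, B)" by (cases k)
  have A: "small_cat A" and B: "small_cat B" and s: "s \<in> Obj (DFib2 A B)" using k s AB by simp_all
  have i: "functor_between (id_func A) A A" "functor_between (id_func B) B B" using A B small_catD(1) by auto
  have "NC (unitor Prof (A, B)) (fib2 s) = Ident (func_cat (prod_cat (op_cat B) A) Set) (fib2 s)"
    using fib2_functor_DFib2[OF s] by (simp add: Prof_def id_nt_def del: func_cat_simps(5))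
  then show "Comp (fib Prof k) (NC (case Ident (times_cat Cat Cat) k of (u, v) \<Rightarrow> Fib_cell u v) s)
      (FA (case k of (A, B) \<Rightarrow> Fib A B) (NC (unitor DFib_span k) s)) =
    NC (unitor Prof k) (FO (case k of (A, B) \<Rightarrow> Fib A B) s)"
    using fib2_cell_unit[OF A B s] DFib2_unitor_in[OF A B s] s
    by (simp add: AB Fib_cell_NC[OF i(1) A A i(2) B B] DFib2_unitor_NC[OF A B] del: func_cat_simps)
next
  fix w w' :: "'u sfunc \<times> 'u sfunc" and s
  assume w: "w \<in> Arr (times_cat Cat Cat)" "w' \<in> Arr (times_cat Cat Cat)"
    "s \<in> Obj (fib DFib_span (Cod (times_cat Cat Cat) w))" "Cod (times_cat Cat Cat) w' = Dom (times_cat Cat Cat) w"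
  obtain u v u' v' where uv: "w = (u, v)" "w' = (u', v')" by (cases w; cases w')
  have u: "functor_between u (Src u) (Tgt u)" "small_cat (Src u)" "small_cat (Tgt u)"
    and v: "functor_between v (Src v) (Tgt v)" "small_cat (Src v)" "small_cat (Tgt v)"
    and u': "functor_between u' (Src u') (Src u)" "small_cat (Src u')"
    and v': "functor_between v' (Src v') (Src v)" "small_cat (Src v')"
    and s: "s \<in> Obj (DFib2 (Tgt u) (Tgt v))"
    using w uv Arr_CatD[of u] Arr_CatD[of v] Arr_CatD[of u'] Arr_CatD[of v'] by auto
  note uu = comp_func_functor[OF u'(1) u(1)] and vv = comp_func_functor[OF v'(1) v(1)]
  note s1 = span_pb_in_DFib2[OF u(1,2) v(1,2) s]
  let ?K = "func_cat (prod_cat (op_cat (Src v')) (Src u')) Set"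
  let ?W = "prod_func (op_func v) u" and ?W' = "prod_func (op_func v') u'"
  note W = prof_act[OF u v] and W' = prof_act[OF u'(1,2) u(2) v'(1,2) v(2)]
  note X = fib2_functor_DFib2[OF s] and Xw = comp_func_functor[OF W fib2_functor_DFib2[OF s]]
  have comp: "NC (compositor Prof (u, v) (u', v')) (fib2 s) = Ident ?K (comp_func (comp_func (fib2 s) ?W) ?W')"
    using X Xw precomp_FO[OF W X] precomp_FO[OF W' Xw]
    by (simp add: Prof_def id_nt_def del: func_cat_simps(5))
  let ?R = "Comp ?K (FA (precomp ?W') (fib2_cell u v s)) (fib2_cell u' v' (span_pb u v s))"
  note c1 = fib2_cell_nt[OF u v s] and c2 = fib2_cell_nt[OF u'(1,2) u(2) v'(1,2) v(2) s1]
  note F1 = fib2_functor_DFib2[OF s1] and F2 = fib2_functor_DFib2[OF span_pb_in_DFib2[OF u' v' s1]]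
  have p: "is_nt (FA (precomp ?W') (fib2_cell u v s))" "NSrc (FA (precomp ?W') (fib2_cell u v s)) = comp_func (fib2 (span_pb u v s)) ?W'"
    "NTgt (FA (precomp ?W') (fib2_cell u v s)) = comp_func (comp_func (fib2 s) ?W) ?W'"
    using precomp_nt[OF W' c1] precomp_FA[OF W' c1] F1 by simp_all
  have R: "?R \<in> Arr ?K" "Cod ?K ?R = comp_func (comp_func (fib2 s) ?W) ?W'"
    using nt_Comp[OF c2 _ p(1), of "prod_cat (op_cat (Src v')) (Src u')" Set] F2 p by simp_all
  have K: "category ?K"
    using u' v' by (intro category_func_cat category_prod_cat category_Set) (simp_all add: small_catD)
  \<comment> \<open>Absorbs the identity compositor of \<open>Prof\<close> that the composition law
    contains, so that \<open>fib2_cell_comp\<close> applies.\<close>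
  have R': "Comp ?K (Ident ?K (comp_func (comp_func (fib2 s) ?W) ?W')) ?R = ?R"
    by (rule Comp_Ident_left[OF K R])
  show "Comp (fib Prof (Dom (times_cat Cat Cat) w')) (NC (case Comp (times_cat Cat Cat) w w' of (u, v) \<Rightarrow> Fib_cell u v) s)
      (FA (case Dom (times_cat Cat Cat) w' of (A, B) \<Rightarrow> Fib A B) (NC (compositor DFib_span w w') s)) =
    Comp (fib Prof (Dom (times_cat Cat Cat) w'))
      (NC (compositor Prof w w') (FO (case Cod (times_cat Cat Cat) w of (A, B) \<Rightarrow> Fib A B) s))
      (Comp (fib Prof (Dom (times_cat Cat Cat) w')) (FA (act Prof w') (NC (case w of (u, v) \<Rightarrow> Fib_cell u v) s))
        (NC (case w' of (u, v) \<Rightarrow> Fib_cell u v) (FO (act DFib_span w) s)))"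
    using fib2_cell_comp[OF u v u' v' s] R' comp DFib2_compositor_in[OF u(1,2) v(1,2) u' v' s] s s1
    by (simp add: uv Fib_cell_NC[OF u v] Fib_cell_NC[OF uu u'(2) u(3) vv v'(2) v(3)]
        Fib_cell_NC[OF u'(1,2) u(2) v'(1,2) v(2)] DFib2_compositor_NC[OF u(1,2) v(1,2) u' v']
        DFib2_act_simps[OF u(1,2) v(1,2)] del: func_cat_simps)
qed

theorem theorem2p3p2:
  "\<exists>\<Phi> \<theta> \<Psi> \<zeta>.
     pseudonatural_equivalence (times_cat Cat Cat)
       (DFib_span :: (('u::universe) scat \<times> 'u scat, 'u sfunc \<times> 'u sfunc,
          'u span, 'u span \<times> 'u sfunc \<times> 'u span) psf) Prof \<Phi> \<theta> \<and>
     pseudonatural_equivalence (times_cat Cat Cat)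
       (Prof :: ('u scat \<times> 'u scat, 'u sfunc \<times> 'u sfunc, 'u copsh, 'u copsh_nt) psf)
       DFib_prod \<Psi> \<zeta>"
  \<comment> \<open>The witnesses are \<open>Fib\<close> with \<open>Fib_cell\<close>, and
    \<open>El\<close> with \<open>El_cell\<close> evaluated at the images under
    \<open>twist\<close>.\<close>
  using pseudonatural_equivalence_Fib
    pseudonatural_equivalence_reindex[OF pseudonatural_equivalence_El twist_functor reindexes_Prof reindexes_DFib_prod]
  by blast

end
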